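(* The functor $\mathfrak{Sl}:\mathrm{RadHausSpc}_{glob}\rightarrow\mathrm{Loc}$, $(X,\mu)\mapsto\mathfrak{Sl}(X)$, lifts (along the functor $\mathrm{MeasLoc}_{glob}\to\mathrm{Loc}$ forgetting the measure) to a functor $$\mathfrak{Sl}:\mathrm{RadHausSpc}_{glob}\rightarrow\mathrm{MeasLoc}_{glob},\qquad (X,\mu)\mapsto(\mathfrak{Sl}(X),\mu_* ).$$
   Context: Locales: A frame is a poset with arbitrary suprema and finite infima satisfying $V\wedge\bigvee_i U_i=\bigvee_i(V\wedge U_i)$; frame homomorphisms preserve arbitrary suprema and finite infima; $\mathrm{Loc}$ is the opposite category of frames, $\mathcal{O}(L)$ is the frame of $L$, and a continuous map $f:L\to M$ is a frame homomorphism $f^*:\mathcal{O}(M)\to\mathcal{O}(L)$. Hausdorff spaces are identified with the locales of their frames of opens. A locale is Boolean if every open has a complement. A measure on $L$ is a monotone map $\nu:\mathcal{O}(L)\to[0,\infty]$ with $\nu(0)=0$, $\nu(U)+\nu(V)=\nu(U\vee V)+\nu(U\wedge V)$, and $\nu(\bigvee_iU_i)=\sup_i\nu(U_i)$ for directed families. The pushforward along $f$ is $f_*\nu(U)=\nu(f^*(U))$. $\mathrm{MeasLoc}_{glob}$ is the category of locales equipped with measures and (globally defined) continuous maps $f:(L,\nu)\to(M,\nu')$ with $f_*\nu=\nu'$. Sublocales: a sublocale of $L$ is a subset $S\subset\mathcal{O}(L)$ that is a frame in the induced order and whose inclusion is right adjoint to a frame homomorphism $\mathcal{O}(L)\to S$.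 The poset $\mathrm{Sl}(L)$ of sublocales ordered by inclusion is a coframe; $\mathfrak{Sl}(L)$ is the locale with frame $\mathrm{Sl}(L)^{op}$. There is a natural map $\mathrm{can}:\mathfrak{Sl}(L)\to L$ with $\mathrm{can}^*(U)=U^c=\{V\mid U\le V\}$ (the closed sublocale complementary to $U$). A continuous map $f:L\to M$ induces $\mathfrak{Sl}(f)$, given by taking preimages (pullbacks) of sublocales. If $f:M\to L$ is continuous and $f^*(U)$ is complemented for every open $U$ of $L$ (e.g. $M$ Boolean), there is a unique lift $\tilde f:M\to\mathfrak{Sl}(L)$ with $\mathrm{can}\circ\tilde f=f$. Radon valuations: for a Hausdorff space $X$, $\mathcal{K}(X)$ is the lattice of compact subsets. A Radon valuation is a map $\mu:\mathcal{K}(X)\to[0,\infty)$ that is monotone, with $\mu(\emptyset)=0$, $\mu(C)+\mu(D)=\mu(C\cup D)+\mu(C\cap D)$, and almost Boolean: for any compact $C$, any ascending sequence of compacts $C_0\subset C_1\subset\cdots\subset C$ and any $\epsilon>0$ there are $N\in\mathbb{N}$ and a compact $D\subset C$ with $\mu(D\cap C_n)=0$ for all $n$ and $\mu(C)-\mu(D\cup C_N)<\epsilon$. A $\mu$-ideal is a downward closed $U\subset\mathcal{K}(X)$ such that $K\in U$ whenever there are $K_i\in U$ $(i\in I)$, $K_i\subset K$, such that for all $\epsilon>0$ some finite $F\subset I$ has $\mu(K)-\mu(\bigcup_{i\in F}K_i)<\epsilon$. The $\mu$-ideals ordered by inclusion form the frame of a locale $X^\mu$, which is Boolean and carries the inner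 measure $\mu_*(U)=\sup_{K\in U}\mu(K)$. The map $p_\mu:X^\mu\to X$ is given by sending an open $V\subset X$ to the smallest $\mu$-ideal containing $\{K\subset V\mid K\text{ compact}\}$. Let $\tilde p:X^\mu\to\mathfrak{Sl}(X)$ be its unique lift along $\mathrm{can}$; the measure $\mu_*$ on $\mathfrak{Sl}(X)$ is the pushforward along $\tilde p$ of the inner measure on $X^\mu$. $\mathrm{RadHausSpc}_{glob}$ is the category of pairs $(X,\mu)$, $X$ a Hausdorff space with Radon valuation $\mu$, whose morphisms $(X,\mu)\to(Y,\nu)$ are the (globally defined) continuous maps $f:X\to Y$ that are proper ($f^{-1}(K)$ compact for $K\subset Y$ compact) and measure-preserving ($\mu(f^{-1}(K))=\nu(K)$ for all compact $K\subset Y$). *)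

theory Defs
  imports "HOL-Analysis.Analysis" "HOL-Algebra.Galois_Connection"
begin

section \<open>Categories and functors\<close>

text \<open>An arrow is only meaningful together with its source and target, so homsets, composition
  and the action of a functor on arrows carry these objects as arguments:
  \<open>Comp C a b c g f\<close> is the composite of \<open>f : a \<rightarrow> b\<close> and \<open>g : b \<rightarrow> c\<close>.\<close>

record ('o, 'm) cat =
  Obj :: "'o set"
  Hom :: "'o \<Rightarrow> 'o \<Rightarrow> 'm set"
  Ident :: "'o \<Rightarrow> 'm"
  Comp :: "'o \<Rightarrow> 'o \<Rightarrow> 'o \<Rightarrow> 'm \<Rightarrow> 'm \<Rightarrow> 'm"

definition is_category :: "('o, 'm) cat \<Rightarrow> bool" where
  "is_category C \<longleftrightarrow>
     (\<forall>a\<in>Obj C. Ident C a \<in> Hom C a a) \<and>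
     (\<forall>a\<in>Obj C. \<forall>b\<in>Obj C. \<forall>c\<in>Obj C. \<forall>f\<in>Hom C a b. \<forall>g\<in>Hom C b c.
        Comp C a b c g f \<in> Hom C a c) \<and>
     (\<forall>a\<in>Obj C. \<forall>b\<in>Obj C. \<forall>f\<in>Hom C a b.
        Comp C a a b f (Ident C a) = f \<and> Comp C a b b (Ident C b) f = f) \<and>
     (\<forall>a\<in>Obj C. \<forall>b\<in>Obj C. \<forall>c\<in>Obj C. \<forall>d\<in>Obj C.
        \<forall>f\<in>Hom C a b. \<forall>g\<in>Hom C b c. \<forall>h\<in>Hom C c d.
          Comp C a b d (Comp C b c d h g) f = Comp C a c d h (Comp C a b c g f))"

record ('o, 'm, 'p, 'n) fctor =
  on_obj :: "'o \<Rightarrow> 'p"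
  on_arr :: "'o \<Rightarrow> 'o \<Rightarrow> 'm \<Rightarrow> 'n"

definition is_functor ::
    "('o, 'm) cat \<Rightarrow> ('p, 'n) cat \<Rightarrow> ('o, 'm, 'p, 'n) fctor \<Rightarrow> bool" where
  "is_functor C D F \<longleftrightarrow>
     is_category C \<and> is_category D \<and>
     (\<forall>a\<in>Obj C. on_obj F a \<in> Obj D) \<and>
     (\<forall>a\<in>Obj C. \<forall>b\<in>Obj C. \<forall>f\<in>Hom C a b. on_arr F a b f \<in> Hom D (on_obj F a) (on_obj F b)) \<and>
     (\<forall>a\<in>Obj C. on_arr F a a (Ident C a) = Ident D (on_obj F a)) \<and>
     (\<forall>a\<in>Obj C. \<forall>b\<in>Obj C. \<forall>c\<in>Obj C. \<forall>f\<in>Hom C a b. \<forall>g\<in>Hom C b c.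
        on_arr F a c (Comp C a b c g f)
          = Comp D (on_obj F a) (on_obj F b) (on_obj F c) (on_arr F b c g) (on_arr F a b f))"

text \<open>\<open>F : A \<rightarrow> B\<close> lifts \<open>G : A \<rightarrow> C\<close> along \<open>U : B \<rightarrow> C\<close>, that is \<open>U \<circ> F = G\<close> strictly.\<close>

definition lifts_along ::
    "('o, 'm) cat \<Rightarrow> ('p, 'n) cat \<Rightarrow> ('q, 'l) cat \<Rightarrow> ('p, 'n, 'q, 'l) fctor
      \<Rightarrow> ('o, 'm, 'q, 'l) fctor \<Rightarrow> ('o, 'm, 'p, 'n) fctor \<Rightarrow> bool" where
  "lifts_along A B C U G F \<longleftrightarrow>
     is_functor A B F \<and> is_functor B C U \<and> is_functor A C G \<and>
     (\<forall>a\<in>Obj A. on_obj U (on_obj F a) = on_obj G a) \<and>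
     (\<forall>a\<in>Obj A. \<forall>b\<in>Obj A. \<forall>f\<in>Hom A a b.
        on_arr U (on_obj F a) (on_obj F b) (on_arr F a b f) = on_arr G a b f)"

text \<open>The square \<open>f \<circ> p = g \<circ> q\<close> with \<open>f : a \<rightarrow> d\<close>, \<open>g : b \<rightarrow> d\<close>, \<open>p : c \<rightarrow> a\<close>, \<open>q : c \<rightarrow> b\<close>
  is a pullback.\<close>

definition is_pullback ::
    "('o, 'm) cat \<Rightarrow> 'o \<Rightarrow> 'o \<Rightarrow> 'o \<Rightarrow> 'o \<Rightarrow> 'm \<Rightarrow> 'm \<Rightarrow> 'm \<Rightarrow> 'm \<Rightarrow> bool" where
  "is_pullback C a b d c f g p q \<longleftrightarrow>
     p \<in> Hom C c a \<and> q \<in> Hom C c b \<and> Comp C c a d f p = Comp C c b d g q \<and>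
     (\<forall>n\<in>Obj C. \<forall>u\<in>Hom C n a. \<forall>v\<in>Hom C n b. Comp C n a d f u = Comp C n b d g v \<longrightarrow>
        (\<exists>!k. k \<in> Hom C n c \<and> Comp C n c a p k = u \<and> Comp C n c b q k = v))"


section \<open>Frames and locales\<close>

text \<open>A locale (in the sense of point-free topology) is represented by its frame of opens, an
  ordered structure with explicit carrier.\<close>

locale frame = complete_lattice L for L (structure) +
  assumes meet_Sup_distrib:
    "\<lbrakk>V \<in> carrier L; A \<subseteq> carrier L\<rbrakk> \<Longrightarrow> V \<sqinter> \<Squnion>A = \<Squnion>((\<lambda>U. V \<sqinter> U) ` A)"

definition frame_hom :: "'a gorder \<Rightarrow> 'b gorder \<Rightarrow> ('a \<Rightarrow> 'b) \<Rightarrow> bool" where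
  "frame_hom L M h \<longleftrightarrow>
     h \<in> carrier L \<rightarrow>\<^sub>E carrier M \<and>
     (\<forall>A\<subseteq>carrier L. h (\<Squnion>\<^bsub>L\<^esub>A) = \<Squnion>\<^bsub>M\<^esub>(h ` A)) \<and>
     (\<forall>A\<subseteq>carrier L. finite A \<longrightarrow> h (\<Sqinter>\<^bsub>L\<^esub>A) = \<Sqinter>\<^bsub>M\<^esub>(h ` A))"

text \<open>The category of locales whose opens are elements of the type \<open>'a\<close>. A continuous map
  \<open>f : L \<rightarrow> M\<close> is represented by the frame homomorphism \<open>f\<^sup>*\<close> from \<open>M\<close> to \<open>L\<close>.\<close>

definition Loc :: "('a gorder, 'a \<Rightarrow> 'a) cat" where
  "Loc = \<lparr>Obj = {L. frame L},
          Hom = (\<lambda>L M. {h. frame_hom M L h}),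
          Ident = (\<lambda>L. \<lambda>U\<in>carrier L. U),
          Comp = (\<lambda>L M N g f. \<lambda>W\<in>carrier N. f (g W))\<rparr>"

definition opens :: "'a topology \<Rightarrow> 'a set gorder" where
  "opens X = \<lparr>carrier = {U. openin X U}, eq = (=), le = (\<subseteq>)\<rparr>"

definition opens_map :: "'a topology \<Rightarrow> 'b topology \<Rightarrow> ('a \<Rightarrow> 'b) \<Rightarrow> 'b set \<Rightarrow> 'a set" where
  "opens_map X Y f = (\<lambda>V\<in>carrier (opens Y). {x \<in> topspace X. f x \<in> V})"


section \<open>Sublocales\<close>

definition sub_order :: "'a gorder \<Rightarrow> 'a set \<Rightarrow> 'a gorder" where
  "sub_order L S = L\<lparr>carrier := S\<rparr>"

text \<open>\<open>h\<close> is a frame homomorphism from \<open>L\<close> to \<open>S\<close> to which the inclusion of \<open>S\<close> is right adjoint.\<close>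

definition reflects_onto :: "'a gorder \<Rightarrow> 'a set \<Rightarrow> ('a \<Rightarrow> 'a) \<Rightarrow> bool" where
  "reflects_onto L S h \<longleftrightarrow>
     frame_hom L (sub_order L S) h \<and>
     galois_connection \<lparr>orderA = L, orderB = sub_order L S, lower = h, upper = (\<lambda>V. V)\<rparr>"

definition is_sublocale :: "'a gorder \<Rightarrow> 'a set \<Rightarrow> bool" where
  "is_sublocale L S \<longleftrightarrow>
     S \<subseteq> carrier L \<and> frame (sub_order L S) \<and> (\<exists>h. reflects_onto L S h)"

text \<open>The continuous inclusion \<open>S \<rightarrow> L\<close> of a sublocale, as an arrow of \<open>Loc\<close>; the left adjoint is
  unique.\<close>

definition incl :: "'a gorder \<Rightarrow> 'a set \<Rightarrow> 'a \<Rightarrow> 'a" where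
  "incl L S = (THE h. reflects_onto L S h)"

definition Sl_coframe :: "'a gorder \<Rightarrow> 'a set gorder" where
  "Sl_coframe L = \<lparr>carrier = {S. is_sublocale L S}, eq = (=), le = (\<subseteq>)\<rparr>"

definition Sl :: "'a gorder \<Rightarrow> 'a set gorder" where
  "Sl L = inv_gorder (Sl_coframe L)"

definition can :: "'a gorder \<Rightarrow> 'a \<Rightarrow> 'a set" where
  "can L = (\<lambda>U\<in>carrier L. {V \<in> carrier L. U \<sqsubseteq>\<^bsub>L\<^esub> V})"

text \<open>The preimage of the sublocale \<open>T\<close> of \<open>M\<close> along \<open>f : L \<rightarrow> M\<close>, that is the sublocale of \<open>L\<close>
  which is the pullback of \<open>T\<close> along \<open>f\<close> in \<open>Loc\<close>.\<close>

definition preimage :: "'a gorder \<Rightarrow> 'a gorder \<Rightarrow> ('a \<Rightarrow> 'a) \<Rightarrow> 'a set \<Rightarrow> 'a set" where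
  "preimage L M f T =
     (THE S. is_sublocale L S \<and>
        (\<exists>q. is_pullback Loc L (sub_order M T) M (sub_order L S) f (incl M T) (incl L S) q))"

definition Sl_map :: "'a gorder \<Rightarrow> 'a gorder \<Rightarrow> ('a \<Rightarrow> 'a) \<Rightarrow> 'a set \<Rightarrow> 'a set" where
  "Sl_map L M f = (\<lambda>T\<in>carrier (Sl M). preimage L M f T)"

text \<open>The unique lift of \<open>f : M \<rightarrow> L\<close> through \<open>can : Sl L \<rightarrow> L\<close>; it exists whenever all \<open>f\<^sup>*(U)\<close> are
  complemented.\<close>

definition Sl_lift :: "'a gorder \<Rightarrow> 'b gorder \<Rightarrow> ('a \<Rightarrow> 'b) \<Rightarrow> 'a set \<Rightarrow> 'b" where
  "Sl_lift L M f =
     (THE h. frame_hom (Sl L) M h \<and> (\<forall>U\<in>carrier L. h (can L U) = f U))"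


section \<open>Measures on locales\<close>

definition directed_in :: "'a gorder \<Rightarrow> 'a set \<Rightarrow> bool" where
  "directed_in L D \<longleftrightarrow>
     D \<subseteq> carrier L \<and> D \<noteq> {} \<and> (\<forall>U\<in>D. \<forall>V\<in>D. \<exists>W\<in>D. U \<sqsubseteq>\<^bsub>L\<^esub> W \<and> V \<sqsubseteq>\<^bsub>L\<^esub> W)"

definition is_loc_measure :: "'a gorder \<Rightarrow> ('a \<Rightarrow> ennreal) \<Rightarrow> bool" where
  "is_loc_measure L \<nu> \<longleftrightarrow>
     \<nu> \<in> extensional (carrier L) \<and>
     (\<forall>U\<in>carrier L. \<forall>V\<in>carrier L. U \<sqsubseteq>\<^bsub>L\<^esub> V \<longrightarrow> \<nu> U \<le> \<nu> V) \<and>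
     \<nu> \<bottom>\<^bsub>L\<^esub> = 0 \<and>
     (\<forall>U\<in>carrier L. \<forall>V\<in>carrier L. \<nu> U + \<nu> V = \<nu> (U \<squnion>\<^bsub>L\<^esub> V) + \<nu> (U \<sqinter>\<^bsub>L\<^esub> V)) \<and>
     (\<forall>D. directed_in L D \<longrightarrow> \<nu> (\<Squnion>\<^bsub>L\<^esub>D) = (SUP U\<in>D. \<nu> U))"

text \<open>Pushforward to \<open>M\<close> along the continuous map given by \<open>f\<close>, a frame homomorphism out of \<open>M\<close>.\<close>

definition pushforward :: "'b gorder \<Rightarrow> ('b \<Rightarrow> 'a) \<Rightarrow> ('a \<Rightarrow> ennreal) \<Rightarrow> 'b \<Rightarrow> ennreal" where
  "pushforward M f \<nu> = (\<lambda>U\<in>carrier M. \<nu> (f U))"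

definition MeasLoc_glob :: "('a gorder \<times> ('a \<Rightarrow> ennreal), 'a \<Rightarrow> 'a) cat" where
  "MeasLoc_glob =
     \<lparr>Obj = {(L, \<nu>). frame L \<and> is_loc_measure L \<nu>},
      Hom = (\<lambda>(L, \<nu>) (M, \<nu>'). {f \<in> Hom Loc L M. pushforward M f \<nu> = \<nu>'}),
      Ident = (\<lambda>(L, \<nu>). Ident Loc L),
      Comp = (\<lambda>(L, _) (M, _) (N, _). Comp Loc L M N)\<rparr>"

definition forget_measure ::
    "('a gorder \<times> ('a \<Rightarrow> ennreal), 'a \<Rightarrow> 'a, 'a gorder, 'a \<Rightarrow> 'a) fctor" where
  "forget_measure = \<lparr>on_obj = fst, on_arr = (\<lambda>_ _ f. f)\<rparr>"


section \<open>Radon valuations\<close>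

definition is_radon_valuation :: "'a topology \<Rightarrow> ('a set \<Rightarrow> real) \<Rightarrow> bool" where
  "is_radon_valuation X \<mu> \<longleftrightarrow>
     \<mu> \<in> {K. compactin X K} \<rightarrow>\<^sub>E {0..} \<and>
     (\<forall>C D. compactin X C \<longrightarrow> compactin X D \<longrightarrow> C \<subseteq> D \<longrightarrow> \<mu> C \<le> \<mu> D) \<and>
     \<mu> {} = 0 \<and>
     (\<forall>C D. compactin X C \<longrightarrow> compactin X D \<longrightarrow> \<mu> C + \<mu> D = \<mu> (C \<union> D) + \<mu> (C \<inter> D)) \<and>
     (\<forall>C Cs \<epsilon>. compactin X C \<longrightarrow> (\<forall>n::nat. compactin X (Cs n) \<and> Cs n \<subseteq> Cs (Suc n) \<and> Cs n \<subseteq> C) \<longrightarrow>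
        \<epsilon> > 0 \<longrightarrow>
        (\<exists>N D. compactin X D \<and> D \<subseteq> C \<and> (\<forall>n. \<mu> (D \<inter> Cs n) = 0) \<and> \<mu> C - \<mu> (D \<union> Cs N) < \<epsilon>))"

definition is_mu_ideal :: "'a topology \<Rightarrow> ('a set \<Rightarrow> real) \<Rightarrow> 'a set set \<Rightarrow> bool" where
  "is_mu_ideal X \<mu> I \<longleftrightarrow>
     I \<subseteq> {K. compactin X K} \<and>
     (\<forall>K\<in>I. \<forall>K'. compactin X K' \<longrightarrow> K' \<subseteq> K \<longrightarrow> K' \<in> I) \<and>
     (\<forall>K. compactin X K \<longrightarrow>
        (\<exists>\<A>\<subseteq>I. (\<forall>C\<in>\<A>. C \<subseteq> K) \<and>
           (\<forall>\<epsilon>>0. \<exists>\<F>\<subseteq>\<A>. finite \<F> \<and> \<mu> K - \<mu> (\<Union>\<F>) < \<epsilon>)) \<longrightarrow>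
        K \<in> I)"

definition mu_locale :: "'a topology \<Rightarrow> ('a set \<Rightarrow> real) \<Rightarrow> 'a set set gorder" where
  "mu_locale X \<mu> = \<lparr>carrier = {I. is_mu_ideal X \<mu> I}, eq = (=), le = (\<subseteq>)\<rparr>"

definition inner_measure :: "'a topology \<Rightarrow> ('a set \<Rightarrow> real) \<Rightarrow> 'a set set \<Rightarrow> ennreal" where
  "inner_measure X \<mu> = (\<lambda>I\<in>carrier (mu_locale X \<mu>). SUP K\<in>I. ennreal (\<mu> K))"

definition mu_proj :: "'a topology \<Rightarrow> ('a set \<Rightarrow> real) \<Rightarrow> 'a set \<Rightarrow> 'a set set" where
  "mu_proj X \<mu> = (\<lambda>V\<in>carrier (opens X). is_mu_ideal X \<mu> hull {K. compactin X K \<and> K \<subseteq> V})"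

definition Sl_measure :: "'a topology \<Rightarrow> ('a set \<Rightarrow> real) \<Rightarrow> 'a set set \<Rightarrow> ennreal" where
  "Sl_measure X \<mu> =
     pushforward (Sl (opens X)) (Sl_lift (opens X) (mu_locale X \<mu>) (mu_proj X \<mu>))
       (inner_measure X \<mu>)"


section \<open>The category of Radon Hausdorff spaces\<close>

text \<open>The type \<open>'a\<close> plays the role of the universe: objects are the spaces whose points are
  elements of \<open>'a\<close>.\<close>

definition RadHausSpc_glob :: "('a topology \<times> ('a set \<Rightarrow> real), 'a \<Rightarrow> 'a) cat" where
  "RadHausSpc_glob =
     \<lparr>Obj = {(X, \<mu>). Hausdorff_space X \<and> is_radon_valuation X \<mu>},
      Hom = (\<lambda>(X, \<mu>) (Y, \<nu>). {f \<in> extensional (topspace X). continuous_map X Y f \<and>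
               (\<forall>K. compactin Y K \<longrightarrow> compactin X {x \<in> topspace X. f x \<in> K}) \<and>
               (\<forall>K. compactin Y K \<longrightarrow> \<mu> {x \<in> topspace X. f x \<in> K} = \<nu> K)}),
      Ident = (\<lambda>(X, \<mu>). \<lambda>x\<in>topspace X. x),
      Comp = (\<lambda>(X, _) _ _ g f. compose (topspace X) g f)\<rparr>"

definition Sl_functor ::
    "('a topology \<times> ('a set \<Rightarrow> real), 'a \<Rightarrow> 'a, 'a set set gorder, 'a set set \<Rightarrow> 'a set set) fctor" where
  "Sl_functor =
     \<lparr>on_obj = (\<lambda>(X, \<mu>). Sl (opens X)),
      on_arr = (\<lambda>(X, _) (Y, _) f. Sl_map (opens X) (opens Y) (opens_map X Y f))\<rparr>"

end

theory Submission
  imports Defs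
begin

text \<open>
  The main point is that a proper measure-preserving map \<open>f\<close> from \<open>(X, \<mu>)\<close> to \<open>(Y, \<nu>)\<close> also
  acts on the Boolean locales of ideals. A \<open>\<nu>\<close>-ideal \<open>I\<close> is sent to the \<open>\<mu>\<close>-ideal generated by
  the compact sets inside some \<open>f\<^sup>-\<^sup>1(K)\<close> with \<open>K \<in> I\<close>; properness makes \<open>f\<^sup>-\<^sup>1(K)\<close> compact. This
  assignment \<open>pull\<close> is a frame homomorphism (\<open>frame_map_pull\<close>), it preserves the inner measures
  because \<open>\<mu>(f\<^sup>-\<^sup>1(K)) = \<nu>(K)\<close> (\<open>inner_measure_pull\<close>), and it lies over \<open>f\<close> because it
  sends the ideal of an open \<open>V\<close> to the ideal of \<open>f\<^sup>-\<^sup>1(V)\<close> (\<open>pull_mu_proj\<close>).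

  It remains to compare the lifts to the locales of sublocales. A frame homomorphism out of \<open>Sl L\<close>
  is determined by its values on the closed sublocales \<open>can L U\<close> (\<open>frame_hom_Sl_unique\<close>): the open
  sublocales are their complements, and every sublocale is an intersection of joins of a closed and
  an open one. Both ways around the square formed by \<open>pull\<close>, the two lifts and the preimage of
  sublocales send \<open>can\<close> of \<open>V\<close> to the ideal of \<open>f\<^sup>-\<^sup>1(V)\<close>, so the square commutes, and comparing
  measures along it gives \<open>pushforward_Sl_measure\<close>.

  Everything else provides the objects in this argument. A sublocale is a subset closed under infima
  and under \<open>U \<Rrightarrow> _\<close> (\<open>sublocale_of_iff\<close>). In these terms the frame of sublocales has explicit
  operations, and the pullback of a sublocale \<open>T\<close> along \<open>f\<close> is
  \<open>{V. \<forall>U. f\<^sub>*(U \<Rrightarrow> V) \<in> T}\<close>, where \<open>f\<^sub>*\<close> is the right adjoint of the frame homomorphism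
  (\<open>preimage_eq\<close>). From this formula the preimage is visibly functorial and preserves
  intersections; that it preserves binary joins (\<open>preim_join\<close>) is the one step that needs an
  argument. The lift to a Boolean frame \<open>B\<close> exists because each sublocale of \<open>B\<close> is closed, so that
  it is given by its least element (\<open>frame_hom_Inf\<close>). Finally the ideals of a Radon valuation form
  a Boolean frame, which is where the almost Boolean axiom enters (\<open>null_part_cover\<close>).
\<close>

section \<open>Frames, Heyting implication and frame homomorphisms\<close>

definition heyting :: "('a, 'b) gorder_scheme \<Rightarrow> 'a \<Rightarrow> 'a \<Rightarrow> 'a" (infixr \<open>\<Rrightarrow>\<index>\<close> 66) where
  "U \<Rrightarrow>\<^bsub>L\<^esub> V = \<Squnion>\<^bsub>L\<^esub>{W \<in> carrier L. W \<sqinter>\<^bsub>L\<^esub> U \<sqsubseteq>\<^bsub>L\<^esub> V}"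

text \<open>The right adjoint of the frame homomorphism \<open>f\<close> of a continuous map from \<open>L\<close> to \<open>M\<close>.\<close>

definition direct_image :: "'a gorder \<Rightarrow> 'b gorder \<Rightarrow> ('b \<Rightarrow> 'a) \<Rightarrow> 'a \<Rightarrow> 'b" where
  "direct_image L M f V = \<Squnion>\<^bsub>M\<^esub>{W \<in> carrier M. f W \<sqsubseteq>\<^bsub>L\<^esub> V}"

context partial_order
begin

lemma sup_eqI:
  assumes "A \<subseteq> carrier L" "s \<in> carrier L" "\<And>a. a \<in> A \<Longrightarrow> a \<sqsubseteq> s"
    "\<And>y. \<lbrakk>y \<in> carrier L; \<And>a. a \<in> A \<Longrightarrow> a \<sqsubseteq> y\<rbrakk> \<Longrightarrow> s \<sqsubseteq> y"
  shows "\<Squnion>A = s"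
proof -
  have "least L s (Upper L A)"
    unfolding least_def Upper_def using assms(1-3) by (auto intro!: assms(4))
  then show ?thesis
    unfolding Lattice.sup_def by (metis least_unique someI)
qed

lemma inf_eqI:
  assumes "A \<subseteq> carrier L" "s \<in> carrier L" "\<And>a. a \<in> A \<Longrightarrow> s \<sqsubseteq> a"
    "\<And>y. \<lbrakk>y \<in> carrier L; \<And>a. a \<in> A \<Longrightarrow> y \<sqsubseteq> a\<rbrakk> \<Longrightarrow> y \<sqsubseteq> s"
  shows "\<Sqinter>A = s"
proof -
  have "greatest L s (Lower L A)"
    unfolding greatest_def Lower_def using assms(1-3) by (auto intro!: assms(4))
  then show ?thesis
    unfolding Lattice.inf_def by (metis greatest_unique someI)
qed

lemma eq_by_lower:
  assumes "x \<in> carrier L" "y \<in> carrier L" "\<And>z. z \<in> carrier L \<Longrightarrow> z \<sqsubseteq> x \<longleftrightarrow> z \<sqsubseteq> y"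
  shows "x = y"
  using assms by (meson le_antisym le_refl)

lemma complete_lattice_by_infs:
  assumes "\<And>A. A \<subseteq> carrier L \<Longrightarrow> \<exists>i. greatest L i (Lower L A)"
  shows "complete_lattice L"
proof (rule complete_lattice_criterion1)
  show "\<exists>g. greatest L g (carrier L)"
    using assms[of "{}"] by simp
qed (use assms in blast)

lemma complete_lattice_by_sups:
  assumes "\<And>A. A \<subseteq> carrier L \<Longrightarrow> \<exists>s. least L s (Upper L A)"
  shows "complete_lattice L"
proof (rule complete_latticeI)
  fix A assume A: "A \<subseteq> carrier L"
  obtain s where s: "least L s (Upper L (Lower L A))"
    using assms[of "Lower L A"] by auto
  have "greatest L s (Lower L A)"
    unfolding greatest_def
  proof (intro conjI ballI)
    show "s \<in> Lower L A"
    proof (rule Lower_memI)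
      fix a assume "a \<in> A"
      then have "a \<in> Upper L (Lower L A)"
        using A by (intro Upper_memI) auto
      with s show "s \<sqsubseteq> a" by (rule least_le)
    qed (use s in auto)
    show "x \<sqsubseteq> s" if "x \<in> Lower L A" for x
      using least_Upper_above[OF s that] by simp
  qed simp
  then show "\<exists>i. greatest L i (Lower L A)" ..
qed (use assms in blast)

end

context complete_lattice
begin

lemma top_eqI: "\<lbrakk>t \<in> carrier L; \<And>x. x \<in> carrier L \<Longrightarrow> x \<sqsubseteq> t\<rbrakk> \<Longrightarrow> \<top> = t"
  by (metis le_antisym weak.top_closed weak.top_higher)

lemma inf_empty: "\<Sqinter>{} = \<top>"
  by (intro inf_eqI) auto

lemma sup_empty: "\<Squnion>{} = \<bottom>"
  by (intro sup_eqI) auto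

lemma inf_insert: "\<lbrakk>a \<in> carrier L; A \<subseteq> carrier L\<rbrakk> \<Longrightarrow> \<Sqinter>(insert a A) = a \<sqinter> \<Sqinter>A"
  using weak.weak_inf_insert eq_is_equal by metis

lemma le_meet_iff:
  "\<lbrakk>x \<in> carrier L; y \<in> carrier L; z \<in> carrier L\<rbrakk> \<Longrightarrow> z \<sqsubseteq> x \<sqinter> y \<longleftrightarrow> z \<sqsubseteq> x \<and> z \<sqsubseteq> y"
  by (meson le_trans meet_closed meet_le meet_left meet_right)

lemma join_le_iff:
  "\<lbrakk>x \<in> carrier L; y \<in> carrier L; z \<in> carrier L\<rbrakk> \<Longrightarrow> x \<squnion> y \<sqsubseteq> z \<longleftrightarrow> x \<sqsubseteq> z \<and> y \<sqsubseteq> z"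
  by (meson le_trans join_closed join_le join_left join_right)

lemma sup_le_iff: "\<lbrakk>A \<subseteq> carrier L; z \<in> carrier L\<rbrakk> \<Longrightarrow> \<Squnion>A \<sqsubseteq> z \<longleftrightarrow> (\<forall>a\<in>A. a \<sqsubseteq> z)"
  by (meson le_trans weak.sup_closed sup_least sup_upper subsetD)

lemma le_inf_iff: "\<lbrakk>A \<subseteq> carrier L; z \<in> carrier L\<rbrakk> \<Longrightarrow> z \<sqsubseteq> \<Sqinter>A \<longleftrightarrow> (\<forall>a\<in>A. z \<sqsubseteq> a)"
  by (meson le_trans weak.inf_closed inf_greatest inf_lower subsetD)

lemma top_meet: "x \<in> carrier L \<Longrightarrow> \<top> \<sqinter> x = x"
  using weak.top_meet eq_is_equal by metis

lemma meet_top: "x \<in> carrier L \<Longrightarrow> x \<sqinter> \<top> = x"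
  using top_meet by (simp add: meet_comm)

lemma meet_absorb: "\<lbrakk>x \<in> carrier L; y \<in> carrier L; x \<sqsubseteq> y\<rbrakk> \<Longrightarrow> x \<sqinter> y = x"
  using le_iff_join by auto

lemma heyting_closed [simp]: "U \<Rrightarrow> V \<in> carrier L"
  unfolding heyting_def by (rule weak.sup_closed) auto

text \<open>Meeting with \<open>U\<close> then has a right adjoint, so it preserves suprema.\<close>

lemma frame_by_heyting:
  assumes "\<And>U V. \<lbrakk>U \<in> carrier L; V \<in> carrier L\<rbrakk> \<Longrightarrow>
    \<exists>H\<in>carrier L. \<forall>W\<in>carrier L. W \<sqinter> U \<sqsubseteq> V \<longleftrightarrow> W \<sqsubseteq> H"
  shows "frame L"
proof
  fix V A assume V: "V \<in> carrier L" and A: "A \<subseteq> carrier L"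
  let ?B = "(\<lambda>U. V \<sqinter> U) ` A"
  have B: "?B \<subseteq> carrier L" using V A by auto
  obtain H where H: "H \<in> carrier L" "\<And>W. W \<in> carrier L \<Longrightarrow> W \<sqinter> V \<sqsubseteq> \<Squnion>?B \<longleftrightarrow> W \<sqsubseteq> H"
    using assms[OF V weak.sup_closed[OF B]] by blast
  have "U \<sqsubseteq> H" if "U \<in> A" for U
    using H(2)[of U] that A sup_upper[OF B, of "V \<sqinter> U"] by (auto simp: meet_comm)
  then have "\<Squnion>A \<sqsubseteq> H"
    using A H(1) by (simp add: sup_le_iff)
  then have 1: "V \<sqinter> \<Squnion>A \<sqsubseteq> \<Squnion>?B"
    using H(2)[of "\<Squnion>A"] A by (simp add: meet_comm)
  have "V \<sqinter> U \<sqsubseteq> V \<sqinter> \<Squnion>A" if "U \<in> A" for U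
  proof -
    have "U \<in> carrier L" using that A by auto
    moreover have "V \<sqinter> U \<sqsubseteq> \<Squnion>A"
      using le_trans[OF meet_right sup_upper[OF A that]] V A calculation by simp
    ultimately show ?thesis using V A by (simp add: le_meet_iff meet_left)
  qed
  then have "\<Squnion>?B \<sqsubseteq> V \<sqinter> \<Squnion>A"
    using B V A by (subst sup_le_iff) auto
  with 1 show "V \<sqinter> \<Squnion>A = \<Squnion>?B"
    using V A B by (intro le_antisym) auto
qed

end

context frame
begin

lemma heyting_galois:
  assumes "U \<in> carrier L" "V \<in> carrier L" "W \<in> carrier L"
  shows "W \<sqsubseteq> U \<Rrightarrow> V \<longleftrightarrow> W \<sqinter> U \<sqsubseteq> V"
proof
  let ?A = "{W \<in> carrier L. W \<sqinter> U \<sqsubseteq> V}"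
  have A: "?A \<subseteq> carrier L" by auto
  show "W \<sqsubseteq> U \<Rrightarrow> V" if "W \<sqinter> U \<sqsubseteq> V"
    unfolding heyting_def using assms that by (intro sup_upper) auto
  have "U \<sqinter> (U \<Rrightarrow> V) = \<Squnion>((\<lambda>W. U \<sqinter> W) ` ?A)"
    unfolding heyting_def by (rule meet_Sup_distrib[OF assms(1) A])
  also have "\<dots> \<sqsubseteq> V"
    using assms by (subst sup_le_iff) (auto simp: meet_comm)
  finally have *: "U \<sqinter> (U \<Rrightarrow> V) \<sqsubseteq> V" .
  show "W \<sqinter> U \<sqsubseteq> V" if "W \<sqsubseteq> U \<Rrightarrow> V"
    using * assms that
    by (meson heyting_closed le_trans meet_closed meet_le meet_left meet_right)
qed

lemma heyting_mp: "\<lbrakk>U \<in> carrier L; V \<in> carrier L\<rbrakk> \<Longrightarrow> (U \<Rrightarrow> V) \<sqinter> U \<sqsubseteq> V"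
  using heyting_galois[of U V "U \<Rrightarrow> V"] by simp

lemma le_heyting: "\<lbrakk>U \<in> carrier L; V \<in> carrier L\<rbrakk> \<Longrightarrow> V \<sqsubseteq> U \<Rrightarrow> V"
  by (simp add: heyting_galois meet_left)

lemma top_heyting: "V \<in> carrier L \<Longrightarrow> \<top> \<Rrightarrow> V = V"
  by (intro eq_by_lower) (auto simp: heyting_galois meet_top)

lemma heyting_heyting:
  "\<lbrakk>U \<in> carrier L; V \<in> carrier L; W \<in> carrier L\<rbrakk> \<Longrightarrow> U \<Rrightarrow> (V \<Rrightarrow> W) = (U \<sqinter> V) \<Rrightarrow> W"
  by (intro eq_by_lower) (auto simp: heyting_galois meet_assoc)

lemma heyting_inf:
  "\<lbrakk>U \<in> carrier L; A \<subseteq> carrier L\<rbrakk> \<Longrightarrow> U \<Rrightarrow> \<Sqinter>A = \<Sqinter>((\<lambda>V. U \<Rrightarrow> V) ` A)"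
  by (intro eq_by_lower) (auto simp: le_inf_iff image_subset_iff heyting_galois subsetD)

lemma meet_mono:
  "\<lbrakk>x \<sqsubseteq> x'; y \<sqsubseteq> y'; x \<in> carrier L; x' \<in> carrier L; y \<in> carrier L; y' \<in> carrier L\<rbrakk>
    \<Longrightarrow> x \<sqinter> y \<sqsubseteq> x' \<sqinter> y'"
  by (meson le_trans meet_closed meet_le meet_left meet_right)

lemma meet_join_distrib:
  "\<lbrakk>x \<in> carrier L; y \<in> carrier L; z \<in> carrier L\<rbrakk> \<Longrightarrow> x \<sqinter> (y \<squnion> z) = (x \<sqinter> y) \<squnion> (x \<sqinter> z)"
  unfolding join_def by (subst meet_Sup_distrib) auto

lemma complement_unique:
  assumes "x \<in> carrier L" "y \<in> carrier L" "y' \<in> carrier L"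
    and "x \<sqinter> y = \<bottom>" "x \<squnion> y = \<top>" "x \<sqinter> y' = \<bottom>" "x \<squnion> y' = \<top>"
  shows "y = y'"
proof -
  have *: "u \<sqsubseteq> v" if "u \<in> carrier L" "v \<in> carrier L" "x \<sqinter> u = \<bottom>" "x \<squnion> v = \<top>" for u v
  proof -
    have "u = u \<sqinter> (x \<squnion> v)"
      using that(1,4) by (simp add: meet_top)
    also have "\<dots> = (x \<sqinter> u) \<squnion> (u \<sqinter> v)"
      using that(1,2) assms(1) by (simp add: meet_join_distrib meet_comm)
    also have "\<dots> \<sqsubseteq> v"
      using that assms(1) by (simp add: join_le_iff meet_right)
    finally show ?thesis .
  qed
  show ?thesis
    using * assms by (intro le_antisym) auto
qed

end

lemma frame_hom_closed: "\<lbrakk>frame_hom L M h; x \<in> carrier L\<rbrakk> \<Longrightarrow> h x \<in> carrier M"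
  by (auto simp: frame_hom_def)

lemma frame_hom_sup: "\<lbrakk>frame_hom L M h; A \<subseteq> carrier L\<rbrakk> \<Longrightarrow> h (\<Squnion>\<^bsub>L\<^esub>A) = \<Squnion>\<^bsub>M\<^esub>(h ` A)"
  by (auto simp: frame_hom_def)

lemma frame_hom_meet:
  "\<lbrakk>frame_hom L M h; x \<in> carrier L; y \<in> carrier L\<rbrakk> \<Longrightarrow> h (x \<sqinter>\<^bsub>L\<^esub> y) = h x \<sqinter>\<^bsub>M\<^esub> h y"
  unfolding frame_hom_def meet_def by (auto dest: spec[of _ "{x, y}"])

lemma frame_hom_join:
  "\<lbrakk>frame_hom L M h; x \<in> carrier L; y \<in> carrier L\<rbrakk> \<Longrightarrow> h (x \<squnion>\<^bsub>L\<^esub> y) = h x \<squnion>\<^bsub>M\<^esub> h y"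
  unfolding frame_hom_def join_def by (auto dest: spec[of _ "{x, y}"])

lemma frame_hom_top:
  assumes "complete_lattice L" "complete_lattice M" "frame_hom L M h" shows "h \<top>\<^bsub>L\<^esub> = \<top>\<^bsub>M\<^esub>"
proof -
  interpret L: complete_lattice L by fact
  interpret M: complete_lattice M by fact
  have "h (\<Sqinter>\<^bsub>L\<^esub>{}) = \<Sqinter>\<^bsub>M\<^esub>(h ` {})"
    using assms(3) unfolding frame_hom_def by blast
  then show ?thesis by (simp add: L.inf_empty M.inf_empty)
qed

lemma frame_hom_bottom:
  assumes "complete_lattice L" "complete_lattice M" "frame_hom L M h" shows "h \<bottom>\<^bsub>L\<^esub> = \<bottom>\<^bsub>M\<^esub>"
proof -
  interpret L: complete_lattice L by fact
  interpret M: complete_lattice M by fact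
  show ?thesis
    using frame_hom_sup[OF assms(3), of "{}"] by (simp add: L.sup_empty M.sup_empty)
qed

lemma frame_homI:
  assumes "complete_lattice L" "complete_lattice M" "h \<in> carrier L \<rightarrow>\<^sub>E carrier M"
    and sup: "\<And>A. A \<subseteq> carrier L \<Longrightarrow> h (\<Squnion>\<^bsub>L\<^esub>A) = \<Squnion>\<^bsub>M\<^esub>(h ` A)"
    and top: "h \<top>\<^bsub>L\<^esub> = \<top>\<^bsub>M\<^esub>"
    and meet: "\<And>x y. \<lbrakk>x \<in> carrier L; y \<in> carrier L\<rbrakk> \<Longrightarrow> h (x \<sqinter>\<^bsub>L\<^esub> y) = h x \<sqinter>\<^bsub>M\<^esub> h y"
  shows "frame_hom L M h"
proof -
  interpret L: complete_lattice L by fact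
  interpret M: complete_lattice M by fact
  have "h (\<Sqinter>\<^bsub>L\<^esub>A) = \<Sqinter>\<^bsub>M\<^esub>(h ` A)" if "finite A" "A \<subseteq> carrier L" for A
    using that
  proof (induction A)
    case empty then show ?case by (simp add: L.inf_empty M.inf_empty top)
  next
    case (insert a A)
    have "h ` A \<subseteq> carrier M" using insert.prems assms(3) by auto
    then show ?case
      using insert assms(3) M.inf_insert[of "h a" "h ` A"] PiE_mem[OF assms(3), of a]
      by (simp add: L.inf_insert meet)
  qed
  with assms show ?thesis by (simp add: frame_hom_def)
qed

lemma frame_hom_mono:
  assumes "complete_lattice L" "complete_lattice M" "frame_hom L M h"
    and "x \<in> carrier L" "y \<in> carrier L" "x \<sqsubseteq>\<^bsub>L\<^esub> y"
  shows "h x \<sqsubseteq>\<^bsub>M\<^esub> h y"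
proof -
  interpret L: complete_lattice L by fact
  interpret M: complete_lattice M by fact
  have "h x = h x \<sqinter>\<^bsub>M\<^esub> h y"
    using frame_hom_meet[OF assms(3-5)] assms(4-6) by (simp add: L.meet_absorb)
  then show ?thesis
    using M.le_iff_join[OF frame_hom_closed[OF assms(3,4)] frame_hom_closed[OF assms(3,5)]] by simp
qed

lemma frame_hom_compose:
  assumes "complete_lattice L" "complete_lattice M" "complete_lattice N"
    and g: "frame_hom L M g" and f: "frame_hom M N f"
  shows "frame_hom L N (\<lambda>W\<in>carrier L. f (g W))"
proof (rule frame_homI)
  interpret L: complete_lattice L by fact
  interpret M: complete_lattice M by fact
  interpret N: complete_lattice N by fact
  let ?h = "\<lambda>W\<in>carrier L. f (g W)"
  show "?h \<in> carrier L \<rightarrow>\<^sub>E carrier N"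
    using g f by (auto simp: frame_hom_closed)
  show "?h (\<Squnion>\<^bsub>L\<^esub>A) = \<Squnion>\<^bsub>N\<^esub>(?h ` A)" if "A \<subseteq> carrier L" for A
  proof -
    have "g ` A \<subseteq> carrier M" using that g by (auto simp: frame_hom_closed)
    moreover have "?h ` A = f ` (g ` A)" using that by (force simp: image_image)
    ultimately show ?thesis
      using that by (simp add: frame_hom_sup[OF g] frame_hom_sup[OF f])
  qed
  show "?h \<top>\<^bsub>L\<^esub> = \<top>\<^bsub>N\<^esub>"
    by (simp add: frame_hom_top[OF assms(1,2) g] frame_hom_top[OF assms(2,3) f])
  show "?h (x \<sqinter>\<^bsub>L\<^esub> y) = ?h x \<sqinter>\<^bsub>N\<^esub> ?h y" if "x \<in> carrier L" "y \<in> carrier L" for x y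
    using that by (simp add: frame_hom_meet[OF g] frame_hom_meet[OF f] frame_hom_closed[OF g])
qed fact+

lemma frame_hom_ident:
  fixes L (structure) assumes "complete_lattice L" shows "frame_hom L L (\<lambda>U\<in>carrier L. U)"
proof (rule frame_homI)
  interpret complete_lattice L by fact
  show "(\<lambda>U\<in>carrier L. U) (\<Squnion>\<^bsub>L\<^esub>A) = \<Squnion>\<^bsub>L\<^esub>((\<lambda>U\<in>carrier L. U) ` A)" if "A \<subseteq> carrier L" for A
  proof -
    have "(\<lambda>U\<in>carrier L. U) ` A = A" using that by force
    then show ?thesis using that by simp
  qed
  show "(\<lambda>U\<in>carrier L. U) \<top> = \<top>" by simp
  show "(\<lambda>U\<in>carrier L. U) (x \<sqinter> y) = (\<lambda>U\<in>carrier L. U) x \<sqinter> (\<lambda>U\<in>carrier L. U) y"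
    if "x \<in> carrier L" "y \<in> carrier L" for x y using that by simp
qed (use assms in auto)

text \<open>Sublocales are defined for orders that carry no further record fields, so the results about them
  need a frame of exactly this type.\<close>

locale plain_frame = frame L for L :: "'a gorder" (structure)

text \<open>A continuous map from \<open>L\<close> to \<open>M\<close>. The two frames may have different element types, which is
  needed to map the ideals of compact sets to the opens of a space.\<close>

locale frame_map = L: plain_frame L + M: plain_frame M for L :: "'a gorder" and M :: "'b gorder" +
  fixes f :: "'b \<Rightarrow> 'a"
  assumes hom: "frame_hom M L f"
begin

lemmas f_closed [simp] = frame_hom_closed[OF hom]
lemmas f_sup = frame_hom_sup[OF hom]
lemmas f_meet = frame_hom_meet[OF hom]
lemmas f_join = frame_hom_join[OF hom]
lemmas f_top = frame_hom_top[OF M.complete_lattice_axioms L.complete_lattice_axioms hom]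
lemmas f_mono = frame_hom_mono[OF M.complete_lattice_axioms L.complete_lattice_axioms hom]

lemma direct_image_closed [simp]: "direct_image L M f V \<in> carrier M"
  unfolding direct_image_def by (rule M.weak.sup_closed) auto

lemma le_direct_image:
  assumes "V \<in> carrier L" "W \<in> carrier M"
  shows "W \<sqsubseteq>\<^bsub>M\<^esub> direct_image L M f V \<longleftrightarrow> f W \<sqsubseteq>\<^bsub>L\<^esub> V"
proof
  let ?A = "{W \<in> carrier M. f W \<sqsubseteq>\<^bsub>L\<^esub> V}"
  have A: "?A \<subseteq> carrier M" "f ` ?A \<subseteq> carrier L" by auto
  show "W \<sqsubseteq>\<^bsub>M\<^esub> direct_image L M f V" if "f W \<sqsubseteq>\<^bsub>L\<^esub> V"
    unfolding direct_image_def using assms that A by (intro M.sup_upper) auto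
  have *: "f (direct_image L M f V) \<sqsubseteq>\<^bsub>L\<^esub> V"
    unfolding direct_image_def f_sup[OF A(1)] using assms A by (subst L.sup_le_iff) auto
  show "f W \<sqsubseteq>\<^bsub>L\<^esub> V" if "W \<sqsubseteq>\<^bsub>M\<^esub> direct_image L M f V"
    using * f_mono[OF _ _ that] assms by (meson L.le_trans direct_image_closed f_closed)
qed

lemma direct_image_inf:
  "A \<subseteq> carrier L \<Longrightarrow> direct_image L M f (\<Sqinter>\<^bsub>L\<^esub>A) = \<Sqinter>\<^bsub>M\<^esub>(direct_image L M f ` A)"
  by (intro M.eq_by_lower)
    (auto simp: le_direct_image L.le_inf_iff M.le_inf_iff image_subset_iff subsetD)

end

section \<open>Sublocales as subsets closed under infima and Heyting implication\<close>

text \<open>The nucleus of the sublocale \<open>S\<close>: the left adjoint of its inclusion.\<close>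

definition reflection :: "'a gorder \<Rightarrow> 'a set \<Rightarrow> 'a \<Rightarrow> 'a" where
  "reflection L S = (\<lambda>W\<in>carrier L. \<Sqinter>\<^bsub>L\<^esub>{V \<in> S. W \<sqsubseteq>\<^bsub>L\<^esub> V})"

lemma sub_order_simps [simp]:
  "carrier (sub_order L S) = S" "le (sub_order L S) = le L" "eq (sub_order L S) = eq L"
  by (simp_all add: sub_order_def)

lemma partial_order_sub_order:
  assumes "partial_order L" "S \<subseteq> carrier L" shows "partial_order (sub_order L S)"
proof -
  interpret partial_order L by fact
  show ?thesis
    by standard (use assms(2) in \<open>auto simp: eq_is_equal subset_iff intro: le_trans\<close>)
qed

text \<open>The elementary description of sublocales, equivalent to \<open>is_sublocale\<close> by \<open>sublocale_of_iff\<close>.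
  Closure under infima yields the left adjoint \<open>j\<close> of the inclusion, closure under Heyting
  implication makes \<open>j\<close> preserve binary meets.\<close>

locale sublocale_of = plain_frame L for L :: "'a gorder" (structure) +
  fixes S :: "'a set"
  assumes subset: "S \<subseteq> carrier L"
    and inf_in: "A \<subseteq> S \<Longrightarrow> \<Sqinter>A \<in> S"
    and heyting_in: "\<lbrakk>U \<in> carrier L; V \<in> S\<rbrakk> \<Longrightarrow> U \<Rrightarrow> V \<in> S"
begin

abbreviation j where "j \<equiv> reflection L S"

lemma in_carrier: "V \<in> S \<Longrightarrow> V \<in> carrier L"
  using subset by auto

lemma j_in: "W \<in> carrier L \<Longrightarrow> j W \<in> S"
  by (auto simp: reflection_def intro!: inf_in)

lemma j_closed [simp]: "W \<in> carrier L \<Longrightarrow> j W \<in> carrier L"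
  by (simp add: j_in in_carrier)

lemma le_j: "W \<in> carrier L \<Longrightarrow> W \<sqsubseteq> j W"
  using subset by (auto simp: reflection_def intro!: inf_greatest)

lemma j_le_iff: "\<lbrakk>W \<in> carrier L; V \<in> S\<rbrakk> \<Longrightarrow> j W \<sqsubseteq> V \<longleftrightarrow> W \<sqsubseteq> V"
proof
  assume *: "W \<in> carrier L" "V \<in> S"
  show "j W \<sqsubseteq> V" if "W \<sqsubseteq> V"
    using * that subset by (auto simp: reflection_def intro!: inf_lower)
  show "W \<sqsubseteq> V" if "j W \<sqsubseteq> V"
    using le_trans[OF le_j that] * by (simp add: in_carrier)
qed

lemma j_fixed: "V \<in> S \<Longrightarrow> j V = V"
  by (intro le_antisym) (auto simp: j_le_iff le_j in_carrier)

lemma j_mono: "\<lbrakk>W \<in> carrier L; W' \<in> carrier L; W \<sqsubseteq> W'\<rbrakk> \<Longrightarrow> j W \<sqsubseteq> j W'"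
  by (simp add: j_le_iff j_in le_trans[OF _ le_j])

lemma top_in: "\<top> \<in> S"
  using inf_in[of "{}"] by (simp add: inf_empty)

lemma meet_in: "\<lbrakk>V \<in> S; V' \<in> S\<rbrakk> \<Longrightarrow> V \<sqinter> V' \<in> S"
  unfolding meet_def by (auto intro: inf_in)

text \<open>For \<open>V \<in> S\<close> the bound \<open>W \<sqinter> W' \<sqsubseteq> V\<close> says \<open>W \<sqsubseteq> W' \<Rrightarrow> V\<close>. The right side is in \<open>S\<close>, so
  \<open>W\<close> may be replaced by \<open>j W\<close>, and then \<open>W'\<close> by \<open>j W'\<close> in the same way.\<close>

lemma j_meet:
  assumes "W \<in> carrier L" "W' \<in> carrier L"
  shows "j (W \<sqinter> W') = j W \<sqinter> j W'"
proof (rule le_antisym)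
  show "j (W \<sqinter> W') \<sqsubseteq> j W \<sqinter> j W'"
    using assms by (simp add: le_meet_iff j_mono meet_left meet_right)
  let ?V = "j (W \<sqinter> W')"
  have V: "?V \<in> S" "?V \<in> carrier L"
    using assms by (simp_all add: j_in)
  have "W \<sqsubseteq> W' \<Rrightarrow> ?V"
    using assms by (simp add: heyting_galois le_j)
  then have "j W \<sqsubseteq> W' \<Rrightarrow> ?V"
    using assms V by (simp add: j_le_iff heyting_in)
  then have "W' \<sqsubseteq> j W \<Rrightarrow> ?V"
    using assms V by (simp add: heyting_galois meet_comm)
  then have "j W' \<sqsubseteq> j W \<Rrightarrow> ?V"
    using assms V by (simp add: j_le_iff heyting_in)
  then show "j W \<sqinter> j W' \<sqsubseteq> ?V"
    using assms V by (simp add: heyting_galois meet_comm)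
qed (use assms in auto)

abbreviation LS where "LS \<equiv> sub_order L S"

sublocale sub: partial_order LS
  by (rule partial_order_sub_order[OF partial_order_axioms subset])

lemma sub_inf: "A \<subseteq> S \<Longrightarrow> \<Sqinter>\<^bsub>LS\<^esub>A = \<Sqinter>A"
  using subset inf_in
  by (intro sub.inf_eqI) (auto intro!: inf_lower inf_greatest)

lemma complete_lattice_sub: "complete_lattice LS"
proof (rule sub.complete_lattice_by_infs)
  fix A assume "A \<subseteq> carrier LS"
  then have A: "A \<subseteq> S" by simp
  have "greatest LS (\<Sqinter>A) (Lower LS A)"
    using A subset inf_in
    by (auto simp: greatest_def Lower_def intro!: inf_lower inf_greatest)
  then show "\<exists>i. greatest LS i (Lower LS A)" ..
qed

sublocale sub: complete_lattice LS
  by (rule complete_lattice_sub)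

lemma sub_sup: "A \<subseteq> S \<Longrightarrow> \<Squnion>\<^bsub>LS\<^esub>A = j (\<Squnion>A)"
proof (rule sub.sup_eqI)
  assume A: "A \<subseteq> S"
  then have A': "A \<subseteq> carrier L" using subset by auto
  show "j (\<Squnion>A) \<in> carrier LS" using A' by (simp add: j_in)
  show "a \<sqsubseteq>\<^bsub>LS\<^esub> j (\<Squnion>A)" if "a \<in> A" for a
    using le_trans[OF sup_upper[OF A' that] le_j] that A' by auto
  show "j (\<Squnion>A) \<sqsubseteq>\<^bsub>LS\<^esub> y" if "y \<in> carrier LS" "\<And>a. a \<in> A \<Longrightarrow> a \<sqsubseteq>\<^bsub>LS\<^esub> y" for y
    using that A' by (auto simp: j_le_iff sup_le_iff in_carrier)
qed auto

lemma sub_meet: "\<lbrakk>V \<in> S; V' \<in> S\<rbrakk> \<Longrightarrow> V \<sqinter>\<^bsub>LS\<^esub> V' = V \<sqinter> V'"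
  by (simp add: meet_def sub_inf)

lemma sub_top: "\<top>\<^bsub>LS\<^esub> = \<top>"
  using sub_inf[of "{}"] by (simp add: inf_empty sub.inf_empty)

text \<open>The Heyting implication of the ambient frame restricts to the sublocale.\<close>

lemma frame_sub: "frame LS"
proof (rule sub.frame_by_heyting)
  fix U V assume "U \<in> carrier LS" "V \<in> carrier LS"
  then show "\<exists>H\<in>carrier LS. \<forall>W\<in>carrier LS. W \<sqinter>\<^bsub>LS\<^esub> U \<sqsubseteq>\<^bsub>LS\<^esub> V \<longleftrightarrow> W \<sqsubseteq>\<^bsub>LS\<^esub> H"
    by (intro bexI[of _ "U \<Rrightarrow> V"]) (auto simp: sub_meet heyting_galois in_carrier heyting_in)
qed

lemma j_sup:
  assumes "A \<subseteq> carrier L"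
  shows "j (\<Squnion>A) = j (\<Squnion>(j ` A))"
proof (rule le_antisym)
  have A: "j ` A \<subseteq> carrier L" using assms by auto
  have "\<Squnion>A \<sqsubseteq> \<Squnion>(j ` A)"
    using assms A by (auto simp: sup_le_iff intro!: le_trans[OF le_j sup_upper[OF A]])
  then show "j (\<Squnion>A) \<sqsubseteq> j (\<Squnion>(j ` A))"
    using assms A by (simp add: j_mono)
  show "j (\<Squnion>(j ` A)) \<sqsubseteq> j (\<Squnion>A)"
    using assms A by (auto simp: j_le_iff j_in sup_le_iff subsetD
        intro!: le_trans[OF sup_upper[OF assms] le_j])
qed (use assms in \<open>auto simp: image_subset_iff subsetD\<close>)

lemma frame_hom_j: "frame_hom L LS j"
proof (rule frame_homI)
  show "j \<in> carrier L \<rightarrow>\<^sub>E carrier LS"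
    using j_in by (auto simp: reflection_def)
  show "j (\<Squnion>A) = \<Squnion>\<^bsub>LS\<^esub>(j ` A)" if "A \<subseteq> carrier L" for A
    using that j_in by (subst sub_sup) (auto simp: j_sup)
  show "j \<top> = \<top>\<^bsub>LS\<^esub>"
    by (simp add: sub_top j_fixed top_in)
  show "j (x \<sqinter> y) = j x \<sqinter>\<^bsub>LS\<^esub> j y" if "x \<in> carrier L" "y \<in> carrier L" for x y
    using that by (simp add: j_meet sub_meet j_in)
qed (rule complete_lattice_axioms complete_lattice_sub)+

lemma reflects_onto_j: "reflects_onto L S j"
  unfolding reflects_onto_def galois_connection_def connection_def galois_connection_axioms_def
  using frame_hom_j partial_order_axioms sub.partial_order_axioms j_in in_carrier j_le_iff by auto

lemma is_sublocale: "is_sublocale L S"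
  unfolding is_sublocale_def using subset frame_sub reflects_onto_j by auto

lemma reflects_onto_unique:
  assumes "reflects_onto L S h" shows "h = j"
proof -
  have h: "h \<in> carrier L \<rightarrow>\<^sub>E S"
    using assms by (simp add: reflects_onto_def frame_hom_def)
  have g: "h W \<sqsubseteq> V \<longleftrightarrow> W \<sqsubseteq> V" if "W \<in> carrier L" "V \<in> S" for W V
    using assms that unfolding reflects_onto_def galois_connection_def galois_connection_axioms_def
    by auto
  show ?thesis
  proof (rule extensionalityI[of _ "carrier L"])
    fix W assume W: "W \<in> carrier L"
    then have "h W \<in> S" using h by auto
    then show "h W = j W"
      using W g[of W "j W"] g[of W "h W"]
      by (intro le_antisym) (auto simp: j_in in_carrier j_le_iff le_j)
  qed (use h in \<open>auto simp: reflection_def PiE_def\<close>)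
qed

lemma incl_eq: "incl L S = j"
  unfolding incl_def using reflects_onto_j reflects_onto_unique by (rule the_equality)

text \<open>The universal property of the quotient frame.\<close>

lemma frame_hom_factor:
  assumes "frame N" "frame_hom L N h" "\<And>W. W \<in> carrier L \<Longrightarrow> h (j W) = h W"
  shows "frame_hom LS N (\<lambda>V\<in>S. h V)"
proof (rule frame_homI)
  interpret N: frame N by fact
  show "(\<lambda>V\<in>S. h V) \<in> carrier LS \<rightarrow>\<^sub>E carrier N"
    using assms(2) by (auto simp: in_carrier frame_hom_closed)
  show "(\<lambda>V\<in>S. h V) (\<Squnion>\<^bsub>LS\<^esub>A) = \<Squnion>\<^bsub>N\<^esub>((\<lambda>V\<in>S. h V) ` A)" if "A \<subseteq> carrier LS" for A
  proof -
    have A: "A \<subseteq> S" "A \<subseteq> carrier L" using that subset by auto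
    have "(\<lambda>V\<in>S. h V) ` A = h ` A" using A by force
    then show ?thesis
      using A assms(3)[of "\<Squnion>A"] by (simp add: sub_sup j_in frame_hom_sup[OF assms(2)])
  qed
  show "(\<lambda>V\<in>S. h V) \<top>\<^bsub>LS\<^esub> = \<top>\<^bsub>N\<^esub>"
    by (simp add: sub_top top_in frame_hom_top[OF complete_lattice_axioms N.complete_lattice_axioms assms(2)])
  show "(\<lambda>V\<in>S. h V) (x \<sqinter>\<^bsub>LS\<^esub> y) = (\<lambda>V\<in>S. h V) x \<sqinter>\<^bsub>N\<^esub> (\<lambda>V\<in>S. h V) y"
    if "x \<in> carrier LS" "y \<in> carrier LS" for x y
    using that by (simp add: sub_meet meet_in frame_hom_meet[OF assms(2)] in_carrier)
qed (use assms(1) complete_lattice_sub in \<open>auto simp: frame_def\<close>)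

end

text \<open>If the inclusion has a left adjoint \<open>h\<close>, then \<open>W \<in> S\<close> as soon as \<open>h W \<sqsubseteq> W\<close>. Infima satisfy
  this by adjointness alone. For \<open>H = U \<Rrightarrow> V\<close> one has
  \<open>h H \<sqinter> U \<sqsubseteq> h H \<sqinter> h U = h (H \<sqinter> U) \<sqsubseteq> V\<close>.\<close>

lemma sublocale_of_iff:
  assumes "frame L"
  shows "is_sublocale L S \<longleftrightarrow> sublocale_of L S"
proof
  show "is_sublocale L S" if "sublocale_of L S"
    using that by (rule sublocale_of.is_sublocale)
  assume S: "is_sublocale L S"
  interpret L: plain_frame L using assms by (rule plain_frame.intro)
  obtain h where h: "reflects_onto L S h" and SL: "S \<subseteq> carrier L" and fS: "frame (sub_order L S)"
    using S by (auto simp: is_sublocale_def)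
  interpret S: frame "sub_order L S" by fact
  have hom: "frame_hom L (sub_order L S) h"
    using h by (simp add: reflects_onto_def)
  have hS: "h W \<in> S" if "W \<in> carrier L" for W
    using hom that by (auto simp: frame_hom_def)
  have g: "h W \<sqsubseteq>\<^bsub>L\<^esub> V \<longleftrightarrow> W \<sqsubseteq>\<^bsub>L\<^esub> V" if "W \<in> carrier L" "V \<in> S" for W V
    using h that unfolding reflects_onto_def galois_connection_def galois_connection_axioms_def
    by auto
  have le_h: "W \<sqsubseteq>\<^bsub>L\<^esub> h W" if "W \<in> carrier L" for W
    using g[OF that hS[OF that]] hS[OF that] SL by auto
  have mem: "W \<in> S" if "W \<in> carrier L" "h W \<sqsubseteq>\<^bsub>L\<^esub> W" for W
    using L.le_antisym[OF that(2) le_h] that hS SL by (metis subsetD)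
  have inf: "\<Sqinter>\<^bsub>L\<^esub>A \<in> S" if "A \<subseteq> S" for A
  proof -
    have A: "A \<subseteq> carrier L" using that SL by auto
    have "h (\<Sqinter>\<^bsub>L\<^esub>A) \<in> carrier L" using hS[of "\<Sqinter>\<^bsub>L\<^esub>A"] A SL by auto
    then show ?thesis
      using that A by (intro mem) (auto simp: L.le_inf_iff g subsetD intro: L.inf_lower)
  qed
  have meet: "a \<sqinter>\<^bsub>sub_order L S\<^esub> b = a \<sqinter>\<^bsub>L\<^esub> b" if "a \<in> S" "b \<in> S" for a b
    unfolding meet_def
  proof (rule S.inf_eqI)
    show "\<Sqinter>\<^bsub>L\<^esub>{a, b} \<in> carrier (sub_order L S)" using inf[of "{a, b}"] that by simp
  qed (use that SL in \<open>auto intro!: L.inf_lower L.inf_greatest\<close>)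
  show "sublocale_of L S"
  proof
    show "S \<subseteq> carrier L" by fact
    show "\<Sqinter>\<^bsub>L\<^esub>A \<in> S" if "A \<subseteq> S" for A using inf that .
    fix U V assume U: "U \<in> carrier L" and V: "V \<in> S"
    have VL: "V \<in> carrier L" using V SL by auto
    let ?H = "U \<Rrightarrow>\<^bsub>L\<^esub> V"
    have c: "h ?H \<in> carrier L" "h U \<in> carrier L" using hS U SL by auto
    have "h ?H \<sqinter>\<^bsub>L\<^esub> U \<sqsubseteq>\<^bsub>L\<^esub> h ?H \<sqinter>\<^bsub>L\<^esub> h U"
      using c U le_h by (intro L.meet_mono) auto
    also have "h ?H \<sqinter>\<^bsub>L\<^esub> h U = h (?H \<sqinter>\<^bsub>L\<^esub> U)"
      using U hS by (simp add: frame_hom_meet[OF hom] meet)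
    also have "h (?H \<sqinter>\<^bsub>L\<^esub> U) \<sqsubseteq>\<^bsub>L\<^esub> V"
      using U V VL by (simp add: g L.heyting_mp)
    finally have "h ?H \<sqinter>\<^bsub>L\<^esub> U \<sqsubseteq>\<^bsub>L\<^esub> V"
      using c U V VL hS[of "?H \<sqinter>\<^bsub>L\<^esub> U"] SL by auto
    then show "?H \<in> S"
      using c U VL by (intro mem) (auto simp: L.heyting_galois)
  qed
qed

section \<open>The frame of sublocales\<close>

text \<open>The join of two sublocales in the order by inclusion, hence their meet in \<open>Sl L\<close>, which is
  ordered by reverse inclusion.\<close>

definition sublocale_join :: "'a gorder \<Rightarrow> 'a set \<Rightarrow> 'a set \<Rightarrow> 'a set" where
  "sublocale_join L S T = {s \<sqinter>\<^bsub>L\<^esub> t | s t. s \<in> S \<and> t \<in> T}"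

lemma Sl_simps:
  "carrier (Sl L) = {S. is_sublocale L S}" "le (Sl L) S T \<longleftrightarrow> T \<subseteq> S" "eq (Sl L) = (=)"
  by (simp_all add: Sl_def Sl_coframe_def)

context plain_frame
begin

lemma carrier_Sl: "carrier (Sl L) = {S. sublocale_of L S}"
  using sublocale_of_iff[OF frame_axioms] by (simp add: Sl_simps)

lemma heyting_meet:
  "\<lbrakk>U \<in> carrier L; V \<in> carrier L; W \<in> carrier L\<rbrakk> \<Longrightarrow> U \<Rrightarrow> V \<sqinter> W = (U \<Rrightarrow> V) \<sqinter> (U \<Rrightarrow> W)"
  by (intro eq_by_lower) (auto simp: heyting_galois le_meet_iff)

lemma sublocale_of_Inter:
  assumes "\<And>S. S \<in> A \<Longrightarrow> sublocale_of L S"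
  shows "sublocale_of L (carrier L \<inter> \<Inter>A)"
proof
  show "\<Sqinter>B \<in> carrier L \<inter> \<Inter>A" if "B \<subseteq> carrier L \<inter> \<Inter>A" for B
    using that sublocale_of.inf_in[OF assms] le_Inf_iff[of B A] by auto
  show "U \<Rrightarrow> V \<in> carrier L \<inter> \<Inter>A" if "U \<in> carrier L" "V \<in> carrier L \<inter> \<Inter>A" for U V
    using that sublocale_of.heyting_in[OF assms] by auto
qed auto

text \<open>An infimum of elements \<open>s \<sqinter> t\<close> is the meet of the infima of all elements of \<open>S\<close>, respectively
  \<open>T\<close>, that lie above one of them.\<close>

lemma sublocale_of_join:
  assumes "sublocale_of L S" "sublocale_of L T"
  shows "sublocale_of L (sublocale_join L S T)"
proof
  interpret S: sublocale_of L S by fact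
  interpret T: sublocale_of L T by fact
  let ?J = "sublocale_join L S T"
  show J: "?J \<subseteq> carrier L"
    by (auto simp: sublocale_join_def S.in_carrier T.in_carrier)
  show "\<Sqinter>A \<in> ?J" if A: "A \<subseteq> ?J" for A
  proof -
    let ?S = "{s \<in> S. \<exists>a\<in>A. a \<sqsubseteq> s}" and ?T = "{t \<in> T. \<exists>a\<in>A. a \<sqsubseteq> t}"
    have AL: "A \<subseteq> carrier L" using A J by auto
    have SL: "?S \<subseteq> carrier L" and TL: "?T \<subseteq> carrier L"
      by (auto simp: S.in_carrier T.in_carrier)
    have "\<Sqinter>A = \<Sqinter>?S \<sqinter> \<Sqinter>?T"
    proof (rule eq_by_lower)
      fix z assume z: "z \<in> carrier L"
      show "z \<sqsubseteq> \<Sqinter>A \<longleftrightarrow> z \<sqsubseteq> \<Sqinter>?S \<sqinter> \<Sqinter>?T"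
      proof
        assume *: "z \<sqsubseteq> \<Sqinter>A"
        have "z \<sqsubseteq> a" if "a \<in> A" for a
          using * that z AL by (simp add: le_inf_iff)
        then have "z \<sqsubseteq> u" if "a \<in> A" "a \<sqsubseteq> u" "u \<in> carrier L" for a u
          using le_trans[of z a u] that z AL by auto
        then show "z \<sqsubseteq> \<Sqinter>?S \<sqinter> \<Sqinter>?T"
          using z SL TL by (auto simp: le_meet_iff le_inf_iff S.in_carrier T.in_carrier)
      next
        assume *: "z \<sqsubseteq> \<Sqinter>?S \<sqinter> \<Sqinter>?T"
        then have *: "z \<sqsubseteq> \<Sqinter>?S" "z \<sqsubseteq> \<Sqinter>?T"
          using z SL TL by (auto simp: le_meet_iff)
        have "z \<sqsubseteq> a" if "a \<in> A" for a
        proof -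
          obtain s t where st: "s \<in> S" "t \<in> T" "a = s \<sqinter> t"
            using \<open>a \<in> A\<close> A by (auto simp: sublocale_join_def)
          then have "s \<in> ?S" "t \<in> ?T"
            using \<open>a \<in> A\<close> S.in_carrier T.in_carrier meet_left[of s t] meet_right[of s t] by blast+
          then have "z \<sqsubseteq> s" "z \<sqsubseteq> t"
            using * z SL TL by (simp_all only: le_inf_iff)
          then show ?thesis
            using st z by (simp add: le_meet_iff S.in_carrier T.in_carrier)
        qed
        then show "z \<sqsubseteq> \<Sqinter>A" using z AL by (simp add: le_inf_iff)
      qed
    qed (use AL SL TL in auto)
    moreover have "\<Sqinter>?S \<in> S" "\<Sqinter>?T \<in> T"
      by (auto intro: S.inf_in T.inf_in)
    ultimately show ?thesis by (auto simp: sublocale_join_def)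
  qed
  show "U \<Rrightarrow> V \<in> ?J" if U: "U \<in> carrier L" and V: "V \<in> ?J" for U V
  proof -
    obtain s t where st: "s \<in> S" "t \<in> T" "V = s \<sqinter> t"
      using V by (auto simp: sublocale_join_def)
    then have "U \<Rrightarrow> V = (U \<Rrightarrow> s) \<sqinter> (U \<Rrightarrow> t)"
      using U by (simp add: heyting_meet S.in_carrier T.in_carrier)
    then show ?thesis
      using S.heyting_in[OF U st(1)] T.heyting_in[OF U st(2)] unfolding sublocale_join_def by blast
  qed
qed

lemma partial_order_Sl: "partial_order (Sl L)"
  by standard (auto simp: Sl_simps)

lemma Sl_Sup:
  assumes "A \<subseteq> carrier (Sl L)"
  shows "\<Squnion>\<^bsub>Sl L\<^esub>A = carrier L \<inter> \<Inter>A" "least (Sl L) (carrier L \<inter> \<Inter>A) (Upper (Sl L) A)"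
proof -
  interpret Sl: partial_order "Sl L" by (rule partial_order_Sl)
  have I: "carrier L \<inter> \<Inter>A \<in> carrier (Sl L)"
    using assms sublocale_of_Inter by (auto simp: carrier_Sl)
  show "\<Squnion>\<^bsub>Sl L\<^esub>A = carrier L \<inter> \<Inter>A"
    using assms I
    by (intro Sl.sup_eqI) (force simp: Sl_simps(2) carrier_Sl dest: sublocale_of.in_carrier)+
  show "least (Sl L) (carrier L \<inter> \<Inter>A) (Upper (Sl L) A)"
    using assms I
    by (intro least_UpperI) (auto simp: Upper_def Sl_simps(2) carrier_Sl dest: sublocale_of.in_carrier)
qed

lemma complete_lattice_Sl: "complete_lattice (Sl L)"
  using partial_order.complete_lattice_by_sups[OF partial_order_Sl] Sl_Sup(2) by blast

lemma sublocale_of_top: "sublocale_of L {\<top>}"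
proof
  show "\<Sqinter>A \<in> {\<top>}" if "A \<subseteq> {\<top>}" for A
    using that by (auto simp: subset_singleton_iff inf_empty intro!: inf_eqI)
  show "U \<Rrightarrow> V \<in> {\<top>}" if "U \<in> carrier L" "V \<in> {\<top>}" for U V
    using that by (auto intro!: eq_by_lower simp: heyting_galois)
qed auto

lemma Sl_top: "\<top>\<^bsub>Sl L\<^esub> = {\<top>}"
proof (rule complete_lattice.top_eqI[OF complete_lattice_Sl])
  show "{\<top>} \<in> carrier (Sl L)" by (simp add: carrier_Sl sublocale_of_top)
  show "S \<sqsubseteq>\<^bsub>Sl L\<^esub> {\<top>}" if "S \<in> carrier (Sl L)" for S
    using that by (auto simp: Sl_simps(2) carrier_Sl dest: sublocale_of.top_in)
qed

lemma Sl_bottom: "\<bottom>\<^bsub>Sl L\<^esub> = carrier L"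
  using Sl_Sup(1)[of "{}"] complete_lattice.sup_empty[OF complete_lattice_Sl] by simp

lemma Sl_join:
  "\<lbrakk>sublocale_of L S; sublocale_of L T\<rbrakk> \<Longrightarrow> S \<squnion>\<^bsub>Sl L\<^esub> T = S \<inter> T"
  unfolding join_def by (subst Sl_Sup) (auto simp: carrier_Sl dest: sublocale_of.in_carrier)

lemma subset_sublocale_join:
  assumes "sublocale_of L S" "sublocale_of L T"
  shows "S \<subseteq> sublocale_join L S T" "T \<subseteq> sublocale_join L S T"
proof (safe)
  interpret S: sublocale_of L S by fact
  interpret T: sublocale_of L T by fact
  show "s \<in> sublocale_join L S T" if "s \<in> S" for s
    unfolding sublocale_join_def
    using that T.top_in meet_top[OF S.in_carrier] by (intro CollectI exI[of _ s] exI[of _ \<top>]) simp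
  show "t \<in> sublocale_join L S T" if "t \<in> T" for t
    unfolding sublocale_join_def
    using that S.top_in top_meet[OF T.in_carrier] by (intro CollectI exI[of _ \<top>] exI[of _ t]) simp
qed

lemma Sl_meet:
  assumes "sublocale_of L S" "sublocale_of L T"
  shows "S \<sqinter>\<^bsub>Sl L\<^esub> T = sublocale_join L S T"
  unfolding meet_def
proof (rule partial_order.inf_eqI[OF partial_order_Sl])
  interpret S: sublocale_of L S by fact
  interpret T: sublocale_of L T by fact
  show "sublocale_join L S T \<in> carrier (Sl L)"
    using assms by (simp add: carrier_Sl sublocale_of_join)
  show "sublocale_join L S T \<sqsubseteq>\<^bsub>Sl L\<^esub> a" if "a \<in> {S, T}" for a
    using that subset_sublocale_join[OF assms] by (auto simp: Sl_simps(2))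
  show "y \<sqsubseteq>\<^bsub>Sl L\<^esub> sublocale_join L S T"
    if "y \<in> carrier (Sl L)" "\<And>a. a \<in> {S, T} \<Longrightarrow> y \<sqsubseteq>\<^bsub>Sl L\<^esub> a" for y
    using that by (auto simp: Sl_simps(2) carrier_Sl sublocale_join_def intro!: sublocale_of.meet_in)
qed (use assms in \<open>auto simp: carrier_Sl\<close>)

text \<open>Distributivity says that \<open>x\<close> lies in the join of \<open>S\<close> with \<open>\<Inter>A\<close> if it lies in the join of \<open>S\<close>
  with each \<open>T \<in> A\<close>. Write \<open>x = s \<sqinter> t\<close> with \<open>t \<in> T\<close>, and let \<open>s\<^sub>0 = S.j x\<close>, so that
  \<open>s\<^sub>0 \<sqsubseteq> s\<close>. Then \<open>s\<^sub>0 \<Rrightarrow> x\<close>, which does not depend on \<open>T\<close>, equals \<open>s\<^sub>0 \<Rrightarrow> t\<close>. It therefore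
  belongs to every \<open>T \<in> A\<close>, and \<open>x = s\<^sub>0 \<sqinter> (s\<^sub>0 \<Rrightarrow> x)\<close>.\<close>

lemma frame_Sl: "frame (Sl L)"
proof -
  interpret Sl: complete_lattice "Sl L" by (rule complete_lattice_Sl)
  show ?thesis
  proof
    fix S A assume S: "S \<in> carrier (Sl L)" and A: "A \<subseteq> carrier (Sl L)"
    have sS: "sublocale_of L S" and sA: "\<And>T. T \<in> A \<Longrightarrow> sublocale_of L T"
      using S A by (auto simp: carrier_Sl)
    interpret S: sublocale_of L S by fact
    let ?I = "carrier L \<inter> \<Inter>A"
    have J: "S \<sqinter>\<^bsub>Sl L\<^esub> T = sublocale_join L S T" if "T \<in> A" for T
      using Sl_meet[OF sS sA[OF that]] .
    have "sublocale_join L S ?I = carrier L \<inter> \<Inter>(sublocale_join L S ` A)"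
    proof (intro equalityI subsetI)
      fix x assume "x \<in> sublocale_join L S ?I"
      then show "x \<in> carrier L \<inter> \<Inter>(sublocale_join L S ` A)"
        by (auto simp: sublocale_join_def S.in_carrier)
    next
      fix x assume x: "x \<in> carrier L \<inter> \<Inter>(sublocale_join L S ` A)"
      then have xL: "x \<in> carrier L" by simp
      let ?s = "S.j x" and ?t = "S.j x \<Rrightarrow> x"
      have s: "?s \<in> S" "?s \<in> carrier L" using xL by (simp_all add: S.j_in)
      have "?t \<in> T" if "T \<in> A" for T
      proof -
        interpret T: sublocale_of L T using sA[OF that] .
        obtain s t where st: "s \<in> S" "t \<in> T" "x = s \<sqinter> t"
          using x \<open>T \<in> A\<close> unfolding sublocale_join_def by blast
        note stL = S.in_carrier[OF st(1)] T.in_carrier[OF st(2)]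
        have "?s \<sqsubseteq> s"
          using st stL xL by (simp add: S.j_le_iff meet_left)
        then have "?s \<Rrightarrow> s = \<top>"
          using s(2) stL(1) le_trans[OF meet_right[OF _ s(2)]]
          by (intro eq_by_lower) (simp_all add: heyting_galois)
        then have "?t = ?s \<Rrightarrow> t"
          using st stL s(2) heyting_meet[OF s(2) stL] by (simp add: top_meet)
        then show ?thesis
          using T.heyting_in[OF s(2) st(2)] by simp
      qed
      moreover have "x = ?s \<sqinter> ?t"
      proof (rule le_antisym)
        show "x \<sqsubseteq> ?s \<sqinter> ?t"
          using xL by (simp add: le_meet_iff S.le_j le_heyting)
        show "?s \<sqinter> ?t \<sqsubseteq> x"
          using heyting_mp[OF s(2) xL] by (simp add: meet_comm)
      qed (use xL in auto)
      ultimately show "x \<in> sublocale_join L S ?I"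
        unfolding sublocale_join_def using s(1)
        by (intro CollectI exI[of _ ?s] exI[of _ ?t]) auto
    qed
    moreover have "sublocale_of L ?I" using sublocale_of_Inter sA by blast
    moreover have "(\<lambda>T. S \<sqinter>\<^bsub>Sl L\<^esub> T) ` A = sublocale_join L S ` A"
      using J by force
    moreover have "sublocale_join L S ` A \<subseteq> carrier (Sl L)"
      using sublocale_of_join sS sA by (auto simp: carrier_Sl)
    ultimately show "S \<sqinter>\<^bsub>Sl L\<^esub> \<Squnion>\<^bsub>Sl L\<^esub>A = \<Squnion>\<^bsub>Sl L\<^esub>((\<lambda>T. S \<sqinter>\<^bsub>Sl L\<^esub> T) ` A)"
      using A sS by (simp add: Sl_Sup Sl_meet)
  qed
qed

lemma can_eq: "U \<in> carrier L \<Longrightarrow> can L U = {V \<in> carrier L. U \<sqsubseteq> V}"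
  by (simp add: can_def)

lemma sublocale_of_can:
  assumes "U \<in> carrier L" shows "sublocale_of L (can L U)"
proof
  show "can L U \<subseteq> carrier L" using assms by (auto simp: can_eq)
  show "\<Sqinter>A \<in> can L U" if "A \<subseteq> can L U" for A
    using that assms by (auto simp: can_eq le_inf_iff subset_iff)
  show "W \<Rrightarrow> V \<in> can L U" if "W \<in> carrier L" "V \<in> can L U" for W V
    using that assms by (auto simp: can_eq intro: le_trans[OF _ le_heyting])
qed

end

section \<open>Preimages of sublocales as pullbacks\<close>

text \<open>The largest sublocale of \<open>L\<close> that \<open>f\<close> maps into \<open>T\<close>. A sublocale is closed under Heyting
  implication, so each \<open>V\<close> in it must satisfy \<open>f\<^sub>*(U \<Rrightarrow> V) \<in> T\<close> for all \<open>U\<close>; the elements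
  satisfying this condition already form a sublocale.\<close>

definition preim :: "'a gorder \<Rightarrow> 'b gorder \<Rightarrow> ('b \<Rightarrow> 'a) \<Rightarrow> 'b set \<Rightarrow> 'a set" where
  "preim L M f T = {V \<in> carrier L. \<forall>U\<in>carrier L. direct_image L M f (U \<Rrightarrow>\<^bsub>L\<^esub> V) \<in> T}"

context frame_map
begin

abbreviation pushforward_open (\<open>f\<^sub>*\<close>) where "f\<^sub>* \<equiv> direct_image L M f"

lemma sublocale_of_preim:
  assumes "sublocale_of M T" shows "sublocale_of L (preim L M f T)"
proof
  interpret T: sublocale_of M T by fact
  show "preim L M f T \<subseteq> carrier L" by (auto simp: preim_def)
  show "\<Sqinter>\<^bsub>L\<^esub>A \<in> preim L M f T" if "A \<subseteq> preim L M f T" for A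
  proof -
    have A: "A \<subseteq> carrier L" using that by (auto simp: preim_def)
    have "f\<^sub>* (U \<Rrightarrow>\<^bsub>L\<^esub> \<Sqinter>\<^bsub>L\<^esub>A) \<in> T" if U: "U \<in> carrier L" for U
    proof -
      have "f\<^sub>* (U \<Rrightarrow>\<^bsub>L\<^esub> \<Sqinter>\<^bsub>L\<^esub>A) = \<Sqinter>\<^bsub>M\<^esub>((\<lambda>V. f\<^sub>* (U \<Rrightarrow>\<^bsub>L\<^esub> V)) ` A)"
        using U A by (subst L.heyting_inf, simp_all) (subst direct_image_inf, auto simp: image_image)
      also have "\<dots> \<in> T"
        using U \<open>A \<subseteq> preim L M f T\<close> by (intro T.inf_in) (auto simp: preim_def)
      finally show ?thesis .
    qed
    then show ?thesis using A by (simp add: preim_def)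
  qed
  show "U \<Rrightarrow>\<^bsub>L\<^esub> V \<in> preim L M f T" if "U \<in> carrier L" "V \<in> preim L M f T" for U V
    using that by (auto simp: preim_def L.heyting_heyting)
qed

lemma preim_Inter: "preim L M f (carrier M \<inter> \<Inter>A) = carrier L \<inter> \<Inter>(preim L M f ` A)"
  by (auto simp: preim_def)

lemma preim_mono: "S \<subseteq> T \<Longrightarrow> preim L M f S \<subseteq> preim L M f T"
  by (auto simp: preim_def)

lemma preim_top: "preim L M f {\<top>\<^bsub>M\<^esub>} = {\<top>\<^bsub>L\<^esub>}"
proof (intro equalityI subsetI)
  fix V assume V: "V \<in> preim L M f {\<top>\<^bsub>M\<^esub>}"
  then have VL: "V \<in> carrier L" and "f\<^sub>* (\<top>\<^bsub>L\<^esub> \<Rrightarrow>\<^bsub>L\<^esub> V) = \<top>\<^bsub>M\<^esub>"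
    by (auto simp: preim_def)
  then have "\<top>\<^bsub>M\<^esub> \<sqsubseteq>\<^bsub>M\<^esub> f\<^sub>* V"
    by (simp add: L.top_heyting)
  then have "\<top>\<^bsub>L\<^esub> \<sqsubseteq>\<^bsub>L\<^esub> V"
    using VL by (simp add: le_direct_image f_top)
  then show "V \<in> {\<top>\<^bsub>L\<^esub>}"
    using VL L.le_antisym by simp
next
  fix V assume V: "V \<in> {\<top>\<^bsub>L\<^esub>}"
  then show "V \<in> preim L M f {\<top>\<^bsub>M\<^esub>}"
    by (auto simp: preim_def intro!: M.eq_by_lower simp: le_direct_image L.heyting_galois)
qed

lemma preim_can:
  assumes "W \<in> carrier M" shows "preim L M f (can M W) = can L (f W)"
proof (intro equalityI subsetI)
  fix V assume V: "V \<in> preim L M f (can M W)"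
  then have VL: "V \<in> carrier L" and "W \<sqsubseteq>\<^bsub>M\<^esub> f\<^sub>* (\<top>\<^bsub>L\<^esub> \<Rrightarrow>\<^bsub>L\<^esub> V)"
    using assms by (auto simp: preim_def M.can_eq)
  then show "V \<in> can L (f W)"
    using assms by (simp add: le_direct_image L.can_eq L.top_heyting)
next
  fix V assume "V \<in> can L (f W)"
  then show "V \<in> preim L M f (can M W)"
    using assms by (auto simp: L.can_eq M.can_eq preim_def le_direct_image
        intro: L.le_trans[OF _ L.le_heyting])
qed

text \<open>For the inclusion of the left side, let \<open>V\<close> be in it, let \<open>a\<close> be the reflection of \<open>V\<close> into the
  preimage of \<open>S\<close>, and \<open>b = a \<Rrightarrow> V\<close>. Then \<open>V = a \<sqinter> b\<close>, and \<open>b\<close> has to be shown to lie in the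
  preimage of \<open>T\<close>, that is \<open>w = f\<^sub>*((U \<sqinter> a) \<Rrightarrow> V)\<close> has to lie above its reflection \<open>y\<close> into \<open>T\<close>.
  With \<open>Y = f y \<sqinter> U \<sqinter> a\<close> this says \<open>Y \<sqsubseteq> V\<close>. As \<open>Y \<sqsubseteq> a\<close>, it is enough to have
  \<open>a \<sqsubseteq> Y \<Rrightarrow> V\<close>, and since \<open>V \<sqsubseteq> Y \<Rrightarrow> V\<close>, this holds once \<open>Y \<Rrightarrow> V\<close> lies in the preimage
  of \<open>S\<close>. There the hypothesis on \<open>V\<close> gives \<open>f\<^sub>*(Z \<Rrightarrow> V) = s \<sqinter> t\<close> for \<open>Z \<sqsubseteq> Y\<close>; from
  \<open>w \<sqsubseteq> t\<close> follows \<open>y \<sqsubseteq> t\<close>, so \<open>Z \<sqsubseteq> f t\<close>. Hence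
  \<open>f s \<sqinter> Z \<sqsubseteq> f (s \<sqinter> t) \<sqinter> Z \<sqsubseteq> V\<close>, that is \<open>s \<sqsubseteq> s \<sqinter> t\<close>, and \<open>s \<sqinter> t = s\<close> is in \<open>S\<close>.\<close>

lemma preim_join:
  assumes "sublocale_of M S" "sublocale_of M T"
  shows "preim L M f (sublocale_join M S T) = sublocale_join L (preim L M f S) (preim L M f T)"
    (is "?P = ?Q")
proof
  interpret S: sublocale_of M S by fact
  interpret T: sublocale_of M T by fact
  interpret ST: sublocale_of M "sublocale_join M S T"
    using assms by (rule M.sublocale_of_join)
  interpret P: sublocale_of L ?P
    by (rule sublocale_of_preim) (rule ST.sublocale_of_axioms)
  interpret PS: sublocale_of L "preim L M f S"
    by (rule sublocale_of_preim) fact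
  have "S \<subseteq> sublocale_join M S T" "T \<subseteq> sublocale_join M S T"
    using M.subset_sublocale_join assms by blast+
  then have "preim L M f S \<subseteq> ?P" "preim L M f T \<subseteq> ?P"
    by (simp_all add: preim_mono)
  then show "?Q \<subseteq> ?P"
    unfolding sublocale_join_def[of L] using P.meet_in by auto
  show "?P \<subseteq> ?Q"
  proof
    fix V assume V: "V \<in> ?P"
    then have VL: "V \<in> carrier L" by (rule P.in_carrier)
    define a where "a = PS.j V"
    define b where "b = a \<Rrightarrow>\<^bsub>L\<^esub> V"
    have a: "a \<in> preim L M f S" "a \<in> carrier L" using VL by (simp_all add: a_def PS.j_in)
    have b: "b \<in> carrier L" by (simp add: b_def)
    have "b \<in> preim L M f T"
      unfolding preim_def
    proof (intro CollectI conjI ballI)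
      fix U assume U: "U \<in> carrier L"
      define X where "X = U \<sqinter>\<^bsub>L\<^esub> a"
      have X: "X \<in> carrier L" using U a by (simp add: X_def)
      define w where "w = f\<^sub>* (X \<Rrightarrow>\<^bsub>L\<^esub> V)"
      have w: "w \<in> carrier M" by (simp add: w_def)
      have w_eq: "f\<^sub>* (U \<Rrightarrow>\<^bsub>L\<^esub> b) = w"
        using U a VL by (simp add: w_def X_def b_def L.heyting_heyting)
      have le_w: "y \<sqsubseteq>\<^bsub>M\<^esub> w \<longleftrightarrow> f y \<sqinter>\<^bsub>L\<^esub> X \<sqsubseteq>\<^bsub>L\<^esub> V" if "y \<in> carrier M" for y
        using that X VL by (simp add: w_def le_direct_image L.heyting_galois)
      define y where "y = T.j w"
      have y: "y \<in> T" "y \<in> carrier M" using w by (simp_all add: y_def T.j_in)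
      define Y where "Y = f y \<sqinter>\<^bsub>L\<^esub> X"
      have Y: "Y \<in> carrier L" using X y by (simp add: Y_def)
      have "Y \<Rrightarrow>\<^bsub>L\<^esub> V \<in> preim L M f S"
        unfolding preim_def
      proof (intro CollectI conjI ballI)
        fix U' assume U': "U' \<in> carrier L"
        define Z where "Z = U' \<sqinter>\<^bsub>L\<^esub> Y"
        have Z: "Z \<in> carrier L" using U' Y by (simp add: Z_def)
        have ZY: "Z \<sqsubseteq>\<^bsub>L\<^esub> Y" using U' Y by (simp add: Z_def L.meet_right)
        have ZX: "Z \<sqsubseteq>\<^bsub>L\<^esub> X" and Zy: "Z \<sqsubseteq>\<^bsub>L\<^esub> f y"
          using ZY X y Z Y by (simp_all add: Y_def L.le_meet_iff)
        have le_Z: "v \<sqsubseteq>\<^bsub>M\<^esub> f\<^sub>* (Z \<Rrightarrow>\<^bsub>L\<^esub> V) \<longleftrightarrow> f v \<sqinter>\<^bsub>L\<^esub> Z \<sqsubseteq>\<^bsub>L\<^esub> V" if "v \<in> carrier M" for v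
          using that Z VL by (simp add: le_direct_image L.heyting_galois)
        have "f\<^sub>* (Z \<Rrightarrow>\<^bsub>L\<^esub> V) \<in> sublocale_join M S T"
          using V Z by (simp add: preim_def)
        then obtain s t where st: "s \<in> S" "t \<in> T" "f\<^sub>* (Z \<Rrightarrow>\<^bsub>L\<^esub> V) = s \<sqinter>\<^bsub>M\<^esub> t"
          by (auto simp: sublocale_join_def)
        note stM = S.in_carrier[OF st(1)] T.in_carrier[OF st(2)]
        have "f w \<sqinter>\<^bsub>L\<^esub> Z \<sqsubseteq>\<^bsub>L\<^esub> f w \<sqinter>\<^bsub>L\<^esub> X"
          using w Z X ZX by (intro L.meet_mono) auto
        moreover have "f w \<sqinter>\<^bsub>L\<^esub> X \<sqsubseteq>\<^bsub>L\<^esub> V"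
          using le_w[OF w] w by simp
        ultimately have "f w \<sqinter>\<^bsub>L\<^esub> Z \<sqsubseteq>\<^bsub>L\<^esub> V"
          by (rule L.le_trans) (use w Z X VL in auto)
        then have "w \<sqsubseteq>\<^bsub>M\<^esub> t"
          using w stM st(3) le_Z[OF w] by (simp add: M.le_meet_iff)
        then have "y \<sqsubseteq>\<^bsub>M\<^esub> t"
          using w st(2) by (simp add: y_def T.j_le_iff)
        then have "f y \<sqsubseteq>\<^bsub>L\<^esub> f t"
          using y stM by (intro f_mono)
        with Zy have "Z \<sqsubseteq>\<^bsub>L\<^esub> f t"
          by (rule L.le_trans) (use Z y stM in auto)
        then have "f s \<sqinter>\<^bsub>L\<^esub> Z \<sqsubseteq>\<^bsub>L\<^esub> f t"
          using L.le_trans[OF L.meet_right] stM Z by simp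
        then have "f s \<sqinter>\<^bsub>L\<^esub> Z \<sqsubseteq>\<^bsub>L\<^esub> f (s \<sqinter>\<^bsub>M\<^esub> t) \<sqinter>\<^bsub>L\<^esub> Z"
          using stM Z by (simp add: f_meet L.le_meet_iff L.meet_left L.meet_right)
        moreover have "f (s \<sqinter>\<^bsub>M\<^esub> t) \<sqinter>\<^bsub>L\<^esub> Z \<sqsubseteq>\<^bsub>L\<^esub> V"
          using le_Z[of "s \<sqinter>\<^bsub>M\<^esub> t"] stM st(3) by simp
        ultimately have "f s \<sqinter>\<^bsub>L\<^esub> Z \<sqsubseteq>\<^bsub>L\<^esub> V"
          using stM Z VL by (auto intro: L.le_trans)
        then have "s \<sqsubseteq>\<^bsub>M\<^esub> s \<sqinter>\<^bsub>M\<^esub> t"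
          using le_Z[of s] stM st(3) by simp
        then have "s \<sqinter>\<^bsub>M\<^esub> t = s"
          using stM by (intro M.le_antisym) (auto intro: M.meet_left)
        then show "f\<^sub>* (U' \<Rrightarrow>\<^bsub>L\<^esub> Y \<Rrightarrow>\<^bsub>L\<^esub> V) \<in> S"
          using st U' Y VL by (simp add: L.heyting_heyting Z_def)
      qed simp
      then have "a \<sqsubseteq>\<^bsub>L\<^esub> Y \<Rrightarrow>\<^bsub>L\<^esub> V"
        using Y VL by (simp add: a_def PS.j_le_iff L.le_heyting)
      then have "a \<sqinter>\<^bsub>L\<^esub> Y \<sqsubseteq>\<^bsub>L\<^esub> V"
        using a Y VL by (simp add: L.heyting_galois)
      moreover have "Y \<sqsubseteq>\<^bsub>L\<^esub> a \<sqinter>\<^bsub>L\<^esub> Y"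
      proof -
        have "X \<sqsubseteq>\<^bsub>L\<^esub> a" using U a by (simp add: X_def L.meet_right)
        moreover have "Y \<sqsubseteq>\<^bsub>L\<^esub> X" using X y by (simp add: Y_def L.meet_right)
        ultimately show ?thesis
          using a X Y L.le_trans[of Y X a] by (simp add: L.le_meet_iff)
      qed
      ultimately have "Y \<sqsubseteq>\<^bsub>L\<^esub> V"
        using a Y VL by (auto intro: L.le_trans)
      then have "y \<sqsubseteq>\<^bsub>M\<^esub> w"
        using le_w[OF y(2)] by (simp add: Y_def)
      then have "w = y"
        using w y by (intro M.le_antisym) (auto simp: y_def T.le_j)
      then show "f\<^sub>* (U \<Rrightarrow>\<^bsub>L\<^esub> b) \<in> T"
        using y by (simp add: w_eq)
    qed (rule b)
    moreover have "V = a \<sqinter>\<^bsub>L\<^esub> b"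
    proof (rule L.le_antisym)
      show "V \<sqsubseteq>\<^bsub>L\<^esub> a \<sqinter>\<^bsub>L\<^esub> b"
        using VL a b PS.le_j[OF VL] L.le_heyting[OF a(2) VL] by (simp add: L.le_meet_iff a_def b_def)
      show "a \<sqinter>\<^bsub>L\<^esub> b \<sqsubseteq>\<^bsub>L\<^esub> V"
        using L.heyting_mp[OF a(2) VL] by (simp add: b_def meet_comm)
    qed (use VL a b in auto)
    ultimately show "V \<in> ?Q"
      unfolding sublocale_join_def using a by blast
  qed
qed

lemma frame_hom_preim: "frame_hom (Sl M) (Sl L) (\<lambda>T\<in>carrier (Sl M). preim L M f T)"
proof (rule frame_homI)
  let ?h = "\<lambda>T\<in>carrier (Sl M). preim L M f T"
  show "?h \<in> carrier (Sl M) \<rightarrow>\<^sub>E carrier (Sl L)"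
    using sublocale_of_preim by (auto simp: L.carrier_Sl M.carrier_Sl)
  show "?h (\<Squnion>\<^bsub>Sl M\<^esub>A) = \<Squnion>\<^bsub>Sl L\<^esub>(?h ` A)" if A: "A \<subseteq> carrier (Sl M)" for A
  proof -
    have "?h ` A = preim L M f ` A" using A by force
    moreover have "preim L M f ` A \<subseteq> carrier (Sl L)"
      using A sublocale_of_preim by (auto simp: L.carrier_Sl M.carrier_Sl)
    moreover have "sublocale_of M (carrier M \<inter> \<Inter>A)"
      using A M.sublocale_of_Inter by (auto simp: M.carrier_Sl)
    ultimately show ?thesis
      using A by (simp add: L.Sl_Sup M.Sl_Sup preim_Inter M.carrier_Sl)
  qed
  show "?h \<top>\<^bsub>Sl M\<^esub> = \<top>\<^bsub>Sl L\<^esub>"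
    by (simp add: L.Sl_top M.Sl_top preim_top M.carrier_Sl M.sublocale_of_top)
  show "?h (S \<sqinter>\<^bsub>Sl M\<^esub> T) = ?h S \<sqinter>\<^bsub>Sl L\<^esub> ?h T"
    if "S \<in> carrier (Sl M)" "T \<in> carrier (Sl M)" for S T
    using that by (simp add: M.carrier_Sl M.Sl_meet L.Sl_meet sublocale_of_preim M.sublocale_of_join preim_join)
qed (rule L.complete_lattice_Sl M.complete_lattice_Sl)+

end

lemma (in plain_frame) frame_map_ident: "frame_map L L (\<lambda>U\<in>carrier L. U)"
  by unfold_locales (rule frame_hom_ident[OF complete_lattice_axioms])

lemma (in sublocale_of) preim_ident: "preim L L (\<lambda>U\<in>carrier L. U) S = S"
proof -
  interpret i: frame_map L L "\<lambda>U\<in>carrier L. U" by (rule frame_map_ident)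
  have d: "direct_image L L (\<lambda>U\<in>carrier L. U) V = V" if "V \<in> carrier L" for V
    using that by (intro eq_by_lower) (auto simp: i.le_direct_image)
  show ?thesis
  proof (intro equalityI subsetI)
    show "V \<in> S" if "V \<in> preim L L (\<lambda>U\<in>carrier L. U) S" for V
      using that d top_heyting[of V] by (auto simp: preim_def dest: bspec[of _ _ \<top>])
    show "V \<in> preim L L (\<lambda>U\<in>carrier L. U) S" if "V \<in> S" for V
      using that by (auto simp: preim_def d in_carrier heyting_in)
  qed
qed

lemma frame_map_compose:
  assumes "frame_map L M f" "frame_map M N g"
  shows "frame_map L N (\<lambda>W\<in>carrier N. f (g W))"
proof -
  interpret f: frame_map L M f by fact
  interpret g: frame_map M N g by fact
  show ?thesis
    by unfold_locales (rule frame_hom_compose[OF _ _ _ g.hom f.hom]; unfold_locales)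
qed

text \<open>Both sides range over the elements
  \<open>g\<^sub>*(U' \<Rrightarrow> f\<^sub>*(U \<Rrightarrow> V)) = (g \<circ> f)\<^sub>*((f U' \<sqinter> U) \<Rrightarrow> V)\<close>; the choice \<open>U' = \<top>\<close> recovers all
  elements of the condition for the composite.\<close>

lemma preim_compose:
  assumes "frame_map L M f" "frame_map M N g"
  shows "preim L N (\<lambda>W\<in>carrier N. f (g W)) T = preim L M f (preim M N g T)"
proof -
  interpret f: frame_map L M f by fact
  interpret g: frame_map M N g by fact
  let ?h = "\<lambda>W\<in>carrier N. f (g W)"
  interpret h: frame_map L N ?h using assms by (rule frame_map_compose)
  have *: "direct_image M N g (U' \<Rrightarrow>\<^bsub>M\<^esub> direct_image L M f (U \<Rrightarrow>\<^bsub>L\<^esub> V))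
      = direct_image L N ?h ((f U' \<sqinter>\<^bsub>L\<^esub> U) \<Rrightarrow>\<^bsub>L\<^esub> V)"
    if "U' \<in> carrier M" "U \<in> carrier L" "V \<in> carrier L" for U' U V
    using that
    by (intro f.M.eq_by_lower g.M.eq_by_lower)
      (auto simp: g.le_direct_image f.le_direct_image h.le_direct_image f.L.heyting_galois
        f.M.heyting_galois f.f_meet f.L.meet_assoc)
  show ?thesis
  proof (intro equalityI subsetI)
    fix V assume "V \<in> preim L N ?h T"
    then show "V \<in> preim L M f (preim M N g T)"
      by (auto simp: preim_def *)
  next
    fix V assume V: "V \<in> preim L M f (preim M N g T)"
    have "direct_image L N ?h (U \<Rrightarrow>\<^bsub>L\<^esub> V) \<in> T" if U: "U \<in> carrier L" for U
    proof -
      have "V \<in> carrier L" "direct_image M N g (\<top>\<^bsub>M\<^esub> \<Rrightarrow>\<^bsub>M\<^esub> direct_image L M f (U \<Rrightarrow>\<^bsub>L\<^esub> V)) \<in> T"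
        using V U by (auto simp: preim_def)
      then show ?thesis
        using U by (simp add: * f.f_top f.L.top_meet)
    qed
    then show "V \<in> preim L N ?h T"
      using V by (auto simp: preim_def)
  qed
qed

context
  fixes L M :: "'a gorder" and f T
  assumes fm: "frame_map L M f" and sT: "sublocale_of M T"
begin

interpretation frame_map L M f by (rule fm)
interpretation T: sublocale_of M T by (rule sT)
interpretation P: sublocale_of L "preim L M f T" by (rule sublocale_of_preim[OF sT])

text \<open>On elements of the preimage, \<open>f\<^sub>*\<close> takes values in \<open>T\<close>, and these do not distinguish \<open>W\<close> from
  its reflection. This makes the pullback square commute.\<close>

lemma reflection_preim_invariant:
  assumes "W \<in> carrier M" shows "P.j (f (T.j W)) = P.j (f W)"
proof -
  have *: "V \<in> preim L M f T \<Longrightarrow> f (T.j W) \<sqsubseteq>\<^bsub>L\<^esub> V \<longleftrightarrow> f W \<sqsubseteq>\<^bsub>L\<^esub> V" for V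
  proof -
    assume V: "V \<in> preim L M f T"
    then have "f\<^sub>* (\<top>\<^bsub>L\<^esub> \<Rrightarrow>\<^bsub>L\<^esub> V) \<in> T" "V \<in> carrier L"
      by (auto simp: preim_def)
    then have "f\<^sub>* V \<in> T" "V \<in> carrier L"
      by (simp_all add: L.top_heyting)
    then show ?thesis
      using assms T.j_le_iff[of W "f\<^sub>* V"] by (simp add: le_direct_image)
  qed
  show ?thesis
    using assms *[of "P.j (f W)"] *[of "P.j (f (T.j W))"]
    by (intro L.le_antisym) (auto simp: P.j_le_iff P.j_in P.le_j)
qed

text \<open>The universal property of the preimage: if \<open>u\<close> after \<open>f\<close> does not distinguish \<open>W\<close> from its
  reflection into \<open>T\<close>, then \<open>u\<close> factors through the preimage. The reason is that the right adjoint
  of \<open>u\<close> takes its values in the preimage.\<close>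

lemma preim_factor:
  assumes "frame N" "frame_hom L N u" "\<And>W. W \<in> carrier M \<Longrightarrow> u (f (T.j W)) = u (f W)"
    and "W \<in> carrier L"
  shows "u (P.j W) = u W"
proof -
  interpret u: frame_map N L u
    using assms(1,2) by (auto simp: frame_map_def plain_frame_def frame_map_axioms_def L.frame_axioms)
  let ?V = "direct_image N L u (u W)"
  have "?V \<in> preim L M f T"
    unfolding preim_def
  proof (intro CollectI conjI ballI)
    fix U assume U: "U \<in> carrier L"
    let ?w = "f\<^sub>* (U \<Rrightarrow>\<^bsub>L\<^esub> ?V)"
    have le: "w \<sqsubseteq>\<^bsub>M\<^esub> ?w \<longleftrightarrow> u (f w) \<sqinter>\<^bsub>N\<^esub> u U \<sqsubseteq>\<^bsub>N\<^esub> u W" if "w \<in> carrier M" for w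
      using that U assms(4) by (simp add: le_direct_image L.heyting_galois u.le_direct_image u.f_meet)
    have "T.j ?w \<sqsubseteq>\<^bsub>M\<^esub> ?w"
      using le[of ?w] le[of "T.j ?w"] by (simp add: assms(3))
    then have "T.j ?w = ?w"
      by (intro M.le_antisym) (auto simp: T.le_j)
    then show "?w \<in> T" using T.j_in[of ?w] by simp
  qed simp
  moreover have "W \<sqsubseteq>\<^bsub>L\<^esub> ?V" using assms(4) by (simp add: u.le_direct_image)
  ultimately have "P.j W \<sqsubseteq>\<^bsub>L\<^esub> ?V" using assms(4) by (simp add: P.j_le_iff)
  then have "u (P.j W) \<sqsubseteq>\<^bsub>N\<^esub> u W" using assms(4) by (simp add: u.le_direct_image)
  then show ?thesis
    using assms(4) by (intro u.L.le_antisym) (auto intro: u.f_mono P.le_j)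
qed

lemma pullback_preim:
  "is_pullback Loc L (sub_order M T) M (sub_order L (preim L M f T)) f (incl M T)
     (incl L (preim L M f T)) (\<lambda>t\<in>T. P.j (f t))" (is "is_pullback _ _ _ _ ?P _ _ _ ?q")
  unfolding is_pullback_def
proof (intro conjI ballI impI)
  show "incl L (preim L M f T) \<in> Hom Loc ?P L"
    using P.frame_hom_j by (simp add: Loc_def P.incl_eq)
  have h: "frame_hom M ?P (\<lambda>W\<in>carrier M. P.j (f W))"
    by (rule frame_hom_compose[OF _ _ _ hom P.frame_hom_j]; unfold_locales)
  have "frame_hom (sub_order M T) ?P (\<lambda>V\<in>T. (\<lambda>W\<in>carrier M. P.j (f W)) V)"
    using h by (rule T.frame_hom_factor[OF P.frame_sub]) (simp add: reflection_preim_invariant)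
  moreover have "(\<lambda>V\<in>T. (\<lambda>W\<in>carrier M. P.j (f W)) V) = ?q"
    by (rule restrict_ext) (simp add: T.in_carrier)
  ultimately have "frame_hom (sub_order M T) ?P ?q"
    by (simp only:)
  then show "?q \<in> Hom Loc ?P (sub_order M T)"
    by (simp add: Loc_def)
  show "Comp Loc ?P L M f (incl L (preim L M f T)) = Comp Loc ?P (sub_order M T) M (incl M T) ?q"
    by (auto simp: Loc_def P.incl_eq T.incl_eq T.j_in reflection_preim_invariant)
  fix N u v
  assume N: "N \<in> Obj Loc" and "u \<in> Hom Loc N L" "v \<in> Hom Loc N (sub_order M T)"
    and eq: "Comp Loc N L M f u = Comp Loc N (sub_order M T) M (incl M T) v"
  then have u: "frame_hom L N u" and v: "frame_hom (sub_order M T) N v" and N: "frame N"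
    by (simp_all add: Loc_def)
  have uv: "u (f W) = v (T.j W)" if "W \<in> carrier M" for W
    using fun_cong[OF eq, of W] that by (simp add: Loc_def T.incl_eq)
  have uj: "u (P.j W) = u W" if "W \<in> carrier L" for W
    using N u _ that by (rule preim_factor) (simp add: uv T.j_in T.j_fixed)
  show "\<exists>!k. k \<in> Hom Loc N ?P \<and> Comp Loc N ?P L (incl L (preim L M f T)) k = u \<and>
          Comp Loc N ?P (sub_order M T) ?q k = v"
  proof (intro ex1I[of _ "\<lambda>V\<in>preim L M f T. u V"] conjI)
    show "(\<lambda>V\<in>preim L M f T. u V) \<in> Hom Loc N ?P"
      using P.frame_hom_factor[OF N u uj] by (simp add: Loc_def)
    show "Comp Loc N ?P L (incl L (preim L M f T)) (\<lambda>V\<in>preim L M f T. u V) = u"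
      using u by (intro extensionalityI[of _ "carrier L"])
        (auto simp: Loc_def P.incl_eq P.j_in uj frame_hom_def PiE_def)
    show "Comp Loc N ?P (sub_order M T) ?q (\<lambda>V\<in>preim L M f T. u V) = v"
      using v by (intro extensionalityI[of _ T])
        (auto simp: Loc_def P.j_in uj uv T.in_carrier T.j_fixed frame_hom_def PiE_def)
    fix k assume k: "k \<in> Hom Loc N ?P \<and> Comp Loc N ?P L (incl L (preim L M f T)) k = u \<and>
          Comp Loc N ?P (sub_order M T) ?q k = v"
    then have "k (P.j W) = u W" if "W \<in> carrier L" for W
      using that by (auto simp: Loc_def P.incl_eq)
    then have "k V = u V" if "V \<in> preim L M f T" for V
      using that P.j_fixed[OF that] P.in_carrier[OF that] by metis
    then show "k = (\<lambda>V\<in>preim L M f T. u V)"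
      using k by (intro extensionalityI[of _ "preim L M f T"]) (auto simp: Loc_def frame_hom_def PiE_def)
  qed
qed

text \<open>Two sublocales that are both pullbacks factor through each other over \<open>L\<close>, so they are equal as
  sets.\<close>

lemma preimage_eq: "preimage L M f T = preim L M f T"
  unfolding preimage_def
proof (rule the_equality)
  show "is_sublocale L (preim L M f T) \<and>
    (\<exists>q. is_pullback Loc L (sub_order M T) M (sub_order L (preim L M f T)) f (incl M T)
      (incl L (preim L M f T)) q)"
    using pullback_preim P.is_sublocale by blast
  have sub: "S' \<subseteq> S" if pb: "is_pullback Loc L (sub_order M T) M (sub_order L S) f (incl M T) (incl L S) q"
    and pb': "is_pullback Loc L (sub_order M T) M (sub_order L S') f (incl M T) (incl L S') q'"
    and S: "sublocale_of L S" and S': "sublocale_of L S'" for S S' q q'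
  proof
    interpret S: sublocale_of L S by fact
    interpret S': sublocale_of L S' by fact
    have "sub_order L S' \<in> Obj Loc" using S'.frame_sub by (simp add: Loc_def)
    then obtain k where "Comp Loc (sub_order L S') (sub_order L S) L (incl L S) k = incl L S'"
      using pb pb' unfolding is_pullback_def by meson
    then have "(\<lambda>W\<in>carrier L. k (S.j W)) = S'.j"
      by (simp add: Loc_def S.incl_eq S'.incl_eq)
    then have k: "k (S.j W) = S'.j W" if "W \<in> carrier L" for W
      using that by (metis restrict_apply')
    fix x assume x: "x \<in> S'"
    then have xL: "x \<in> carrier L" by (rule S'.in_carrier)
    have "S'.j (S.j x) = k (S.j (S.j x))"
      using xL by (simp add: k)
    also have "\<dots> = x"
      using k[OF xL] S'.j_fixed[OF x] S.j_fixed[OF S.j_in[OF xL]] by simp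
    finally have "S.j x \<sqsubseteq>\<^bsub>L\<^esub> x"
      using S'.le_j[of "S.j x"] xL by simp
    then have "S.j x = x"
      using xL by (intro L.le_antisym) (auto simp: S.le_j)
    then show "x \<in> S" using S.j_in[OF xL] by simp
  qed
  fix S assume "is_sublocale L S \<and>
    (\<exists>q. is_pullback Loc L (sub_order M T) M (sub_order L S) f (incl M T) (incl L S) q)"
  then obtain q where "sublocale_of L S"
    and "is_pullback Loc L (sub_order M T) M (sub_order L S) f (incl M T) (incl L S) q"
    using sublocale_of_iff[OF L.frame_axioms] by blast
  then show "S = preim L M f T"
    using sub pullback_preim P.sublocale_of_axioms by blast
qed

end

lemma Sl_map_eq:
  assumes "frame_map L M f" shows "Sl_map L M f = (\<lambda>T\<in>carrier (Sl M). preim L M f T)"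
proof -
  interpret frame_map L M f by fact
  show ?thesis
    unfolding Sl_map_def by (rule restrict_ext) (simp add: M.carrier_Sl preimage_eq[OF assms])
qed

section \<open>Lifting frame homomorphisms along the closed sublocales\<close>

text \<open>The image of the nucleus \<open>U \<Rrightarrow> _\<close>, complementary to the closed sublocale \<open>can L U\<close>.\<close>

definition open_sublocale :: "'a gorder \<Rightarrow> 'a \<Rightarrow> 'a set" where
  "open_sublocale L U = {V \<in> carrier L. U \<Rrightarrow>\<^bsub>L\<^esub> V = V}"

definition boolean_frame :: "'a gorder \<Rightarrow> bool" where
  "boolean_frame L \<longleftrightarrow> frame L \<and>
     (\<forall>U\<in>carrier L. \<exists>V\<in>carrier L. U \<sqinter>\<^bsub>L\<^esub> V = \<bottom>\<^bsub>L\<^esub> \<and> U \<squnion>\<^bsub>L\<^esub> V = \<top>\<^bsub>L\<^esub>)"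

context plain_frame
begin

lemma heyting_eq_top: "\<lbrakk>U \<in> carrier L; V \<in> carrier L; U \<sqsubseteq> V\<rbrakk> \<Longrightarrow> U \<Rrightarrow> V = \<top>"
  using le_trans[OF meet_right] by (intro eq_by_lower) (simp_all add: heyting_galois)

lemma sublocale_of_open:
  assumes "U \<in> carrier L" shows "sublocale_of L (open_sublocale L U)"
proof
  show "\<Sqinter>A \<in> open_sublocale L U" if A: "A \<subseteq> open_sublocale L U" for A
  proof -
    have AL: "A \<subseteq> carrier L" using A by (auto simp: open_sublocale_def)
    have "(\<lambda>V. U \<Rrightarrow> V) ` A = A" using A by (force simp: open_sublocale_def)
    then show ?thesis
      using heyting_inf[OF assms AL] AL by (simp add: open_sublocale_def)
  qed
  show "W \<Rrightarrow> V \<in> open_sublocale L U" if W: "W \<in> carrier L" and V: "V \<in> open_sublocale L U" for W V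
  proof -
    have V: "V \<in> carrier L" "U \<Rrightarrow> V = V" using V by (auto simp: open_sublocale_def)
    have "U \<Rrightarrow> (W \<Rrightarrow> V) = W \<Rrightarrow> (U \<Rrightarrow> V)"
      using assms W V(1) by (simp add: heyting_heyting meet_comm)
    then show ?thesis using V by (simp add: open_sublocale_def)
  qed
qed (auto simp: open_sublocale_def)

text \<open>Every \<open>V\<close> splits as \<open>V = (V \<squnion> U) \<sqinter> (U \<Rrightarrow> V)\<close>.\<close>

lemma can_meet_open:
  assumes U: "U \<in> carrier L"
  shows "can L U \<sqinter>\<^bsub>Sl L\<^esub> open_sublocale L U = \<bottom>\<^bsub>Sl L\<^esub>"
proof -
  have "V \<in> sublocale_join L (can L U) (open_sublocale L U)" if V: "V \<in> carrier L" for V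
  proof -
    have "V = (V \<squnion> U) \<sqinter> (U \<Rrightarrow> V)"
    proof (rule le_antisym)
      show "V \<sqsubseteq> (V \<squnion> U) \<sqinter> (U \<Rrightarrow> V)"
        using U V by (simp add: le_meet_iff join_left le_heyting)
      have "(U \<Rrightarrow> V) \<sqinter> (V \<squnion> U) = ((U \<Rrightarrow> V) \<sqinter> V) \<squnion> ((U \<Rrightarrow> V) \<sqinter> U)"
        using U V by (simp add: meet_join_distrib)
      also have "\<dots> \<sqsubseteq> V"
        using U V by (simp add: join_le_iff meet_right heyting_mp)
      finally show "(V \<squnion> U) \<sqinter> (U \<Rrightarrow> V) \<sqsubseteq> V" by (simp add: meet_comm)
    qed (use U V in auto)
    moreover have "V \<squnion> U \<in> can L U" using U V by (simp add: can_eq join_right)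
    moreover have "U \<Rrightarrow> V \<in> open_sublocale L U"
      using U V by (simp add: open_sublocale_def heyting_heyting meet_absorb)
    ultimately show ?thesis unfolding sublocale_join_def by blast
  qed
  moreover have "sublocale_join L (can L U) (open_sublocale L U) \<subseteq> carrier L"
    using sublocale_of.subset[OF sublocale_of_join[OF sublocale_of_can[OF U] sublocale_of_open[OF U]]] .
  ultimately show ?thesis
    using sublocale_of_can[OF U] sublocale_of_open[OF U] by (auto simp: Sl_meet Sl_bottom)
qed

lemma can_join_open:
  assumes U: "U \<in> carrier L"
  shows "can L U \<squnion>\<^bsub>Sl L\<^esub> open_sublocale L U = \<top>\<^bsub>Sl L\<^esub>"
proof -
  have "can L U \<inter> open_sublocale L U = {\<top>}"
    using U heyting_eq_top by (auto simp: can_eq open_sublocale_def)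
  then show ?thesis
    using sublocale_of_can[OF U] sublocale_of_open[OF U] by (simp add: Sl_join Sl_top)
qed

text \<open>The members \<open>V\<close> of \<open>S\<close> are characterised by \<open>S.j W \<Rrightarrow> V = W \<Rrightarrow> V\<close> for all \<open>W\<close>. Splitting \<open>V\<close>
  along \<open>S.j W\<close> therefore puts \<open>V\<close> into each of the given joins. Conversely, only \<open>W = V\<close> is needed:
  \<open>V = a \<sqinter> b\<close> with \<open>S.j V \<sqsubseteq> a\<close> and \<open>b = V \<Rrightarrow> b = \<top>\<close> forces \<open>S.j V \<sqsubseteq> V\<close>.\<close>

lemma sublocale_decomposition:
  assumes "sublocale_of L S"
  shows "S = \<Squnion>\<^bsub>Sl L\<^esub>((\<lambda>W. can L (reflection L S W) \<sqinter>\<^bsub>Sl L\<^esub> open_sublocale L W) ` carrier L)"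
proof -
  interpret S: sublocale_of L S by fact
  let ?J = "\<lambda>W. sublocale_join L (can L (S.j W)) (open_sublocale L W)"
  have eq: "can L (S.j W) \<sqinter>\<^bsub>Sl L\<^esub> open_sublocale L W = ?J W"
    if "W \<in> carrier L" for W
    using that by (simp add: Sl_meet sublocale_of_can sublocale_of_open)
  have "S = carrier L \<inter> \<Inter>(?J ` carrier L)"
  proof (intro equalityI subsetI)
    fix V assume VS: "V \<in> S"
    then have V: "V \<in> carrier L" by (rule S.in_carrier)
    have "V \<in> ?J W" if W: "W \<in> carrier L" for W
    proof -
      have "S.j W \<Rrightarrow> V = W \<Rrightarrow> V"
      proof (rule eq_by_lower)
        fix z assume z: "z \<in> carrier L"
        have "z \<sqsubseteq> S.j W \<Rrightarrow> V \<longleftrightarrow> S.j W \<sqsubseteq> z \<Rrightarrow> V"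
          using z V W by (simp add: heyting_galois meet_comm)
        also have "\<dots> \<longleftrightarrow> W \<sqsubseteq> z \<Rrightarrow> V"
          using z VS W by (simp add: S.j_le_iff S.heyting_in)
        also have "\<dots> \<longleftrightarrow> z \<sqsubseteq> W \<Rrightarrow> V"
          using z V W by (simp add: heyting_galois meet_comm)
        finally show "z \<sqsubseteq> S.j W \<Rrightarrow> V \<longleftrightarrow> z \<sqsubseteq> W \<Rrightarrow> V" .
      qed auto
      moreover have "V \<in> sublocale_join L (can L (S.j W)) (open_sublocale L (S.j W))"
        using V W can_meet_open[of "S.j W"] by (simp add: Sl_meet sublocale_of_can sublocale_of_open Sl_bottom)
      then obtain a b where ab: "a \<in> can L (S.j W)" "b \<in> open_sublocale L (S.j W)" "V = a \<sqinter> b"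
        unfolding sublocale_join_def by blast
      have "V = a \<sqinter> (W \<Rrightarrow> V)"
      proof (rule le_antisym)
        have L: "a \<in> carrier L" "b \<in> carrier L" "S.j W \<sqsubseteq> a"
          using ab W by (auto simp: can_eq open_sublocale_def)
        show "V \<sqsubseteq> a \<sqinter> (W \<Rrightarrow> V)"
          using L V W ab(3) by (simp add: le_meet_iff meet_left le_heyting)
        have "S.j W \<Rrightarrow> V = (S.j W \<Rrightarrow> a) \<sqinter> (S.j W \<Rrightarrow> b)"
          using L W by (simp add: ab(3) heyting_meet)
        also have "\<dots> = b"
          using L W ab(2) by (simp add: heyting_eq_top open_sublocale_def top_meet)
        finally show "a \<sqinter> (W \<Rrightarrow> V) \<sqsubseteq> V"
          using V ab(3) \<open>S.j W \<Rrightarrow> V = W \<Rrightarrow> V\<close> by simp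
      qed (use V W ab in \<open>auto simp: can_eq\<close>)
      moreover have "W \<Rrightarrow> V \<in> open_sublocale L W"
        using V W by (simp add: open_sublocale_def heyting_heyting meet_absorb)
      ultimately show ?thesis
        unfolding sublocale_join_def using ab(1) by blast
    qed
    then show "V \<in> carrier L \<inter> \<Inter>(?J ` carrier L)"
      using V by blast
  next
    fix V assume "V \<in> carrier L \<inter> \<Inter>(?J ` carrier L)"
    then have V: "V \<in> carrier L" and "V \<in> ?J V"
      by auto
    then obtain a b where ab: "a \<in> can L (S.j V)" "b \<in> open_sublocale L V" "V = a \<sqinter> b"
      unfolding sublocale_join_def by blast
    then have L: "a \<in> carrier L" "b \<in> carrier L" "S.j V \<sqsubseteq> a" "V \<Rrightarrow> b = b"
      using V by (auto simp: can_eq open_sublocale_def)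
    have "V \<sqsubseteq> b" using L ab(3) by (simp add: meet_right)
    then have "b = \<top>" using L V heyting_eq_top[of V b] by simp
    then have "V = a" using ab(3) L by (simp add: meet_top)
    then have "S.j V = V" using L V by (intro le_antisym) (auto simp: S.le_j)
    then show "V \<in> S" using S.j_in[OF V] by simp
  qed
  moreover have "(\<lambda>W. can L (S.j W) \<sqinter>\<^bsub>Sl L\<^esub> open_sublocale L W) ` carrier L
    = ?J ` carrier L"
    by (rule image_cong[OF HOL.refl eq])
  moreover have "?J ` carrier L \<subseteq> carrier (Sl L)"
    by (auto simp: carrier_Sl intro!: sublocale_of_join sublocale_of_can sublocale_of_open)
  ultimately show ?thesis by (simp add: Sl_Sup)
qed

text \<open>The values on open sublocales are determined as complements, and all other values by
  \<open>sublocale_decomposition\<close>.\<close>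

lemma frame_hom_Sl_unique:
  assumes N: "frame N" and h: "frame_hom (Sl L) N h" and h': "frame_hom (Sl L) N h'"
    and can: "\<And>U. U \<in> carrier L \<Longrightarrow> h (can L U) = h' (can L U)"
  shows "h = h'"
proof (rule extensionalityI[of _ "carrier (Sl L)"])
  interpret N: frame N by fact
  interpret Sl: frame "Sl L" by (rule frame_Sl)
  have car: "can L U \<in> carrier (Sl L)" "open_sublocale L U \<in> carrier (Sl L)" if "U \<in> carrier L" for U
    using that by (simp_all add: carrier_Sl sublocale_of_can sublocale_of_open)
  have op: "h (open_sublocale L U) = h' (open_sublocale L U)" if U: "U \<in> carrier L" for U
  proof (rule N.complement_unique)
    have *: "k (can L U) \<sqinter>\<^bsub>N\<^esub> k (open_sublocale L U) = \<bottom>\<^bsub>N\<^esub>"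
      "k (can L U) \<squnion>\<^bsub>N\<^esub> k (open_sublocale L U) = \<top>\<^bsub>N\<^esub>" if k: "frame_hom (Sl L) N k" for k
      using frame_hom_meet[OF k car[OF U]] frame_hom_join[OF k car[OF U]]
        frame_hom_top[OF Sl.complete_lattice_axioms N.complete_lattice_axioms k]
        frame_hom_bottom[OF Sl.complete_lattice_axioms N.complete_lattice_axioms k]
        can_meet_open[OF U] can_join_open[OF U] by simp_all
    show "h (can L U) \<sqinter>\<^bsub>N\<^esub> h (open_sublocale L U) = \<bottom>\<^bsub>N\<^esub>"
      "h (can L U) \<squnion>\<^bsub>N\<^esub> h (open_sublocale L U) = \<top>\<^bsub>N\<^esub>"
      using *[OF h] .
    show "h (can L U) \<sqinter>\<^bsub>N\<^esub> h' (open_sublocale L U) = \<bottom>\<^bsub>N\<^esub>"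
      "h (can L U) \<squnion>\<^bsub>N\<^esub> h' (open_sublocale L U) = \<top>\<^bsub>N\<^esub>"
      using *[OF h'] can[OF U] by simp_all
  qed (use h h' car[OF U] in \<open>auto simp: frame_hom_closed\<close>)
  fix S assume S: "S \<in> carrier (Sl L)"
  interpret S: sublocale_of L S using S by (simp add: carrier_Sl)
  let ?d = "\<lambda>W. can L (S.j W) \<sqinter>\<^bsub>Sl L\<^esub> open_sublocale L W"
  have D: "?d ` carrier L \<subseteq> carrier (Sl L)"
    using car by auto
  have "h (?d W) = h' (?d W)" if W: "W \<in> carrier L" for W
    using frame_hom_meet[OF h, of "can L (S.j W)" "open_sublocale L W"]
      frame_hom_meet[OF h', of "can L (S.j W)" "open_sublocale L W"] car W
    by (simp add: can op)
  then have "h ` ?d ` carrier L = h' ` ?d ` carrier L"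
    by (auto simp: image_image)
  then have "h (\<Squnion>\<^bsub>Sl L\<^esub>(?d ` carrier L)) = h' (\<Squnion>\<^bsub>Sl L\<^esub>(?d ` carrier L))"
    by (simp add: frame_hom_sup[OF h D] frame_hom_sup[OF h' D])
  then show "h S = h' S"
    using sublocale_decomposition[OF S.sublocale_of_axioms] by simp
qed (use h h' in \<open>auto simp: frame_hom_def PiE_def\<close>)

lemma Inf_can: "U \<in> carrier L \<Longrightarrow> \<Sqinter>(can L U) = U"
  by (intro inf_eqI) (auto simp: can_eq)

text \<open>If \<open>c\<close> is a complement of \<open>V\<close> and \<open>b\<close> the least element of \<open>S\<close>, then \<open>b \<sqsubseteq> V\<close> implies
  \<open>V = c \<Rrightarrow> b\<close>, which is in \<open>S\<close>.\<close>

lemma boolean_sublocale: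
  assumes "boolean_frame L" "sublocale_of L S"
  shows "S = can L (\<Sqinter>S)"
proof (intro equalityI subsetI)
  interpret S: sublocale_of L S by fact
  have b: "\<Sqinter>S \<in> S" "\<Sqinter>S \<in> carrier L" using S.inf_in[of S] S.in_carrier by auto
  show "V \<in> can L (\<Sqinter>S)" if "V \<in> S" for V
    using that b S.subset by (auto simp: can_eq inf_lower)
  fix V assume "V \<in> can L (\<Sqinter>S)"
  then have V: "V \<in> carrier L" "\<Sqinter>S \<sqsubseteq> V" using b by (auto simp: can_eq)
  obtain c where c: "c \<in> carrier L" "V \<sqinter> c = \<bottom>" "V \<squnion> c = \<top>"
    using assms(1) V by (auto simp: boolean_frame_def)
  have "c \<Rrightarrow> \<Sqinter>S = V"
  proof (rule eq_by_lower)
    fix W assume W: "W \<in> carrier L"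
    have "W \<sqinter> c \<sqsubseteq> \<Sqinter>S \<longleftrightarrow> W \<sqsubseteq> V"
    proof
      assume *: "W \<sqinter> c \<sqsubseteq> \<Sqinter>S"
      have "W = W \<sqinter> (V \<squnion> c)" using W c(3) by (simp add: meet_top)
      also have "\<dots> = (W \<sqinter> V) \<squnion> (W \<sqinter> c)" using W V c(1) by (simp add: meet_join_distrib)
      also have "\<dots> \<sqsubseteq> V"
        using W V(1) c(1) le_trans[OF * V(2)] b by (simp add: join_le_iff meet_right)
      finally show "W \<sqsubseteq> V" .
    next
      assume "W \<sqsubseteq> V"
      then have "W \<sqinter> c \<sqsubseteq> V \<sqinter> c" using W V c(1) by (intro meet_mono) auto
      then have "W \<sqinter> c \<sqsubseteq> \<bottom>" using c(2) by simp
      then show "W \<sqinter> c \<sqsubseteq> \<Sqinter>S" using W c(1) b le_trans[of _ \<bottom>] by simp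
    qed
    then show "W \<sqsubseteq> c \<Rrightarrow> \<Sqinter>S \<longleftrightarrow> W \<sqsubseteq> V"
      using W c(1) b by (simp add: heyting_galois)
  qed (use V in auto)
  then show "V \<in> S" using S.heyting_in[OF c(1) b(1)] by simp
qed

text \<open>A Boolean frame is its own frame of sublocales, by \<open>boolean_sublocale\<close>: this is the inverse of
  \<open>can\<close>.\<close>

lemma frame_hom_Inf:
  assumes B: "boolean_frame L"
  shows "frame_hom (Sl L) L (\<lambda>S\<in>carrier (Sl L). \<Sqinter>S)"
proof (rule frame_homI)
  let ?h = "\<lambda>S\<in>carrier (Sl L). \<Sqinter>S"
  have sub: "S \<subseteq> carrier L" if "S \<in> carrier (Sl L)" for S
    using that by (simp add: carrier_Sl sublocale_of.subset)
  show "?h \<in> carrier (Sl L) \<rightarrow>\<^sub>E carrier L"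
    using sub by auto
  show "?h (\<Squnion>\<^bsub>Sl L\<^esub>A) = \<Squnion>(?h ` A)" if A: "A \<subseteq> carrier (Sl L)" for A
  proof -
    have h: "?h ` A = Lattice.inf L ` A" using A by force
    have hL: "Lattice.inf L ` A \<subseteq> carrier L" using A sub by auto
    have "V \<in> S \<longleftrightarrow> \<Sqinter>S \<sqsubseteq> V" if "S \<in> A" "V \<in> carrier L" for S V
    proof -
      have "sublocale_of L S" using that A by (auto simp: carrier_Sl)
      then show ?thesis
        using boolean_sublocale[OF B, of S] that(2) sub[of S] can_eq[of "\<Sqinter>S"] A that(1)
        by (metis (no_types, lifting) mem_Collect_eq subsetD weak.inf_closed)
    qed
    then have "carrier L \<inter> \<Inter>A = can L (\<Squnion>(Lattice.inf L ` A))"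
      using hL by (auto simp: can_eq sup_le_iff)
    then show ?thesis
      using A hL h Sl_Sup(1)[OF A] complete_lattice_Sl
      by (simp add: Inf_can carrier_Sl sublocale_of_can)
  qed
  show "?h \<top>\<^bsub>Sl L\<^esub> = \<top>"
    by (simp add: Sl_top carrier_Sl sublocale_of_top inf_eqI)
  show "?h (S \<sqinter>\<^bsub>Sl L\<^esub> T) = ?h S \<sqinter> ?h T" if "S \<in> carrier (Sl L)" "T \<in> carrier (Sl L)" for S T
  proof -
    have ST: "sublocale_of L S" "sublocale_of L T" using that by (simp_all add: carrier_Sl)
    interpret S: sublocale_of L S by fact
    interpret T: sublocale_of L T by fact
    have in_S: "\<Sqinter>S \<in> S" "\<Sqinter>T \<in> T" using S.inf_in[of S] T.inf_in[of T] by auto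
    have "\<Sqinter>(sublocale_join L S T) = \<Sqinter>S \<sqinter> \<Sqinter>T"
    proof (rule inf_eqI)
      show "sublocale_join L S T \<subseteq> carrier L"
        using sublocale_of.subset[OF sublocale_of_join[OF ST]] .
      show "\<Sqinter>S \<sqinter> \<Sqinter>T \<sqsubseteq> a" if "a \<in> sublocale_join L S T" for a
        using that S.subset T.subset S.in_carrier T.in_carrier
        by (auto simp: sublocale_join_def intro!: meet_mono inf_lower)
      show "y \<sqsubseteq> \<Sqinter>S \<sqinter> \<Sqinter>T" if "\<And>a. a \<in> sublocale_join L S T \<Longrightarrow> y \<sqsubseteq> a" for y
        using that in_S unfolding sublocale_join_def by blast
    qed (use S.subset T.subset in auto)
    then show ?thesis
      using that ST by (simp add: Sl_meet carrier_Sl sublocale_of_join)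
  qed
qed (rule complete_lattice_Sl complete_lattice_axioms)+

end

text \<open>The lift is the preimage along \<open>f\<close> followed by the identification of sublocales of \<open>B\<close> with
  their least elements.\<close>

lemma Sl_lift_props:
  assumes "frame_map B L f" "boolean_frame B"
  shows "frame_hom (Sl L) B (Sl_lift L B f)" "\<And>U. U \<in> carrier L \<Longrightarrow> Sl_lift L B f (can L U) = f U"
proof -
  interpret f: frame_map B L f by fact
  let ?h = "\<lambda>S\<in>carrier (Sl L). (\<lambda>S\<in>carrier (Sl B). \<Sqinter>\<^bsub>B\<^esub>S) ((\<lambda>T\<in>carrier (Sl L). preim B L f T) S)"
  let ?P = "\<lambda>h. frame_hom (Sl L) B h \<and> (\<forall>U\<in>carrier L. h (can L U) = f U)"
  have "frame_hom (Sl L) B ?h"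
    using f.M.complete_lattice_Sl f.L.complete_lattice_Sl f.L.complete_lattice_axioms
      f.frame_hom_preim f.L.frame_hom_Inf[OF assms(2)]
    by (rule frame_hom_compose)
  moreover have "?h (can L U) = f U" if "U \<in> carrier L" for U
    using that f.M.sublocale_of_can[OF that] f.L.sublocale_of_can[of "f U"]
    by (simp add: f.M.carrier_Sl f.L.carrier_Sl f.preim_can f.L.Inf_can)
  ultimately have h: "?P ?h" by blast
  have "k = ?h" if "?P k" for k
    using that h by (intro f.M.frame_hom_Sl_unique[OF f.L.frame_axioms]) simp_all
  with h have "\<exists>!h. ?P h" by (rule ex1I)
  then have "?P (Sl_lift L B f)"
    unfolding Sl_lift_def by (rule theI')
  then show "frame_hom (Sl L) B (Sl_lift L B f)"
    "\<And>U. U \<in> carrier L \<Longrightarrow> Sl_lift L B f (can L U) = f U" by auto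
qed

section \<open>The frame of ideals of a Radon valuation\<close>

text \<open>Ideals in the lattice of compact sets, without any condition on the valuation.\<close>

definition compact_ideal :: "'a topology \<Rightarrow> 'a set set \<Rightarrow> bool" where
  "compact_ideal X D \<longleftrightarrow>
     (\<forall>K\<in>D. compactin X K) \<and> {} \<in> D \<and> (\<forall>K\<in>D. \<forall>C\<in>D. K \<union> C \<in> D) \<and>
     (\<forall>K\<in>D. \<forall>C. compactin X C \<longrightarrow> C \<subseteq> K \<longrightarrow> C \<in> D)"

text \<open>The compact sets that can be exhausted from inside, up to arbitrarily small measure, by a single
  member of \<open>D\<close>. For an ideal \<open>D\<close> of compact sets this is the \<open>\<mu>\<close>-ideal generated by \<open>D\<close>
  (\<open>mu_ideal_hull\<close>).\<close>

definition mu_closure :: "'a topology \<Rightarrow> ('a set \<Rightarrow> real) \<Rightarrow> 'a set set \<Rightarrow> 'a set set" where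
  "mu_closure X \<mu> D = {K. compactin X K \<and> (\<forall>\<epsilon>>0. \<exists>C\<in>D. C \<subseteq> K \<and> \<mu> K - \<mu> C < \<epsilon>)}"

lemma compact_idealD:
  assumes "compact_ideal X D"
  shows "K \<in> D \<Longrightarrow> compactin X K" "{} \<in> D" "\<lbrakk>K \<in> D; C \<in> D\<rbrakk> \<Longrightarrow> K \<union> C \<in> D"
    "\<lbrakk>K \<in> D; compactin X C; C \<subseteq> K\<rbrakk> \<Longrightarrow> C \<in> D"
proof -
  note D = assms[unfolded compact_ideal_def]
  show "K \<in> D \<Longrightarrow> compactin X K" by (rule D[THEN conjunct1, rule_format])
  show "{} \<in> D" by (rule D[THEN conjunct2, THEN conjunct1])
  show "\<lbrakk>K \<in> D; C \<in> D\<rbrakk> \<Longrightarrow> K \<union> C \<in> D"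
    by (rule D[THEN conjunct2, THEN conjunct2, THEN conjunct1, rule_format])
  show "\<lbrakk>K \<in> D; compactin X C; C \<subseteq> K\<rbrakk> \<Longrightarrow> C \<in> D"
    by (rule D[THEN conjunct2, THEN conjunct2, THEN conjunct2, rule_format])
qed

lemma compact_ideal_finite_Union:
  assumes "compact_ideal X D" "finite \<F>" "\<F> \<subseteq> D" shows "\<Union>\<F> \<in> D"
  using assms(2,3) by (induction) (auto intro: compact_idealD[OF assms(1)])

locale radon =
  fixes X :: "'a topology" and \<mu> :: "'a set \<Rightarrow> real"
  assumes Hausdorff: "Hausdorff_space X" and valuation: "is_radon_valuation X \<mu>"
begin

lemma compact_Int: "\<lbrakk>compactin X C; compactin X D\<rbrakk> \<Longrightarrow> compactin X (C \<inter> D)"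
  using compact_Int_closedin compactin_imp_closedin[OF Hausdorff] by blast

lemma nonneg: "compactin X C \<Longrightarrow> 0 \<le> \<mu> C"
  using valuation by (auto simp: is_radon_valuation_def)

lemma mono: "\<lbrakk>compactin X C; compactin X D; C \<subseteq> D\<rbrakk> \<Longrightarrow> \<mu> C \<le> \<mu> D"
  using valuation[unfolded is_radon_valuation_def, THEN conjunct2, THEN conjunct1, rule_format] .

lemma empty [simp]: "\<mu> {} = 0"
  using valuation by (simp add: is_radon_valuation_def)

lemma modular: "\<lbrakk>compactin X C; compactin X D\<rbrakk> \<Longrightarrow> \<mu> C + \<mu> D = \<mu> (C \<union> D) + \<mu> (C \<inter> D)"
  using valuation[unfolded is_radon_valuation_def, THEN conjunct2, THEN conjunct2, THEN conjunct2,
      THEN conjunct1, rule_format] .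

lemma almost_boolean:
  assumes "compactin X C" "\<And>n::nat. compactin X (Cs n)" "\<And>n. Cs n \<subseteq> Cs (Suc n)" "\<And>n. Cs n \<subseteq> C" "\<epsilon> > 0"
  obtains N D where "compactin X D" "D \<subseteq> C" "\<And>n. \<mu> (D \<inter> Cs n) = 0" "\<mu> C - \<mu> (D \<union> Cs N) < \<epsilon>"
proof -
  have "\<exists>N D. compactin X D \<and> D \<subseteq> C \<and> (\<forall>n. \<mu> (D \<inter> Cs n) = 0) \<and> \<mu> C - \<mu> (D \<union> Cs N) < \<epsilon>"
    using valuation[unfolded is_radon_valuation_def, THEN conjunct2, THEN conjunct2, THEN conjunct2,
        THEN conjunct2, rule_format, of C Cs \<epsilon>] assms by simp
  then show thesis using that by blast
qed

text \<open>Cutting down or enlarging (as in \<open>diff_Un\<close> below) by a fixed compact set does not increase the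
  measure of a difference; the closure properties of \<open>\<mu>\<close>-ideals rest on these two estimates.\<close>

lemma diff_Int:
  assumes "compactin X A" "compactin X B" "compactin X C" "B \<subseteq> A"
  shows "\<mu> (A \<inter> C) - \<mu> (B \<inter> C) \<le> \<mu> A - \<mu> B"
proof -
  have "\<mu> (A \<inter> C) + \<mu> B = \<mu> (A \<inter> C \<union> B) + \<mu> (A \<inter> C \<inter> B)"
    using assms by (intro modular compact_Int)
  moreover have "A \<inter> C \<inter> B = B \<inter> C" using assms(4) by auto
  moreover have "\<mu> (A \<inter> C \<union> B) \<le> \<mu> A"
    using assms by (intro mono compactin_Un compact_Int) auto
  ultimately show ?thesis by simp
qed

lemma diff_Un:
  assumes "compactin X A" "compactin X B" "compactin X C" "B \<subseteq> A"
  shows "\<mu> (A \<union> C) - \<mu> (B \<union> C) \<le> \<mu> A - \<mu> B"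
proof -
  have "\<mu> (B \<inter> C) \<le> \<mu> (A \<inter> C)"
    using assms by (intro mono compact_Int) auto
  then show ?thesis
    using modular[OF assms(1,3)] modular[OF assms(2,3)] by simp
qed

text \<open>A \<open>\<mu>\<close>-ideal contains finite unions of its members, so in the defining closure condition the
  finite subfamilies can be replaced by single members.\<close>

lemma is_mu_ideal_iff:
  "is_mu_ideal X \<mu> I \<longleftrightarrow> compact_ideal X I \<and> mu_closure X \<mu> I \<subseteq> I"
proof
  assume I: "is_mu_ideal X \<mu> I"
  have cpt: "compactin X K" if "K \<in> I" for K using I that by (auto simp: is_mu_ideal_def)
  have down: "C \<in> I" if "K \<in> I" "compactin X C" "C \<subseteq> K" for K C
    using I[unfolded is_mu_ideal_def, THEN conjunct2, THEN conjunct1] that by simp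
  have appr: "K \<in> I" if "compactin X K" "\<A> \<subseteq> I" "\<And>C. C \<in> \<A> \<Longrightarrow> C \<subseteq> K"
    "\<And>\<epsilon>. \<epsilon> > 0 \<Longrightarrow> \<exists>\<F>\<subseteq>\<A>. finite \<F> \<and> \<mu> K - \<mu> (\<Union>\<F>) < \<epsilon>" for K \<A>
    by (rule I[unfolded is_mu_ideal_def, THEN conjunct2, THEN conjunct2, rule_format])
      (rule that(1), rule exI[of _ \<A>], use that in simp)
  have "{} \<in> I"
    by (rule appr[of _ "{}"]) auto
  moreover have "K \<union> C \<in> I" if "K \<in> I" "C \<in> I" for K C
  proof (rule appr[of _ "{K, C}"])
    show "compactin X (K \<union> C)" using that cpt by (simp add: compactin_Un)
    show "\<exists>\<F>\<subseteq>{K, C}. finite \<F> \<and> \<mu> (K \<union> C) - \<mu> (\<Union>\<F>) < \<epsilon>" if "\<epsilon> > 0" for \<epsilon>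
      using that by (intro exI[of _ "{K, C}"]) simp
  qed (use that in auto)
  moreover have "K \<in> I" if K: "K \<in> mu_closure X \<mu> I" for K
  proof (rule appr[of _ "{C\<in>I. C \<subseteq> K}"])
    show "\<exists>\<F>\<subseteq>{C \<in> I. C \<subseteq> K}. finite \<F> \<and> \<mu> K - \<mu> (\<Union>\<F>) < \<epsilon>" if "\<epsilon> > 0" for \<epsilon>
    proof -
      obtain C where "C \<in> I" "C \<subseteq> K" "\<mu> K - \<mu> C < \<epsilon>"
        using K \<open>\<epsilon> > 0\<close> by (auto simp: mu_closure_def)
      then show ?thesis by (intro exI[of _ "{C}"]) auto
    qed
  qed (use K in \<open>auto simp: mu_closure_def\<close>)
  ultimately show "compact_ideal X I \<and> mu_closure X \<mu> I \<subseteq> I"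
    unfolding compact_ideal_def using cpt down by (intro conjI ballI allI impI subsetI)
next
  assume I: "compact_ideal X I \<and> mu_closure X \<mu> I \<subseteq> I"
  note D = compact_idealD[OF conjunct1[OF I]]
  show "is_mu_ideal X \<mu> I"
    unfolding is_mu_ideal_def
  proof (intro conjI ballI allI impI)
    fix K assume K: "compactin X K"
      and "\<exists>\<A>\<subseteq>I. (\<forall>C\<in>\<A>. C \<subseteq> K) \<and> (\<forall>\<epsilon>>0. \<exists>\<F>\<subseteq>\<A>. finite \<F> \<and> \<mu> K - \<mu> (\<Union>\<F>) < \<epsilon>)"
    then obtain \<A> where A: "\<A> \<subseteq> I" "\<And>C. C \<in> \<A> \<Longrightarrow> C \<subseteq> K"
      "\<And>\<epsilon>. \<epsilon> > 0 \<Longrightarrow> \<exists>\<F>\<subseteq>\<A>. finite \<F> \<and> \<mu> K - \<mu> (\<Union>\<F>) < \<epsilon>" by auto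
    have "\<exists>C\<in>I. C \<subseteq> K \<and> \<mu> K - \<mu> C < \<epsilon>" if e: "\<epsilon> > 0" for \<epsilon>
    proof -
      obtain \<F> where F: "\<F> \<subseteq> \<A>" "finite \<F>" "\<mu> K - \<mu> (\<Union>\<F>) < \<epsilon>"
        using A(3)[OF e] by auto
      then have "\<Union>\<F> \<in> I"
        using A(1) I by (intro compact_ideal_finite_Union) auto
      moreover have "\<Union>\<F> \<subseteq> K" using F(1) A(2) by (meson Union_least subsetD)
      ultimately show ?thesis using F(3) by (intro bexI[of _ "\<Union>\<F>"]) simp_all
    qed
    then show "K \<in> I" using I K by (auto simp: mu_closure_def)
  next
    show "I \<subseteq> {K. compactin X K}" using D(1) by (intro subsetI CollectI)
  qed (rule D(4))
qed

lemma mu_idealD: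
  assumes "is_mu_ideal X \<mu> I"
  shows "compact_ideal X I"
    "\<lbrakk>compactin X K; \<And>\<epsilon>. \<epsilon> > 0 \<Longrightarrow> \<exists>C\<in>I. C \<subseteq> K \<and> \<mu> K - \<mu> C < \<epsilon>\<rbrakk> \<Longrightarrow> K \<in> I"
  using assms by (auto simp: is_mu_ideal_iff mu_closure_def)

lemma mu_idealI:
  assumes "\<And>K. K \<in> I \<Longrightarrow> compactin X K" "{} \<in> I" "\<And>K C. \<lbrakk>K \<in> I; C \<in> I\<rbrakk> \<Longrightarrow> K \<union> C \<in> I"
    "\<And>K C. \<lbrakk>K \<in> I; compactin X C; C \<subseteq> K\<rbrakk> \<Longrightarrow> C \<in> I"
    "\<And>K. \<lbrakk>compactin X K; \<And>\<epsilon>. \<epsilon> > 0 \<Longrightarrow> \<exists>C\<in>I. C \<subseteq> K \<and> \<mu> K - \<mu> C < \<epsilon>\<rbrakk> \<Longrightarrow> K \<in> I"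
  shows "is_mu_ideal X \<mu> I"
proof -
  have "compact_ideal X I"
    unfolding compact_ideal_def using assms(1-4) by (intro conjI ballI allI impI)
  moreover have "mu_closure X \<mu> I \<subseteq> I"
    using assms(5) unfolding mu_closure_def by (intro subsetI) simp
  ultimately show ?thesis by (simp add: is_mu_ideal_iff)
qed

lemma in_mu_closure: "\<lbrakk>C \<in> D; compactin X C\<rbrakk> \<Longrightarrow> C \<in> mu_closure X \<mu> D"
  by (auto simp: mu_closure_def)

lemma mu_closureE:
  assumes "K \<in> mu_closure X \<mu> D" "\<epsilon> > 0"
  obtains C where "C \<in> D" "C \<subseteq> K" "\<mu> K - \<mu> C < \<epsilon>" "compactin X K"
  using assms by (auto simp: mu_closure_def)

text \<open>Each closure property holds up to a small error by \<open>diff_Un\<close> and \<open>diff_Int\<close>; being closed under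
  \<open>mu_closure X \<mu>\<close> itself is the addition of two errors.\<close>

lemma is_mu_ideal_mu_closure:
  assumes "compact_ideal X D" shows "is_mu_ideal X \<mu> (mu_closure X \<mu> D)"
proof (rule mu_idealI)
  note D = compact_idealD[OF assms]
  show "compactin X K" if "K \<in> mu_closure X \<mu> D" for K using that by (simp add: mu_closure_def)
  show "{} \<in> mu_closure X \<mu> D" using D(2) by (simp add: in_mu_closure)
  show "K \<union> C \<in> mu_closure X \<mu> D" if K: "K \<in> mu_closure X \<mu> D" and C: "C \<in> mu_closure X \<mu> D" for K C
    unfolding mu_closure_def
  proof (intro CollectI conjI allI impI)
    have c: "compactin X K" "compactin X C" using K C by (simp_all add: mu_closure_def)
    then show "compactin X (K \<union> C)" by (rule compactin_Un)
    fix \<epsilon> :: real assume "\<epsilon> > 0"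
    then have e: "\<epsilon> / 2 > 0" by simp
    obtain K' where K': "K' \<in> D" "K' \<subseteq> K" "\<mu> K - \<mu> K' < \<epsilon> / 2" using K e by (rule mu_closureE)
    obtain C' where C': "C' \<in> D" "C' \<subseteq> C" "\<mu> C - \<mu> C' < \<epsilon> / 2" using C e by (rule mu_closureE)
    have "\<mu> (K \<union> C) - \<mu> (K' \<union> C) \<le> \<mu> K - \<mu> K'"
      using c K' D(1) by (intro diff_Un) auto
    moreover have "\<mu> (C \<union> K') - \<mu> (C' \<union> K') \<le> \<mu> C - \<mu> C'"
      using c K' C' D(1) by (intro diff_Un) auto
    ultimately have "\<mu> (K \<union> C) - \<mu> (K' \<union> C') < \<epsilon>"
      using K'(3) C'(3) by (simp add: Un_commute)
    then show "\<exists>B\<in>D. B \<subseteq> K \<union> C \<and> \<mu> (K \<union> C) - \<mu> B < \<epsilon>"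
      using K' C' D(3) by (intro bexI[of _ "K' \<union> C'"]) auto
  qed
  show "C \<in> mu_closure X \<mu> D" if K: "K \<in> mu_closure X \<mu> D" and C: "compactin X C" "C \<subseteq> K" for K C
    unfolding mu_closure_def
  proof (intro CollectI conjI allI impI)
    fix \<epsilon> :: real assume e: "\<epsilon> > 0"
    obtain K' where K': "K' \<in> D" "K' \<subseteq> K" "\<mu> K - \<mu> K' < \<epsilon>" "compactin X K" using K e by (rule mu_closureE)
    have "\<mu> (K \<inter> C) - \<mu> (K' \<inter> C) \<le> \<mu> K - \<mu> K'"
      using C K' D(1) by (intro diff_Int) auto
    moreover have "K \<inter> C = C" using C by auto
    ultimately have "\<mu> C - \<mu> (K' \<inter> C) < \<epsilon>" using K'(3) by simp
    moreover have "K' \<inter> C \<in> D" using D(4)[OF K'(1) compact_Int[OF D(1)[OF K'(1)] C(1)]] by simp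
    ultimately show "\<exists>B\<in>D. B \<subseteq> C \<and> \<mu> C - \<mu> B < \<epsilon>"
      by (intro bexI[of _ "K' \<inter> C"]) simp_all
  qed (rule C(1))
  show "K \<in> mu_closure X \<mu> D" if K: "compactin X K"
    and a: "\<And>\<epsilon>. \<epsilon> > 0 \<Longrightarrow> \<exists>C\<in>mu_closure X \<mu> D. C \<subseteq> K \<and> \<mu> K - \<mu> C < \<epsilon>" for K
    unfolding mu_closure_def
  proof (intro CollectI conjI allI impI)
    fix \<epsilon> :: real assume "\<epsilon> > 0"
    then have e: "\<epsilon> / 2 > 0" by simp
    obtain C where C: "C \<in> mu_closure X \<mu> D" "C \<subseteq> K" "\<mu> K - \<mu> C < \<epsilon> / 2" using a[OF e] by auto
    obtain C' where C': "C' \<in> D" "C' \<subseteq> C" "\<mu> C - \<mu> C' < \<epsilon> / 2" using C(1) e by (rule mu_closureE)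
    show "\<exists>B\<in>D. B \<subseteq> K \<and> \<mu> K - \<mu> B < \<epsilon>"
      using C C' by (intro bexI[of _ C']) auto
  qed (rule K)
qed

lemma mu_closure_least:
  assumes "is_mu_ideal X \<mu> J" "D \<subseteq> J" shows "mu_closure X \<mu> D \<subseteq> J"
proof
  fix K assume K: "K \<in> mu_closure X \<mu> D"
  show "K \<in> J"
  proof (rule mu_idealD(2)[OF assms(1)])
    show "compactin X K" using K by (simp add: mu_closure_def)
    show "\<exists>C\<in>J. C \<subseteq> K \<and> \<mu> K - \<mu> C < \<epsilon>" if e: "\<epsilon> > 0" for \<epsilon>
    proof -
      obtain C where "C \<in> D" "C \<subseteq> K" "\<mu> K - \<mu> C < \<epsilon>" using K e by (rule mu_closureE)
      then show ?thesis using assms(2) by (intro bexI[of _ C]) auto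
    qed
  qed
qed

lemma mu_ideal_hull:
  assumes "compact_ideal X D" shows "is_mu_ideal X \<mu> hull D = mu_closure X \<mu> D"
  by (rule hull_unique)
    (use assms compact_idealD(1)[OF assms] in
      \<open>auto intro: in_mu_closure is_mu_ideal_mu_closure dest: mu_closure_least\<close>)

lemma mu_locale_simps:
  "carrier (mu_locale X \<mu>) = {I. is_mu_ideal X \<mu> I}" "le (mu_locale X \<mu>) = (\<subseteq>)" "eq (mu_locale X \<mu>) = (=)"
  by (simp_all add: mu_locale_def)

lemma partial_order_mu: "partial_order (mu_locale X \<mu>)"
  by standard (auto simp: mu_locale_simps)

lemma is_mu_ideal_Inter:
  assumes "\<And>I. I \<in> A \<Longrightarrow> is_mu_ideal X \<mu> I"
  shows "is_mu_ideal X \<mu> ({K. compactin X K} \<inter> \<Inter>A)"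
proof (rule mu_idealI)
  note ci = mu_idealD(1)[OF assms]
  let ?I = "{K. compactin X K} \<inter> \<Inter>A"
  show "{} \<in> {K. compactin X K} \<inter> \<Inter>A" using compact_idealD(2)[OF ci] by auto
  show "K \<union> C \<in> {K. compactin X K} \<inter> \<Inter>A"
    if "K \<in> {K. compactin X K} \<inter> \<Inter>A" "C \<in> {K. compactin X K} \<inter> \<Inter>A" for K C
    using that compact_idealD(3)[OF ci] by (auto intro: compactin_Un)
  show "C \<in> {K. compactin X K} \<inter> \<Inter>A"
    if "K \<in> {K. compactin X K} \<inter> \<Inter>A" "compactin X C" "C \<subseteq> K" for K C
  proof -
    have "C \<in> I" if "I \<in> A" for I
      using \<open>K \<in> ?I\<close> \<open>compactin X C\<close> \<open>C \<subseteq> K\<close> that 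
      by (rule_tac compact_idealD(4)[OF ci[OF that], of K]) simp_all
    then show ?thesis using that(2) by simp
  qed
  show "K \<in> {K. compactin X K} \<inter> \<Inter>A" if K: "compactin X K"
    and a: "\<And>\<epsilon>. \<epsilon> > 0 \<Longrightarrow> \<exists>C\<in>{K. compactin X K} \<inter> \<Inter>A. C \<subseteq> K \<and> \<mu> K - \<mu> C < \<epsilon>" for K
  proof -
    have "K \<in> I" if I: "I \<in> A" for I
    proof (rule mu_idealD(2)[OF assms[OF I] K])
      fix \<epsilon> :: real assume "\<epsilon> > 0"
      from a[OF this] obtain C where "C \<in> ?I" "C \<subseteq> K" "\<mu> K - \<mu> C < \<epsilon>" by auto
      then show "\<exists>C\<in>I. C \<subseteq> K \<and> \<mu> K - \<mu> C < \<epsilon>"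
        using I by (intro bexI[of _ C]) simp_all
    qed
    then show ?thesis using K by simp
  qed
qed auto

lemma mu_Inf:
  assumes "A \<subseteq> carrier (mu_locale X \<mu>)"
  shows "\<Sqinter>\<^bsub>mu_locale X \<mu>\<^esub>A = {K. compactin X K} \<inter> \<Inter>A"
    "greatest (mu_locale X \<mu>) ({K. compactin X K} \<inter> \<Inter>A) (Lower (mu_locale X \<mu>) A)"
proof -
  have I: "is_mu_ideal X \<mu> ({K. compactin X K} \<inter> \<Inter>A)"
    using assms by (intro is_mu_ideal_Inter) (auto simp: mu_locale_simps)
  have cpt: "compactin X K" if "is_mu_ideal X \<mu> J" "K \<in> J" for J K
    by (rule compact_idealD(1)[OF mu_idealD(1)[OF that(1)] that(2)])
  let ?I = "{K. compactin X K} \<inter> \<Inter>A"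
  have car: "?I \<in> carrier (mu_locale X \<mu>)" using I by (simp add: mu_locale_simps)
  have below: "?I \<sqsubseteq>\<^bsub>mu_locale X \<mu>\<^esub> a" if "a \<in> A" for a
    using that by (auto simp: mu_locale_simps)
  have greatest: "y \<sqsubseteq>\<^bsub>mu_locale X \<mu>\<^esub> ?I" if y: "y \<in> carrier (mu_locale X \<mu>)"
    and le: "\<And>a. a \<in> A \<Longrightarrow> y \<sqsubseteq>\<^bsub>mu_locale X \<mu>\<^esub> a" for y
  proof -
    have "y \<subseteq> {K. compactin X K}" using cpt y by (auto simp: mu_locale_simps)
    moreover have "y \<subseteq> \<Inter>A" using le by (simp add: mu_locale_simps Inter_greatest)
    ultimately show ?thesis by (simp add: mu_locale_simps)
  qed
  show "\<Sqinter>\<^bsub>mu_locale X \<mu>\<^esub>A = ?I"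
    using assms car below greatest by (rule partial_order.inf_eqI[OF partial_order_mu])
  show "greatest (mu_locale X \<mu>) ?I (Lower (mu_locale X \<mu>) A)"
    using below _ assms car
  proof (rule greatest_LowerI)
    show "y \<sqsubseteq>\<^bsub>mu_locale X \<mu>\<^esub> ?I" if "y \<in> Lower (mu_locale X \<mu>) A" for y
      using that assms by (intro greatest) (auto simp: Lower_def)
  qed
qed

lemma complete_lattice_mu: "complete_lattice (mu_locale X \<mu>)"
  using partial_order.complete_lattice_by_infs[OF partial_order_mu] mu_Inf(2) by blast

lemma mu_meet:
  assumes "is_mu_ideal X \<mu> I" "is_mu_ideal X \<mu> J"
  shows "I \<sqinter>\<^bsub>mu_locale X \<mu>\<^esub> J = I \<inter> J"
  unfolding meet_def using assms compact_idealD(1)[OF mu_idealD(1)[OF assms(1)]]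
  by (subst mu_Inf) (auto simp: mu_locale_simps)

lemma is_mu_ideal_compacts: "is_mu_ideal X \<mu> {K. compactin X K}"
  using is_mu_ideal_Inter[of "{}"] by simp

lemma mu_top: "\<top>\<^bsub>mu_locale X \<mu>\<^esub> = {K. compactin X K}"
  using complete_lattice.inf_empty[OF complete_lattice_mu] mu_Inf(1)[of "{}"] by simp

text \<open>The Heyting implication from \<open>U\<close> to \<open>V\<close> consists of the compact sets whose intersection with
  each member of \<open>U\<close> is in \<open>V\<close>. It is a \<open>\<mu>\<close>-ideal by \<open>diff_Int\<close>.\<close>

lemma frame_mu: "frame (mu_locale X \<mu>)"
proof (rule complete_lattice.frame_by_heyting[OF complete_lattice_mu])
  fix U V assume "U \<in> carrier (mu_locale X \<mu>)" "V \<in> carrier (mu_locale X \<mu>)"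
  then have U: "is_mu_ideal X \<mu> U" and V: "is_mu_ideal X \<mu> V" by (simp_all add: mu_locale_simps)
  note cU = compact_idealD[OF mu_idealD(1)[OF U]] and cV = compact_idealD[OF mu_idealD(1)[OF V]]
  let ?H = "{K. compactin X K \<and> (\<forall>C\<in>U. K \<inter> C \<in> V)}"
  have "is_mu_ideal X \<mu> ?H"
  proof (rule mu_idealI)
    show "K \<union> C \<in> ?H" if "K \<in> ?H" "C \<in> ?H" for K C
      using that by (auto simp: Int_Un_distrib2 intro: compactin_Un cV(3))
    show "C \<in> ?H" if "K \<in> ?H" "compactin X C" "C \<subseteq> K" for K C
    proof -
      have "C \<inter> B \<in> V" if "B \<in> U" for B
        using \<open>K \<in> ?H\<close> \<open>C \<subseteq> K\<close> that compact_Int[OF \<open>compactin X C\<close> cU(1)[OF that]]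
        by (rule_tac cV(4)[of "K \<inter> B" "C \<inter> B"]) auto
      then show ?thesis using that(2) by blast
    qed
    show "K \<in> ?H" if K: "compactin X K" and a: "\<And>\<epsilon>. \<epsilon> > 0 \<Longrightarrow> \<exists>C\<in>?H. C \<subseteq> K \<and> \<mu> K - \<mu> C < \<epsilon>" for K
    proof -
      have "K \<inter> B \<in> V" if B: "B \<in> U" for B
      proof (rule mu_idealD(2)[OF V])
        show "compactin X (K \<inter> B)" using K cU(1)[OF B] by (rule compact_Int)
        fix \<epsilon> :: real assume "\<epsilon> > 0"
        from a[OF this] obtain C where C: "C \<in> ?H" "C \<subseteq> K" "\<mu> K - \<mu> C < \<epsilon>" by auto
        then have "\<mu> (K \<inter> B) - \<mu> (C \<inter> B) \<le> \<mu> K - \<mu> C"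
          using K cU(1)[OF B] by (intro diff_Int) auto
        then show "\<exists>D\<in>V. D \<subseteq> K \<inter> B \<and> \<mu> (K \<inter> B) - \<mu> D < \<epsilon>"
          using C B by (intro bexI[of _ "C \<inter> B"]) auto
      qed
      then show ?thesis using K by blast
    qed
  next
    show "{} \<in> ?H" using cV(2) by simp
  qed simp
  moreover have "W \<sqinter>\<^bsub>mu_locale X \<mu>\<^esub> U \<subseteq> V \<longleftrightarrow> W \<subseteq> ?H" if "is_mu_ideal X \<mu> W" for W
  proof -
    note cW = compact_idealD[OF mu_idealD(1)[OF that]]
    have "W \<inter> U \<subseteq> V \<longleftrightarrow> W \<subseteq> ?H"
    proof
      assume *: "W \<inter> U \<subseteq> V"
      show "W \<subseteq> ?H"
      proof
        fix K assume K: "K \<in> W"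
        have "K \<inter> C \<in> V" if C: "C \<in> U" for C
        proof -
          have "compactin X (K \<inter> C)" using cW(1)[OF K] cU(1)[OF C] by (rule compact_Int)
          then have "K \<inter> C \<in> W \<inter> U" using cW(4)[OF K] cU(4)[OF C] by auto
          then show ?thesis using * by blast
        qed
        then show "K \<in> ?H" using cW(1)[OF K] by blast
      qed
    next
      assume *: "W \<subseteq> ?H"
      show "W \<inter> U \<subseteq> V"
      proof
        fix K assume "K \<in> W \<inter> U"
        then have "K \<inter> K \<in> V" using * by blast
        then show "K \<in> V" by simp
      qed
    qed
    then show ?thesis using that U by (simp add: mu_meet)
  qed
  ultimately show "\<exists>H\<in>carrier (mu_locale X \<mu>). \<forall>W\<in>carrier (mu_locale X \<mu>).
      W \<sqinter>\<^bsub>mu_locale X \<mu>\<^esub> U \<sqsubseteq>\<^bsub>mu_locale X \<mu>\<^esub> V \<longleftrightarrow> W \<sqsubseteq>\<^bsub>mu_locale X \<mu>\<^esub> H"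
    by (intro bexI[of _ ?H]) (simp_all add: mu_locale_simps)
qed

sublocale mu: plain_frame "mu_locale X \<mu>"
  by (rule plain_frame.intro[OF frame_mu])

lemma null_in_mu_ideal:
  assumes "is_mu_ideal X \<mu> I" "compactin X K" "\<mu> K = 0" shows "K \<in> I"
  using assms(2)
proof (rule mu_idealD(2)[OF assms(1)])
  show "\<exists>C\<in>I. C \<subseteq> K \<and> \<mu> K - \<mu> C < \<epsilon>" if "\<epsilon> > 0" for \<epsilon>
    using that assms(3) compact_idealD(2)[OF mu_idealD(1)[OF assms(1)]] by (intro bexI[of _ "{}"]) auto
qed

lemma mu_bottom: "\<bottom>\<^bsub>mu_locale X \<mu>\<^esub> = {K. compactin X K \<and> \<mu> K = 0}"
proof -
  let ?B = "mu_closure X \<mu> {{}}"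
  have B: "is_mu_ideal X \<mu> ?B"
    by (rule is_mu_ideal_mu_closure) (auto simp: compact_ideal_def)
  have eq: "?B = {K. compactin X K \<and> \<mu> K = 0}"
  proof (intro equalityI subsetI)
    fix K assume "K \<in> ?B"
    then have K: "compactin X K" and e: "\<And>\<epsilon>. \<epsilon> > 0 \<Longrightarrow> \<mu> K < \<epsilon>" by (auto simp: mu_closure_def)
    have "\<mu> K \<le> 0" by (rule field_le_epsilon) (simp add: e less_imp_le)
    then show "K \<in> {K. compactin X K \<and> \<mu> K = 0}"
      using nonneg[OF K] K by simp
  qed (use null_in_mu_ideal[OF B] in auto)
  have "\<Squnion>\<^bsub>mu_locale X \<mu>\<^esub>{} = ?B"
    using B null_in_mu_ideal unfolding eq by (intro mu.sup_eqI) (auto simp: mu_locale_simps)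
  then show ?thesis by (simp add: mu.sup_empty eq)
qed

end

section \<open>Complements and the inner measure\<close>

context radon
begin

text \<open>The complement of the \<open>\<mu>\<close>-ideal \<open>I\<close> in the frame of \<open>\<mu>\<close>-ideals.\<close>

definition null_part :: "'a set set \<Rightarrow> 'a set set" where
  "null_part I = {K. compactin X K \<and> (\<forall>C\<in>I. \<mu> (K \<inter> C) = 0)}"

lemma is_mu_ideal_null_part:
  assumes I: "is_mu_ideal X \<mu> I" shows "is_mu_ideal X \<mu> (null_part I)"
proof (rule mu_idealI)
  note c = compact_idealD(1)[OF mu_idealD(1)[OF I]]
  show "K \<union> C \<in> null_part I" if KC: "K \<in> null_part I" "C \<in> null_part I" for K C
  proof -
    have "\<mu> ((K \<union> C) \<inter> B) = 0" if B: "B \<in> I" for B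
    proof -
      have k: "compactin X (K \<inter> B)" "compactin X (C \<inter> B)"
        using KC c[OF B] by (auto simp: null_part_def compact_Int)
      have "\<mu> (K \<inter> B \<union> C \<inter> B) = 0"
        using modular[OF k] nonneg[OF compactin_Un[OF k]] nonneg[OF compact_Int[OF k]] KC B
        by (simp add: null_part_def)
      then show ?thesis by (simp add: Int_Un_distrib2)
    qed
    then show ?thesis using KC by (simp add: null_part_def compactin_Un)
  qed
  show "C \<in> null_part I" if KC: "K \<in> null_part I" "compactin X C" "C \<subseteq> K" for K C
  proof -
    have "\<mu> (C \<inter> B) = 0" if B: "B \<in> I" for B
      using mono[of "C \<inter> B" "K \<inter> B"] nonneg[of "C \<inter> B"] KC B c[OF B]
      by (auto simp: null_part_def compact_Int)
    then show ?thesis using KC(2) by (simp add: null_part_def)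
  qed
  show "K \<in> null_part I" if K: "compactin X K"
    and a: "\<And>\<epsilon>. \<epsilon> > 0 \<Longrightarrow> \<exists>C\<in>null_part I. C \<subseteq> K \<and> \<mu> K - \<mu> C < \<epsilon>" for K
  proof -
    have "\<mu> (K \<inter> B) = 0" if B: "B \<in> I" for B
    proof (rule antisym)
      show "0 \<le> \<mu> (K \<inter> B)" using K c[OF B] by (simp add: nonneg compact_Int)
      show "\<mu> (K \<inter> B) \<le> 0"
      proof (rule field_le_epsilon)
        fix \<epsilon> :: real assume "\<epsilon> > 0"
        then obtain C where C: "C \<in> null_part I" "C \<subseteq> K" "\<mu> K - \<mu> C < \<epsilon>" using a by blast
        then have "\<mu> (K \<inter> B) - \<mu> (C \<inter> B) \<le> \<mu> K - \<mu> C"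
          using K c[OF B] by (intro diff_Int) (auto simp: null_part_def)
        then show "\<mu> (K \<inter> B) \<le> 0 + \<epsilon>" using C B by (simp add: null_part_def)
      qed
    qed
    then show ?thesis using K by (simp add: null_part_def)
  qed
qed (auto simp: null_part_def)

text \<open>The measures of the members of \<open>I\<close> inside \<open>K\<close> are bounded by \<open>\<mu> K\<close>. Choose members whose
  measures approach the supremum and take finite unions to make the sequence increasing.\<close>

lemma exhaustion:
  assumes I: "is_mu_ideal X \<mu> I" and K: "compactin X K"
  obtains Cs :: "nat \<Rightarrow> 'a set" where "\<And>n. Cs n \<in> I" "\<And>n. Cs n \<subseteq> Cs (Suc n)" "\<And>n. Cs n \<subseteq> K"
    "\<And>\<epsilon>. \<epsilon> > 0 \<Longrightarrow> \<exists>n. \<forall>C\<in>I. C \<subseteq> K \<longrightarrow> \<mu> C < \<mu> (Cs n) + \<epsilon>"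
proof -
  note D = compact_idealD[OF mu_idealD(1)[OF I]]
  let ?A = "{C \<in> I. C \<subseteq> K}"
  define s where "s = Sup (\<mu> ` ?A)"
  have bdd: "bdd_above (\<mu> ` ?A)"
    using mono[OF D(1) K] by (intro bdd_aboveI[of _ "\<mu> K"]) auto
  have ne: "\<mu> ` ?A \<noteq> {}" using D(2) by auto
  have "\<exists>B. B \<in> ?A \<and> s - 1 / real (Suc n) < \<mu> B" for n
  proof -
    have "s - 1 / real (Suc n) < s" by simp
    then show ?thesis unfolding s_def using less_cSup_iff[OF ne bdd] by auto
  qed
  then obtain B where B: "\<And>n. B n \<in> ?A" "\<And>n. s - 1 / real (Suc n) < \<mu> (B n)" by metis
  define Cs where "Cs n = (\<Union>i\<le>n. B i)" for n
  have Cs: "Cs n \<in> I" "Cs n \<subseteq> K" for n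
    unfolding Cs_def using B(1) compact_ideal_finite_Union[OF mu_idealD(1)[OF I], of "B ` {..n}"] by auto
  show thesis
  proof
    show "Cs n \<subseteq> Cs (Suc n)" for n by (force simp: Cs_def)
    fix \<epsilon> :: real assume e: "\<epsilon> > 0"
    obtain n where n: "1 / real (Suc n) < \<epsilon>" using nat_approx_posE[OF e] .
    have "\<mu> C \<le> s" if "C \<in> I" "C \<subseteq> K" for C
      unfolding s_def using that bdd by (intro cSup_upper) auto
    moreover have "\<mu> (B n) \<le> \<mu> (Cs n)"
      using B(1)[of n] Cs[of n] by (intro mono D(1)) (auto simp: Cs_def)
    ultimately show "\<exists>n. \<forall>C\<in>I. C \<subseteq> K \<longrightarrow> \<mu> C < \<mu> (Cs n) + \<epsilon>"
      using B(2)[of n] n by (intro exI[of _ n]) fastforce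
  qed (use Cs in auto)
qed

text \<open>The almost Boolean axiom, applied to a sequence exhausting \<open>I\<close> inside \<open>K\<close>, yields a compact
  \<open>D'\<close> that is null on the sequence and together with one member of it nearly fills \<open>K\<close>. Because
  the sequence approaches the supremum, adding \<open>D' \<inter> C\<close> with \<open>C \<in> I\<close> to it cannot increase the
  measure, so \<open>D'\<close> is null on all of \<open>I\<close>.\<close>

lemma null_part_cover:
  assumes I: "is_mu_ideal X \<mu> I" and J: "is_mu_ideal X \<mu> J" "I \<subseteq> J" "null_part I \<subseteq> J"
    and K: "compactin X K"
  shows "K \<in> J"
proof (rule mu_idealD(2)[OF J(1) K])
  note D = compact_idealD[OF mu_idealD(1)[OF I]]
  fix \<epsilon> :: real assume e: "\<epsilon> > 0"
  obtain Cs where Cs: "\<And>n. Cs n \<in> I" "\<And>n. Cs n \<subseteq> Cs (Suc n)" "\<And>n. Cs n \<subseteq> K"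
    and ex: "\<And>\<epsilon>. \<epsilon> > 0 \<Longrightarrow> \<exists>n. \<forall>C\<in>I. C \<subseteq> K \<longrightarrow> \<mu> C < \<mu> (Cs n) + \<epsilon>"
    using exhaustion[OF I K] by blast
  obtain N D' where D': "compactin X D'" "D' \<subseteq> K" "\<And>n. \<mu> (D' \<inter> Cs n) = 0" "\<mu> K - \<mu> (D' \<union> Cs N) < \<epsilon>"
    using K D(1)[OF Cs(1)] Cs(2) Cs(3) e by (rule almost_boolean) (rule that)
  have "\<mu> (D' \<inter> C) = 0" if C: "C \<in> I" for C
  proof (rule antisym)
    have k: "compactin X (D' \<inter> C)" using D'(1) D(1)[OF C] by (rule compact_Int)
    have kI: "D' \<inter> C \<in> I" using D(4)[OF C k] by auto
    show "0 \<le> \<mu> (D' \<inter> C)" using k by (rule nonneg)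
    show "\<mu> (D' \<inter> C) \<le> 0"
    proof (rule field_le_epsilon)
      fix \<delta> :: real assume d: "\<delta> > 0"
      obtain n where n: "\<And>B. \<lbrakk>B \<in> I; B \<subseteq> K\<rbrakk> \<Longrightarrow> \<mu> B < \<mu> (Cs n) + \<delta>"
        using ex[OF d] by blast
      have "\<mu> (D' \<inter> C \<union> Cs n) < \<mu> (Cs n) + \<delta>"
        using D'(2) Cs(3) by (intro n D(3)[OF kI Cs(1)]) auto
      moreover have "\<mu> (D' \<inter> C \<inter> Cs n) \<le> \<mu> (D' \<inter> Cs n)"
        using k D'(1) D(1)[OF Cs(1)] D(1)[OF C] by (intro mono compact_Int) auto
      ultimately show "\<mu> (D' \<inter> C) \<le> 0 + \<delta>"
        using modular[OF k D(1)[OF Cs(1)], of n] D'(3)[of n] by simp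
    qed
  qed
  then have "D' \<in> J" using D'(1) J(3) by (auto simp: null_part_def)
  then have "D' \<union> Cs N \<in> J"
    using Cs(1) J(2) compact_idealD(3)[OF mu_idealD(1)[OF J(1)]] by blast
  then show "\<exists>C\<in>J. C \<subseteq> K \<and> \<mu> K - \<mu> C < \<epsilon>"
    using D' Cs(3) by (intro bexI[of _ "D' \<union> Cs N"]) auto
qed

lemma boolean_mu: "boolean_frame (mu_locale X \<mu>)"
  unfolding boolean_frame_def
proof (intro conjI ballI)
  fix I assume "I \<in> carrier (mu_locale X \<mu>)"
  then have I: "is_mu_ideal X \<mu> I" by (simp add: mu_locale_simps)
  have N: "is_mu_ideal X \<mu> (null_part I)" using I by (rule is_mu_ideal_null_part)
  have car: "{I, null_part I} \<subseteq> carrier (mu_locale X \<mu>)" using I N by (simp add: mu_locale_simps)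
  have "I \<inter> null_part I \<subseteq> {K. compactin X K \<and> \<mu> K = 0}"
  proof
    fix K assume "K \<in> I \<inter> null_part I"
    then have "compactin X K" "\<mu> (K \<inter> K) = 0" by (auto simp: null_part_def)
    then show "K \<in> {K. compactin X K \<and> \<mu> K = 0}" by simp
  qed
  then have "I \<sqinter>\<^bsub>mu_locale X \<mu>\<^esub> null_part I = \<bottom>\<^bsub>mu_locale X \<mu>\<^esub>"
    using null_in_mu_ideal[OF I] null_in_mu_ideal[OF N] by (auto simp: mu_meet[OF I N] mu_bottom)
  moreover have "I \<squnion>\<^bsub>mu_locale X \<mu>\<^esub> null_part I = \<top>\<^bsub>mu_locale X \<mu>\<^esub>"
    unfolding join_def mu_top
  proof (rule mu.sup_eqI[OF car])
    show "{K. compactin X K} \<in> carrier (mu_locale X \<mu>)"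
      by (simp add: mu_locale_simps is_mu_ideal_compacts)
    show "a \<sqsubseteq>\<^bsub>mu_locale X \<mu>\<^esub> {K. compactin X K}" if "a \<in> {I, null_part I}" for a
      using that compact_idealD(1)[OF mu_idealD(1)[OF I]] compact_idealD(1)[OF mu_idealD(1)[OF N]]
      by (auto simp: mu_locale_simps)
    show "{K. compactin X K} \<sqsubseteq>\<^bsub>mu_locale X \<mu>\<^esub> J"
      if "J \<in> carrier (mu_locale X \<mu>)" "\<And>a. a \<in> {I, null_part I} \<Longrightarrow> a \<sqsubseteq>\<^bsub>mu_locale X \<mu>\<^esub> J" for J
      using that null_part_cover[OF I, of J] by (auto simp: mu_locale_simps)
  qed
  ultimately show "\<exists>V\<in>carrier (mu_locale X \<mu>). I \<sqinter>\<^bsub>mu_locale X \<mu>\<^esub> V = \<bottom>\<^bsub>mu_locale X \<mu>\<^esub> \<and>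
      I \<squnion>\<^bsub>mu_locale X \<mu>\<^esub> V = \<top>\<^bsub>mu_locale X \<mu>\<^esub>"
    using N by (auto simp: mu_locale_simps)
qed (rule frame_mu)

lemma compact_ideal_Un:
  assumes "compact_ideal X I" "compact_ideal X J"
  shows "compact_ideal X {A \<union> B | A B. A \<in> I \<and> B \<in> J}"
  unfolding compact_ideal_def
proof (intro conjI ballI allI impI)
  note I = compact_idealD[OF assms(1)] and J = compact_idealD[OF assms(2)]
  let ?U = "{A \<union> B | A B. A \<in> I \<and> B \<in> J}"
  show "compactin X K" if "K \<in> ?U" for K using that I(1) J(1) by (auto intro: compactin_Un)
  show "{} \<in> ?U" using I(2) J(2) by blast
  show "K \<union> C \<in> ?U" if KC: "K \<in> ?U" "C \<in> ?U" for K C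
  proof -
    obtain A B A' B' where "A \<in> I" "B \<in> J" "K = A \<union> B" "A' \<in> I" "B' \<in> J" "C = A' \<union> B'"
      using KC by auto
    then have "A \<union> A' \<in> I" "B \<union> B' \<in> J" "K \<union> C = (A \<union> A') \<union> (B \<union> B')"
      using I(3) J(3) by auto
    then show ?thesis by blast
  qed
  show "C \<in> ?U" if K: "K \<in> ?U" and C: "compactin X C" "C \<subseteq> K" for K C
  proof -
    obtain A B where AB: "A \<in> I" "B \<in> J" "K = A \<union> B" using K by auto
    then have "A \<inter> C \<in> I" "B \<inter> C \<in> J"
      using C(1) I(1) J(1) by (auto intro!: I(4)[of A] J(4)[of B] compact_Int)
    moreover have "C = (A \<inter> C) \<union> (B \<inter> C)" using AB(3) C(2) by auto
    ultimately show ?thesis by blast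
  qed
qed

lemma mu_join:
  assumes I: "is_mu_ideal X \<mu> I" and J: "is_mu_ideal X \<mu> J"
  shows "I \<squnion>\<^bsub>mu_locale X \<mu>\<^esub> J = mu_closure X \<mu> {A \<union> B | A B. A \<in> I \<and> B \<in> J}"
  unfolding join_def
proof (rule mu.sup_eqI)
  let ?U = "{A \<union> B | A B. A \<in> I \<and> B \<in> J}"
  note cI = compact_idealD[OF mu_idealD(1)[OF I]] and cJ = compact_idealD[OF mu_idealD(1)[OF J]]
  show "{I, J} \<subseteq> carrier (mu_locale X \<mu>)" using I J by (simp add: mu_locale_simps)
  have U: "compact_ideal X ?U"
    using mu_idealD(1)[OF I] mu_idealD(1)[OF J] by (rule compact_ideal_Un)
  then show "mu_closure X \<mu> ?U \<in> carrier (mu_locale X \<mu>)"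
    by (simp add: mu_locale_simps is_mu_ideal_mu_closure)
  have "?U \<subseteq> mu_closure X \<mu> ?U"
    by (intro subsetI in_mu_closure compact_idealD(1)[OF U])
  moreover have "I \<subseteq> ?U" "J \<subseteq> ?U"
  proof safe
    show "\<exists>A B. K = A \<union> B \<and> A \<in> I \<and> B \<in> J" if "K \<in> I" for K
      using that cJ(2) by (intro exI[of _ K] exI[of _ "{}"]) simp
    show "\<exists>A B. K = A \<union> B \<and> A \<in> I \<and> B \<in> J" if "K \<in> J" for K
      using that cI(2) by (intro exI[of _ "{}"] exI[of _ K]) simp
  qed
  ultimately show "a \<sqsubseteq>\<^bsub>mu_locale X \<mu>\<^esub> mu_closure X \<mu> ?U" if "a \<in> {I, J}" for a
    using that by (auto simp: mu_locale_simps)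
  show "mu_closure X \<mu> ?U \<sqsubseteq>\<^bsub>mu_locale X \<mu>\<^esub> y"
    if "y \<in> carrier (mu_locale X \<mu>)" "\<And>a. a \<in> {I, J} \<Longrightarrow> a \<sqsubseteq>\<^bsub>mu_locale X \<mu>\<^esub> y" for y
  proof -
    have y: "is_mu_ideal X \<mu> y" "I \<subseteq> y" "J \<subseteq> y" using that by (auto simp: mu_locale_simps)
    have "?U \<subseteq> y"
      using y(2,3) by (auto intro!: compact_idealD(3)[OF mu_idealD(1)[OF y(1)]])
    then show ?thesis using y(1) by (simp add: mu_locale_simps mu_closure_least)
  qed
qed

lemma mu_directed_Sup:
  assumes D: "directed_in (mu_locale X \<mu>) D"
  shows "\<Squnion>\<^bsub>mu_locale X \<mu>\<^esub>D = mu_closure X \<mu> (\<Union>D)"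
proof (rule mu.sup_eqI)
  have id: "is_mu_ideal X \<mu> I" if "I \<in> D" for I
    using D that by (auto simp: directed_in_def mu_locale_simps)
  note c = compact_idealD[OF mu_idealD(1)[OF id]]
  show "D \<subseteq> carrier (mu_locale X \<mu>)" using D by (simp add: directed_in_def)
  have "compact_ideal X (\<Union>D)"
    unfolding compact_ideal_def
  proof (intro conjI ballI allI impI)
    show "{} \<in> \<Union>D" using D c(2) by (auto simp: directed_in_def)
    show "K \<union> C \<in> \<Union>D" if KC: "K \<in> \<Union>D" "C \<in> \<Union>D" for K C
    proof -
      obtain I J where "I \<in> D" "J \<in> D" "K \<in> I" "C \<in> J" using KC by auto
      then obtain W where "W \<in> D" "K \<in> W" "C \<in> W"
        using D unfolding directed_in_def mu_locale_simps by blast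
      then show ?thesis using c(3) by blast
    qed
    show "C \<in> \<Union>D" if "K \<in> \<Union>D" "compactin X C" "C \<subseteq> K" for K C
      using that c(4) by blast
  qed (use c(1) in auto)
  then show "mu_closure X \<mu> (\<Union>D) \<in> carrier (mu_locale X \<mu>)"
    by (simp add: mu_locale_simps is_mu_ideal_mu_closure)
  show "a \<sqsubseteq>\<^bsub>mu_locale X \<mu>\<^esub> mu_closure X \<mu> (\<Union>D)" if "a \<in> D" for a
    using that c(1) by (auto simp: mu_locale_simps intro: in_mu_closure)
  show "mu_closure X \<mu> (\<Union>D) \<sqsubseteq>\<^bsub>mu_locale X \<mu>\<^esub> y"
    if "y \<in> carrier (mu_locale X \<mu>)" "\<And>a. a \<in> D \<Longrightarrow> a \<sqsubseteq>\<^bsub>mu_locale X \<mu>\<^esub> y" for y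
    using that by (simp add: mu_locale_simps) (rule mu_closure_least, auto)
qed

text \<open>Approximation from inside does not change the supremum of the measures.\<close>

lemma SUP_mu_closure:
  assumes "\<And>C. C \<in> D \<Longrightarrow> compactin X C"
  shows "(SUP K\<in>mu_closure X \<mu> D. ennreal (\<mu> K)) = (SUP K\<in>D. ennreal (\<mu> K))"
proof (rule antisym)
  show "(SUP K\<in>mu_closure X \<mu> D. ennreal (\<mu> K)) \<le> (SUP K\<in>D. ennreal (\<mu> K))"
  proof (rule SUP_least)
    fix K assume K: "K \<in> mu_closure X \<mu> D"
    show "ennreal (\<mu> K) \<le> (SUP K\<in>D. ennreal (\<mu> K))"
    proof (rule ennreal_le_epsilon)
      fix \<epsilon> :: real assume e: "\<epsilon> > 0"
      obtain C where C: "C \<in> D" "\<mu> K - \<mu> C < \<epsilon>" using K e by (rule mu_closureE)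
      then have "ennreal (\<mu> K) \<le> ennreal (\<mu> C + \<epsilon>)" by (intro ennreal_leI) simp
      also have "\<dots> = ennreal (\<mu> C) + ennreal \<epsilon>"
        using e nonneg[OF assms[OF C(1)]] by simp
      also have "\<dots> \<le> (SUP K\<in>D. ennreal (\<mu> K)) + ennreal \<epsilon>"
        using C(1) by (intro add_right_mono SUP_upper)
      finally show "ennreal (\<mu> K) \<le> (SUP K\<in>D. ennreal (\<mu> K)) + ennreal \<epsilon>" .
    qed
  qed
  show "(SUP K\<in>D. ennreal (\<mu> K)) \<le> (SUP K\<in>mu_closure X \<mu> D. ennreal (\<mu> K))"
    using assms by (intro SUP_subset_mono) (auto intro: in_mu_closure)
qed

end

lemma SUP_add_SUP_le:
  fixes f :: "'a \<Rightarrow> ennreal" and g :: "'b \<Rightarrow> ennreal"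
  assumes "I \<noteq> {}" "J \<noteq> {}" "\<And>i j. \<lbrakk>i \<in> I; j \<in> J\<rbrakk> \<Longrightarrow> f i + g j \<le> z"
  shows "(SUP i\<in>I. f i) + (SUP j\<in>J. g j) \<le> z"
proof -
  have "f i + (SUP j\<in>J. g j) \<le> z" if "i \<in> I" for i
    using assms that by (subst ennreal_SUP_add_right) (auto intro: SUP_least)
  then show ?thesis
    using assms(1) by (subst ennreal_SUP_add_left[symmetric]) (auto intro: SUP_least)
qed

context radon
begin

text \<open>For \<open>A \<in> I\<close> and \<open>B \<in> J\<close> modularity of \<open>\<mu>\<close> gives one inequality. For the other, given
  \<open>A \<union> B\<close> and \<open>C \<in> I \<inter> J\<close>, apply it to \<open>A \<union> C\<close> and \<open>B \<union> C\<close>, whose intersection contains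
  \<open>C\<close>.\<close>

lemma inner_measure_modular:
  assumes I: "is_mu_ideal X \<mu> I" and J: "is_mu_ideal X \<mu> J"
  shows "(SUP K\<in>I. ennreal (\<mu> K)) + (SUP K\<in>J. ennreal (\<mu> K))
    = (SUP K\<in>{A \<union> B | A B. A \<in> I \<and> B \<in> J}. ennreal (\<mu> K)) + (SUP K\<in>I \<inter> J. ennreal (\<mu> K))"
proof (rule antisym)
  note cI = compact_idealD[OF mu_idealD(1)[OF I]] and cJ = compact_idealD[OF mu_idealD(1)[OF J]]
  let ?U = "{A \<union> B | A B. A \<in> I \<and> B \<in> J}"
  have U: "compact_ideal X ?U"
    using mu_idealD(1)[OF I] mu_idealD(1)[OF J] by (rule compact_ideal_Un)
  have add: "ennreal (\<mu> A) + ennreal (\<mu> B) = ennreal (\<mu> (A \<union> B)) + ennreal (\<mu> (A \<inter> B))"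
    if AB: "compactin X A" "compactin X B" for A B
    using modular[OF AB] nonneg[OF AB(1)] nonneg[OF AB(2)] nonneg[OF compactin_Un[OF AB]]
      nonneg[OF compact_Int[OF AB]] by (simp flip: ennreal_plus)
  show "(SUP K\<in>I. ennreal (\<mu> K)) + (SUP K\<in>J. ennreal (\<mu> K))
    \<le> (SUP K\<in>?U. ennreal (\<mu> K)) + (SUP K\<in>I \<inter> J. ennreal (\<mu> K))"
  proof (rule SUP_add_SUP_le)
    fix A B assume A: "A \<in> I" and B: "B \<in> J"
    have "compactin X (A \<inter> B)" using cI(1)[OF A] cJ(1)[OF B] by (rule compact_Int)
    then have "A \<inter> B \<in> I \<inter> J" using cI(4)[OF A] cJ(4)[OF B] by auto
    moreover have "A \<union> B \<in> ?U" using A B by blast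
    ultimately show "ennreal (\<mu> A) + ennreal (\<mu> B)
      \<le> (SUP K\<in>?U. ennreal (\<mu> K)) + (SUP K\<in>I \<inter> J. ennreal (\<mu> K))"
      unfolding add[OF cI(1)[OF A] cJ(1)[OF B]] by (intro add_mono SUP_upper)
  qed (use cI(2) cJ(2) in auto)
  show "(SUP K\<in>?U. ennreal (\<mu> K)) + (SUP K\<in>I \<inter> J. ennreal (\<mu> K))
    \<le> (SUP K\<in>I. ennreal (\<mu> K)) + (SUP K\<in>J. ennreal (\<mu> K))"
  proof (rule SUP_add_SUP_le)
    fix K C assume K: "K \<in> ?U" and C: "C \<in> I \<inter> J"
    obtain A B where AB: "A \<in> I" "B \<in> J" "K = A \<union> B" using K by auto
    have AC: "A \<union> C \<in> I" "B \<union> C \<in> J" using AB C cI(3) cJ(3) by auto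
    note k = cI(1)[OF AC(1)] cJ(1)[OF AC(2)]
    have "\<mu> K \<le> \<mu> ((A \<union> C) \<union> (B \<union> C))" "\<mu> C \<le> \<mu> ((A \<union> C) \<inter> (B \<union> C))"
      using AB C k compact_idealD(1)[OF U K] cI(1)
      by (auto intro!: mono intro: compactin_Un compact_Int)
    then have "ennreal (\<mu> K) + ennreal (\<mu> C) \<le> ennreal (\<mu> (A \<union> C)) + ennreal (\<mu> (B \<union> C))"
      unfolding add[OF k] by (intro add_mono ennreal_leI)
    also have "\<dots> \<le> (SUP K\<in>I. ennreal (\<mu> K)) + (SUP K\<in>J. ennreal (\<mu> K))"
      using AC by (intro add_mono SUP_upper)
    finally show "ennreal (\<mu> K) + ennreal (\<mu> C)
      \<le> (SUP K\<in>I. ennreal (\<mu> K)) + (SUP K\<in>J. ennreal (\<mu> K))" .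
  qed (use cI(2) cJ(2) in auto)
qed

lemma is_loc_measure_inner: "is_loc_measure (mu_locale X \<mu>) (inner_measure X \<mu>)"
  unfolding is_loc_measure_def
proof (intro conjI ballI allI impI)
  let ?m = "inner_measure X \<mu>"
  have m: "?m I = (SUP K\<in>I. ennreal (\<mu> K))" if "I \<in> carrier (mu_locale X \<mu>)" for I
    using that by (simp add: inner_measure_def)
  show "?m \<in> extensional (carrier (mu_locale X \<mu>))" by (simp add: inner_measure_def)
  show "?m I \<le> ?m J" if "I \<in> carrier (mu_locale X \<mu>)" "J \<in> carrier (mu_locale X \<mu>)"
    "I \<sqsubseteq>\<^bsub>mu_locale X \<mu>\<^esub> J" for I J
    using that by (simp add: m mu_locale_simps(2) SUP_subset_mono)
  have "?m \<bottom>\<^bsub>mu_locale X \<mu>\<^esub> = (SUP K\<in>{K. compactin X K \<and> \<mu> K = 0}. ennreal (\<mu> K))"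
    using mu.bottom_closed by (subst m) (simp_all add: mu_bottom)
  also have "\<dots> \<le> 0" by (intro SUP_least) simp
  finally show "?m \<bottom>\<^bsub>mu_locale X \<mu>\<^esub> = 0" by simp
  show "?m I + ?m J = ?m (I \<squnion>\<^bsub>mu_locale X \<mu>\<^esub> J) + ?m (I \<sqinter>\<^bsub>mu_locale X \<mu>\<^esub> J)"
    if IJ: "I \<in> carrier (mu_locale X \<mu>)" "J \<in> carrier (mu_locale X \<mu>)" for I J
  proof -
    have id: "is_mu_ideal X \<mu> I" "is_mu_ideal X \<mu> J" using IJ by (simp_all add: mu_locale_simps)
    have U: "compact_ideal X {A \<union> B | A B. A \<in> I \<and> B \<in> J}"
      using mu_idealD(1)[OF id(1)] mu_idealD(1)[OF id(2)] by (rule compact_ideal_Un)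
    have "?m (I \<squnion>\<^bsub>mu_locale X \<mu>\<^esub> J) = (SUP K\<in>{A \<union> B | A B. A \<in> I \<and> B \<in> J}. ennreal (\<mu> K))"
      unfolding m[OF mu.join_closed[OF IJ]] by (subst mu_join[OF id])
        (rule SUP_mu_closure, rule compact_idealD(1)[OF U])
    moreover have "?m (I \<sqinter>\<^bsub>mu_locale X \<mu>\<^esub> J) = (SUP K\<in>I \<inter> J. ennreal (\<mu> K))"
      unfolding m[OF mu.meet_closed[OF IJ]] by (subst mu_meet[OF id]) (rule HOL.refl)
    ultimately show ?thesis
      using inner_measure_modular[OF id] IJ by (simp add: m)
  qed
  show "?m (\<Squnion>\<^bsub>mu_locale X \<mu>\<^esub>D) = (SUP I\<in>D. ?m I)" if D: "directed_in (mu_locale X \<mu>) D" for D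
  proof -
    have DC: "D \<subseteq> carrier (mu_locale X \<mu>)" using D by (simp add: directed_in_def)
    have "?m (\<Squnion>\<^bsub>mu_locale X \<mu>\<^esub>D) = (SUP K\<in>mu_closure X \<mu> (\<Union>D). ennreal (\<mu> K))"
      using mu.weak.sup_closed[OF DC] by (simp add: m mu_directed_Sup[OF D])
    also have "\<dots> = (SUP K\<in>\<Union>D. ennreal (\<mu> K))"
      using DC by (intro SUP_mu_closure) (auto simp: mu_locale_simps dest: compact_idealD(1)[OF mu_idealD(1)])
    also have "\<dots> = (SUP I\<in>D. SUP K\<in>I. ennreal (\<mu> K))"
      by (simp add: SUP_UNION[of _ "\<lambda>x. x", simplified])
    also have "\<dots> = (SUP I\<in>D. ?m I)"
      using DC by (intro SUP_cong) (auto simp: m)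
    finally show ?thesis .
  qed
qed

end

section \<open>Radon spaces, their projections and proper measure-preserving maps\<close>

lemma opens_simps:
  "carrier (opens X) = {U. openin X U}" "le (opens X) = (\<subseteq>)" "eq (opens X) = (=)"
  by (simp_all add: opens_def)

lemma partial_order_opens: "partial_order (opens X)"
  by standard (auto simp: opens_simps)

lemma opens_Sup:
  assumes "A \<subseteq> carrier (opens X)"
  shows "\<Squnion>\<^bsub>opens X\<^esub>A = \<Union>A" "least (opens X) (\<Union>A) (Upper (opens X) A)"
proof -
  have o: "openin X (\<Union>A)" using assms by (auto simp: opens_simps)
  then show "\<Squnion>\<^bsub>opens X\<^esub>A = \<Union>A"
    using assms by (intro partial_order.sup_eqI[OF partial_order_opens]) (auto simp: opens_simps)
  show "least (opens X) (\<Union>A) (Upper (opens X) A)"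
    using assms o by (intro least_UpperI) (auto simp: opens_simps Upper_def)
qed

lemma complete_lattice_opens: "complete_lattice (opens X)"
  using partial_order.complete_lattice_by_sups[OF partial_order_opens] opens_Sup(2) by blast

lemma opens_meet:
  assumes "openin X U" "openin X V" shows "U \<sqinter>\<^bsub>opens X\<^esub> V = U \<inter> V"
  unfolding meet_def
  by (rule partial_order.inf_eqI[OF partial_order_opens]) (use assms in \<open>auto simp: opens_simps\<close>)

lemma opens_top: "\<top>\<^bsub>opens X\<^esub> = topspace X"
  by (rule complete_lattice.top_eqI[OF complete_lattice_opens])
    (auto simp: opens_simps openin_subset)

lemma frame_opens: "frame (opens X)"
proof -
  interpret complete_lattice "opens X" by (rule complete_lattice_opens)
  show ?thesis
  proof
    fix V A assume V: "V \<in> carrier (opens X)" and A: "A \<subseteq> carrier (opens X)"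
    have o: "openin X (\<Union>A)" "openin X V" using A V by (auto simp: opens_simps)
    have im: "(\<lambda>U. V \<sqinter>\<^bsub>opens X\<^esub> U) ` A = (\<lambda>U. V \<inter> U) ` A"
      using A V by (intro image_cong) (auto simp: opens_meet opens_simps)
    moreover have "(\<lambda>U. V \<inter> U) ` A \<subseteq> carrier (opens X)"
      using A V by (auto simp: opens_simps)
    ultimately show "V \<sqinter>\<^bsub>opens X\<^esub> \<Squnion>\<^bsub>opens X\<^esub>A = \<Squnion>\<^bsub>opens X\<^esub>((\<lambda>U. V \<sqinter>\<^bsub>opens X\<^esub> U) ` A)"
      using A o by (auto simp: opens_Sup opens_meet)
  qed
qed

lemma frame_map_opens:
  assumes "continuous_map X Y f" shows "frame_map (opens X) (opens Y) (opens_map X Y f)"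
proof -
  interpret X: plain_frame "opens X" by (rule plain_frame.intro[OF frame_opens])
  interpret Y: plain_frame "opens Y" by (rule plain_frame.intro[OF frame_opens])
  have pre: "openin X {x \<in> topspace X. f x \<in> V}" if "openin Y V" for V
    using assms that by (auto simp: continuous_map_def)
  have maps: "f x \<in> topspace Y" if "x \<in> topspace X" for x
    using assms that by (auto simp: continuous_map_def)
  have val: "opens_map X Y f V = {x \<in> topspace X. f x \<in> V}" if "openin Y V" for V
    using that by (simp add: opens_map_def opens_simps)
  have "frame_hom (opens Y) (opens X) (opens_map X Y f)"
  proof (rule frame_homI[OF complete_lattice_opens complete_lattice_opens])
    show "opens_map X Y f \<in> carrier (opens Y) \<rightarrow>\<^sub>E carrier (opens X)"
      using pre by (auto simp: opens_map_def opens_simps)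
    show "opens_map X Y f (\<Squnion>\<^bsub>opens Y\<^esub>A) = \<Squnion>\<^bsub>opens X\<^esub>(opens_map X Y f ` A)"
      if A: "A \<subseteq> carrier (opens Y)" for A
    proof -
      have "opens_map X Y f ` A = (\<lambda>V. {x \<in> topspace X. f x \<in> V}) ` A"
        using A by (intro image_cong) (auto simp: val opens_simps)
      moreover have "(\<lambda>V. {x \<in> topspace X. f x \<in> V}) ` A \<subseteq> carrier (opens X)"
        using A pre by (auto simp: opens_simps)
      moreover have "openin Y (\<Union>A)" using A by (auto simp: opens_simps)
      ultimately show ?thesis using A by (auto simp: opens_Sup val)
    qed
    show "opens_map X Y f \<top>\<^bsub>opens Y\<^esub> = \<top>\<^bsub>opens X\<^esub>"
      using maps by (auto simp: opens_top val)
    show "opens_map X Y f (U \<sqinter>\<^bsub>opens Y\<^esub> V) = opens_map X Y f U \<sqinter>\<^bsub>opens X\<^esub> opens_map X Y f V"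
      if "U \<in> carrier (opens Y)" "V \<in> carrier (opens Y)" for U V
      using that pre by (auto simp: opens_simps opens_meet val openin_Int)
  qed
  then show ?thesis by unfold_locales
qed

lemma is_loc_measure_pushforward:
  assumes "frame_map L M f" "is_loc_measure L \<nu>"
  shows "is_loc_measure M (pushforward M f \<nu>)"
proof -
  interpret frame_map L M f by fact
  have mono: "\<nu> U \<le> \<nu> V" if "U \<in> carrier L" "V \<in> carrier L" "U \<sqsubseteq>\<^bsub>L\<^esub> V" for U V
    using assms(2)[unfolded is_loc_measure_def, THEN conjunct2, THEN conjunct1, rule_format, OF that] .
  have bot: "\<nu> \<bottom>\<^bsub>L\<^esub> = 0"
    using assms(2)[unfolded is_loc_measure_def, THEN conjunct2, THEN conjunct2, THEN conjunct1] .
  have modular: "\<nu> U + \<nu> V = \<nu> (U \<squnion>\<^bsub>L\<^esub> V) + \<nu> (U \<sqinter>\<^bsub>L\<^esub> V)"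
    if "U \<in> carrier L" "V \<in> carrier L" for U V
    using assms(2)[unfolded is_loc_measure_def, THEN conjunct2, THEN conjunct2, THEN conjunct2,
        THEN conjunct1, rule_format, OF that] .
  have dir: "\<nu> (\<Squnion>\<^bsub>L\<^esub>D) = (SUP U\<in>D. \<nu> U)" if "directed_in L D" for D
    using assms(2)[unfolded is_loc_measure_def, THEN conjunct2, THEN conjunct2, THEN conjunct2,
        THEN conjunct2, rule_format, OF that] .
  show ?thesis
    unfolding is_loc_measure_def
  proof (intro conjI ballI allI impI)
    show "pushforward M f \<nu> \<in> extensional (carrier M)" by (simp add: pushforward_def)
    show "pushforward M f \<nu> U \<le> pushforward M f \<nu> V"
      if "U \<in> carrier M" "V \<in> carrier M" "U \<sqsubseteq>\<^bsub>M\<^esub> V" for U V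
      using that by (simp add: pushforward_def mono f_mono)
    show "pushforward M f \<nu> \<bottom>\<^bsub>M\<^esub> = 0"
      using frame_hom_bottom[OF M.complete_lattice_axioms L.complete_lattice_axioms hom]
      by (simp add: pushforward_def bot)
    show "pushforward M f \<nu> U + pushforward M f \<nu> V
        = pushforward M f \<nu> (U \<squnion>\<^bsub>M\<^esub> V) + pushforward M f \<nu> (U \<sqinter>\<^bsub>M\<^esub> V)"
      if "U \<in> carrier M" "V \<in> carrier M" for U V
      using that modular[of "f U" "f V"] by (simp add: pushforward_def f_join f_meet)
    show "pushforward M f \<nu> (\<Squnion>\<^bsub>M\<^esub>D) = (SUP U\<in>D. pushforward M f \<nu> U)" if D: "directed_in M D" for D
    proof -
      have DM: "D \<subseteq> carrier M" using D by (simp add: directed_in_def)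
      have "directed_in L (f ` D)"
        unfolding directed_in_def
      proof (intro conjI ballI)
        show "f ` D \<subseteq> carrier L" using DM by auto
        show "f ` D \<noteq> {}" using D by (simp add: directed_in_def)
        fix u v assume "u \<in> f ` D" "v \<in> f ` D"
        then obtain U V where UV: "U \<in> D" "V \<in> D" "u = f U" "v = f V" by auto
        then obtain W where W: "W \<in> D" "U \<sqsubseteq>\<^bsub>M\<^esub> W" "V \<sqsubseteq>\<^bsub>M\<^esub> W"
          using D unfolding directed_in_def by blast
        then show "\<exists>w\<in>f ` D. u \<sqsubseteq>\<^bsub>L\<^esub> w \<and> v \<sqsubseteq>\<^bsub>L\<^esub> w"
          using UV DM by (intro bexI[of _ "f W"]) (auto intro!: f_mono)
      qed
      then have "\<nu> (f (\<Squnion>\<^bsub>M\<^esub>D)) = (SUP U\<in>D. \<nu> (f U))"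
        using dir[of "f ` D"] by (simp add: f_sup[OF DM] image_image)
      also have "\<dots> = (SUP U\<in>D. pushforward M f \<nu> U)"
        using DM by (intro SUP_cong) (auto simp: pushforward_def)
      finally show ?thesis using DM by (simp add: pushforward_def)
    qed
  qed
qed

context radon
begin

lemma compact_ideal_compacts_in: "compact_ideal X {K. compactin X K \<and> K \<subseteq> V}"
  by (auto simp: compact_ideal_def compactin_Un)

lemma mu_proj_eq:
  assumes "openin X V" shows "mu_proj X \<mu> V = mu_closure X \<mu> {K. compactin X K \<and> K \<subseteq> V}"
  using assms by (simp add: mu_proj_def opens_simps mu_ideal_hull[OF compact_ideal_compacts_in])

text \<open>If \<open>A\<close> and \<open>B\<close> both nearly fill \<open>K\<close>, then so does \<open>A \<inter> B\<close>, by modularity.\<close>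

lemma mu_closure_Int:
  assumes "compact_ideal X D" "compact_ideal X E"
  shows "mu_closure X \<mu> D \<inter> mu_closure X \<mu> E = mu_closure X \<mu> (D \<inter> E)"
proof (intro equalityI subsetI)
  note D = compact_idealD[OF assms(1)] and E = compact_idealD[OF assms(2)]
  fix K assume K: "K \<in> mu_closure X \<mu> D \<inter> mu_closure X \<mu> E"
  show "K \<in> mu_closure X \<mu> (D \<inter> E)"
    unfolding mu_closure_def
  proof (intro CollectI conjI allI impI)
    show Kc: "compactin X K" using K by (simp add: mu_closure_def)
    fix \<epsilon> :: real assume "\<epsilon> > 0"
    then have e: "\<epsilon> / 2 > 0" by simp
    obtain A where A: "A \<in> D" "A \<subseteq> K" "\<mu> K - \<mu> A < \<epsilon> / 2"
      using IntD1[OF K] e by (rule mu_closureE)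
    obtain B where B: "B \<in> E" "B \<subseteq> K" "\<mu> K - \<mu> B < \<epsilon> / 2"
      using IntD2[OF K] e by (rule mu_closureE)
    note k = D(1)[OF A(1)] E(1)[OF B(1)]
    have "\<mu> (A \<union> B) \<le> \<mu> K" using k Kc A(2) B(2) by (intro mono compactin_Un) auto
    then have "\<mu> K - \<mu> (A \<inter> B) < \<epsilon>" using modular[OF k] A(3) B(3) by simp
    moreover have "A \<inter> B \<in> D \<inter> E"
      using D(4)[OF A(1) compact_Int[OF k]] E(4)[OF B(1) compact_Int[OF k]] by simp
    ultimately show "\<exists>C\<in>D \<inter> E. C \<subseteq> K \<and> \<mu> K - \<mu> C < \<epsilon>"
      using A(2) by (intro bexI[of _ "A \<inter> B"]) auto
  qed
next
  fix K assume "K \<in> mu_closure X \<mu> (D \<inter> E)"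
  then show "K \<in> mu_closure X \<mu> D \<inter> mu_closure X \<mu> E"
    unfolding mu_closure_def by auto
qed

lemma compact_diff:
  assumes "compactin X K" "openin X U" shows "compactin X (K - U)"
proof -
  have "K - U = K \<inter> (topspace X - U)"
    using compactin_subset_topspace[OF assms(1)] by auto
  then show ?thesis
    using assms by (simp add: compact_Int_closedin closedin_diff)
qed

text \<open>The compact sets \<open>K - U\<close> and \<open>K - V\<close> are disjoint; removing from \<open>K\<close> disjoint open
  neighbourhoods of them leaves the two pieces.\<close>

lemma compact_split:
  assumes K: "compactin X K" and U: "openin X U" and V: "openin X V" and sub: "K \<subseteq> U \<union> V"
  obtains A B where "compactin X A" "compactin X B" "A \<subseteq> U" "B \<subseteq> V" "K = A \<union> B"
proof -
  have c: "compactin X (K - U)" "compactin X (K - V)"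
    using K U V by (simp_all add: compact_diff)
  have "disjnt (K - U) (K - V)" using sub by (auto simp: disjnt_def)
  then obtain U' V' where s: "openin X U'" "openin X V'" "K - U \<subseteq> U'" "K - V \<subseteq> V'" "disjnt U' V'"
    using Hausdorff_space_compact_separation[OF Hausdorff c] by blast
  show thesis
  proof
    show "compactin X (K - U')" "compactin X (K - V')" using K s by (simp_all add: compact_diff)
    show "K - U' \<subseteq> U" "K - V' \<subseteq> V" using s by auto
    show "K = (K - U') \<union> (K - V')" using s(5) by (auto simp: disjnt_def)
  qed
qed

text \<open>A compact set inside a union of opens splits into finitely many compact pieces, each in one of
  the opens. This is why \<open>mu_proj X \<mu>\<close> preserves suprema.\<close>

lemma mu_ideal_open_cover:
  assumes J: "is_mu_ideal X \<mu> J" and A: "\<And>V. V \<in> A \<Longrightarrow> openin X V"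
    and sub: "\<And>V K. \<lbrakk>V \<in> A; compactin X K; K \<subseteq> V\<rbrakk> \<Longrightarrow> K \<in> J"
    and K: "compactin X K" "K \<subseteq> \<Union>A"
  shows "K \<in> J"
proof -
  note D = compact_idealD[OF mu_idealD(1)[OF J]]
  obtain F where F: "finite F" "F \<subseteq> A" "K \<subseteq> \<Union>F"
    using K A unfolding compactin_def by meson
  from F K(1) show ?thesis
  proof (induction F arbitrary: K)
    case empty then show ?case using D(2) by simp
  next
    case (insert V F)
    have o: "openin X V" "openin X (\<Union>F)" using insert.prems A by auto
    have "K \<subseteq> V \<union> \<Union>F" using insert.prems by auto
    with insert.prems(3) o obtain B C where BC: "compactin X B" "compactin X C" "B \<subseteq> V" "C \<subseteq> \<Union>F" "K = B \<union> C"
      by (rule compact_split)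
    have "B \<in> J" using sub[of V B] BC insert.prems by simp
    moreover have "C \<in> J" using insert.IH[of C] BC insert.prems by simp
    ultimately show ?case using BC(5) D(3) by simp
  qed
qed

lemma frame_map_mu_proj: "frame_map (mu_locale X \<mu>) (opens X) (mu_proj X \<mu>)"
proof -
  interpret O: plain_frame "opens X" by (rule plain_frame.intro[OF frame_opens])
  have id: "is_mu_ideal X \<mu> (mu_proj X \<mu> V)" if "openin X V" for V
    using that by (simp add: mu_proj_eq is_mu_ideal_mu_closure compact_ideal_compacts_in)
  have sub: "{K. compactin X K \<and> K \<subseteq> V} \<subseteq> mu_proj X \<mu> V" if "openin X V" for V
    using that by (auto simp: mu_proj_eq intro: in_mu_closure)
  have le_iff: "mu_proj X \<mu> V \<subseteq> J \<longleftrightarrow> (\<forall>K. compactin X K \<longrightarrow> K \<subseteq> V \<longrightarrow> K \<in> J)"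
    if "openin X V" "is_mu_ideal X \<mu> J" for V J
    using sub[OF that(1)] mu_closure_least[OF that(2), of "{K. compactin X K \<and> K \<subseteq> V}"] that(1)
    by (auto simp: mu_proj_eq)
  have "frame_hom (opens X) (mu_locale X \<mu>) (mu_proj X \<mu>)"
  proof (rule frame_homI[OF complete_lattice_opens complete_lattice_mu])
    show "mu_proj X \<mu> \<in> carrier (opens X) \<rightarrow>\<^sub>E carrier (mu_locale X \<mu>)"
      using id by (auto simp: mu_locale_simps opens_simps mu_proj_def)
    show "mu_proj X \<mu> (\<Squnion>\<^bsub>opens X\<^esub>A) = \<Squnion>\<^bsub>mu_locale X \<mu>\<^esub>(mu_proj X \<mu> ` A)"
      if A: "A \<subseteq> carrier (opens X)" for A
    proof (rule mu.sup_eqI[symmetric])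
      have o: "\<And>V. V \<in> A \<Longrightarrow> openin X V" and oU: "openin X (\<Union>A)"
        using A by (auto simp: opens_simps)
      show "mu_proj X \<mu> ` A \<subseteq> carrier (mu_locale X \<mu>)"
        using id o by (auto simp: mu_locale_simps)
      show "mu_proj X \<mu> (\<Squnion>\<^bsub>opens X\<^esub>A) \<in> carrier (mu_locale X \<mu>)"
        using id oU A by (simp add: mu_locale_simps opens_Sup)
      show "a \<sqsubseteq>\<^bsub>mu_locale X \<mu>\<^esub> mu_proj X \<mu> (\<Squnion>\<^bsub>opens X\<^esub>A)" if "a \<in> mu_proj X \<mu> ` A" for a
      proof -
        obtain V where V: "V \<in> A" "a = mu_proj X \<mu> V" using \<open>a \<in> mu_proj X \<mu> ` A\<close> by auto
        have "mu_proj X \<mu> V \<subseteq> mu_proj X \<mu> (\<Union>A)"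
          using V(1) sub[OF oU] by (subst le_iff[OF o[OF V(1)] id[OF oU]]) auto
        then show ?thesis using V A by (simp add: mu_locale_simps opens_Sup)
      qed
      show "mu_proj X \<mu> (\<Squnion>\<^bsub>opens X\<^esub>A) \<sqsubseteq>\<^bsub>mu_locale X \<mu>\<^esub> J"
        if "J \<in> carrier (mu_locale X \<mu>)" "\<And>a. a \<in> mu_proj X \<mu> ` A \<Longrightarrow> a \<sqsubseteq>\<^bsub>mu_locale X \<mu>\<^esub> J" for J
      proof -
        have J: "is_mu_ideal X \<mu> J" and le: "\<And>V. V \<in> A \<Longrightarrow> mu_proj X \<mu> V \<subseteq> J"
          using that by (auto simp: mu_locale_simps)
        have "K \<in> J" if "compactin X K" "K \<subseteq> \<Union>A" for K
          using J o _ that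
        proof (rule mu_ideal_open_cover)
          show "K \<in> J" if "V \<in> A" "compactin X K" "K \<subseteq> V" for V K
            using le[OF that(1)] le_iff[OF o[OF that(1)] J] that by simp
        qed
        then have "mu_proj X \<mu> (\<Union>A) \<subseteq> J" using le_iff[OF oU J] by simp
        then show ?thesis using A by (simp add: mu_locale_simps opens_Sup)
      qed
    qed
    have "{K. compactin X K} \<subseteq> mu_proj X \<mu> (topspace X)"
      using sub[of "topspace X"] compactin_subset_topspace by auto
    then show "mu_proj X \<mu> \<top>\<^bsub>opens X\<^esub> = \<top>\<^bsub>mu_locale X \<mu>\<^esub>"
      using compact_idealD(1)[OF mu_idealD(1)[OF id[OF openin_topspace]]] by (auto simp: opens_top mu_top)
    show "mu_proj X \<mu> (U \<sqinter>\<^bsub>opens X\<^esub> V) = mu_proj X \<mu> U \<sqinter>\<^bsub>mu_locale X \<mu>\<^esub> mu_proj X \<mu> V"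
      if "U \<in> carrier (opens X)" "V \<in> carrier (opens X)" for U V
    proof -
      have o: "openin X U" "openin X V" using that by (auto simp: opens_simps)
      have "{K. compactin X K \<and> K \<subseteq> U} \<inter> {K. compactin X K \<and> K \<subseteq> V} = {K. compactin X K \<and> K \<subseteq> U \<inter> V}"
        by auto
      then have "mu_proj X \<mu> U \<inter> mu_proj X \<mu> V = mu_proj X \<mu> (U \<inter> V)"
        using o mu_closure_Int[OF compact_ideal_compacts_in compact_ideal_compacts_in, of U V]
        by (simp add: mu_proj_eq openin_Int)
      then show ?thesis using o id by (simp add: opens_meet mu_meet)
    qed
  qed
  then show ?thesis by unfold_locales
qed

lemma Sl_lift_mu:
  "frame_map (mu_locale X \<mu>) (Sl (opens X)) (Sl_lift (opens X) (mu_locale X \<mu>) (mu_proj X \<mu>))"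
  "openin X U \<Longrightarrow> Sl_lift (opens X) (mu_locale X \<mu>) (mu_proj X \<mu>) (can (opens X) U) = mu_proj X \<mu> U"
proof -
  interpret O: plain_frame "opens X" by (rule plain_frame.intro[OF frame_opens])
  interpret S: plain_frame "Sl (opens X)" by (rule plain_frame.intro[OF O.frame_Sl])
  show "frame_map (mu_locale X \<mu>) (Sl (opens X)) (Sl_lift (opens X) (mu_locale X \<mu>) (mu_proj X \<mu>))"
    using Sl_lift_props(1)[OF frame_map_mu_proj boolean_mu] by unfold_locales
  show "openin X U \<Longrightarrow> Sl_lift (opens X) (mu_locale X \<mu>) (mu_proj X \<mu>) (can (opens X) U) = mu_proj X \<mu> U"
    using Sl_lift_props(2)[OF frame_map_mu_proj boolean_mu] by (simp add: opens_simps)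
qed

lemma is_loc_measure_Sl: "is_loc_measure (Sl (opens X)) (Sl_measure X \<mu>)"
  unfolding Sl_measure_def by (rule is_loc_measure_pushforward[OF Sl_lift_mu(1) is_loc_measure_inner])

end

text \<open>The arrows of the category of Radon spaces, apart from their normalisation outside the space.\<close>

locale radon_map = X: radon X \<mu> + Y: radon Y \<nu>
  for X :: "'a topology" and \<mu> and Y :: "'b topology" and \<nu> +
  fixes f :: "'a \<Rightarrow> 'b"
  assumes cont: "continuous_map X Y f"
    and proper: "compactin Y K \<Longrightarrow> compactin X {x \<in> topspace X. f x \<in> K}"
    and preserving: "compactin Y K \<Longrightarrow> \<mu> {x \<in> topspace X. f x \<in> K} = \<nu> K"
begin

definition pre :: "'b set \<Rightarrow> 'a set" where
  "pre K = {x \<in> topspace X. f x \<in> K}"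

definition pull_base :: "'b set set \<Rightarrow> 'a set set" where
  "pull_base I = {C. compactin X C \<and> (\<exists>K\<in>I. C \<subseteq> pre K)}"

text \<open>The frame homomorphism of the continuous map that \<open>f\<close> induces between the locales of ideals.\<close>

definition pull :: "'b set set \<Rightarrow> 'a set set" where
  "pull = (\<lambda>I\<in>carrier (mu_locale Y \<nu>). mu_closure X \<mu> (pull_base I))"

lemma pre_compact: "compactin Y K \<Longrightarrow> compactin X (pre K)"
  using proper by (simp add: pre_def)

lemma pre_measure: "compactin Y K \<Longrightarrow> \<mu> (pre K) = \<nu> K"
  using preserving by (simp add: pre_def)

lemma pre_mono: "K \<subseteq> C \<Longrightarrow> pre K \<subseteq> pre C"
  by (auto simp: pre_def)

lemma pre_Un: "pre (K \<union> C) = pre K \<union> pre C"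
  by (auto simp: pre_def)

lemma compact_ideal_pull_base:
  assumes "compact_ideal Y I" shows "compact_ideal X (pull_base I)"
  unfolding compact_ideal_def
proof (intro conjI ballI allI impI)
  note I = compact_idealD[OF assms]
  show "compactin X K" if "K \<in> pull_base I" for K using that by (simp add: pull_base_def)
  show "{} \<in> pull_base I" using I(2) by (auto simp: pull_base_def)
  show "K \<union> C \<in> pull_base I" if KC: "K \<in> pull_base I" "C \<in> pull_base I" for K C
  proof -
    obtain K' C' where "K' \<in> I" "C' \<in> I" "K \<subseteq> pre K'" "C \<subseteq> pre C'"
      using KC by (auto simp: pull_base_def)
    then have "K \<union> C \<subseteq> pre (K' \<union> C')" "K' \<union> C' \<in> I" using I(3) by (auto simp: pre_Un)
    then show ?thesis using KC by (auto simp: pull_base_def intro: compactin_Un)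
  qed
  show "C \<in> pull_base I" if "K \<in> pull_base I" "compactin X C" "C \<subseteq> K" for K C
    using that by (auto simp: pull_base_def)
qed

lemma pull_eq: "is_mu_ideal Y \<nu> I \<Longrightarrow> pull I = mu_closure X \<mu> (pull_base I)"
  by (simp add: pull_def Y.mu_locale_simps)

lemma pull_ideal: "is_mu_ideal Y \<nu> I \<Longrightarrow> is_mu_ideal X \<mu> (pull I)"
  by (simp add: pull_eq X.is_mu_ideal_mu_closure compact_ideal_pull_base Y.mu_idealD(1))

lemma pre_in_pull_base: "\<lbrakk>compact_ideal Y I; K \<in> I\<rbrakk> \<Longrightarrow> pre K \<in> pull_base I"
  using pre_compact[OF compact_idealD(1)] by (auto simp: pull_base_def)

text \<open>Together with \<open>push_ideal\<close> this exhibits a right adjoint of \<open>pull\<close>, which therefore preserves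
  suprema.\<close>

lemma pull_le_iff:
  assumes I: "is_mu_ideal Y \<nu> I" and J: "is_mu_ideal X \<mu> J"
  shows "pull I \<subseteq> J \<longleftrightarrow> (\<forall>K\<in>I. pre K \<in> J)"
proof
  note cI = Y.mu_idealD(1)[OF I]
  have "pre K \<in> pull I" if "K \<in> I" for K
    using pre_in_pull_base[OF cI that] pre_compact[OF compact_idealD(1)[OF cI that]] I
    by (simp add: pull_eq X.in_mu_closure)
  then show "\<forall>K\<in>I. pre K \<in> J" if "pull I \<subseteq> J" using that by auto
  show "pull I \<subseteq> J" if *: "\<forall>K\<in>I. pre K \<in> J"
    unfolding pull_eq[OF I]
  proof (rule X.mu_closure_least[OF J], rule)
    fix C assume "C \<in> pull_base I"
    then obtain K where "K \<in> I" "compactin X C" "C \<subseteq> pre K" by (auto simp: pull_base_def)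
    then show "C \<in> J" using * compact_idealD(4)[OF X.mu_idealD(1)[OF J], of "pre K" C] by simp
  qed
qed

lemma push_ideal:
  assumes J: "is_mu_ideal X \<mu> J" shows "is_mu_ideal Y \<nu> {K. compactin Y K \<and> pre K \<in> J}"
    (is "is_mu_ideal Y \<nu> ?P")
proof (rule Y.mu_idealI)
  note D = compact_idealD[OF X.mu_idealD(1)[OF J]]
  show "{} \<in> ?P" using D(2) by (simp add: pre_def)
  show "K \<union> C \<in> ?P" if "K \<in> ?P" "C \<in> ?P" for K C
    using that D(3)[of "pre K" "pre C"] by (simp add: pre_Un compactin_Un)
  show "C \<in> ?P" if "K \<in> ?P" "compactin Y C" "C \<subseteq> K" for K C
    using that D(4)[of "pre K" "pre C"] by (simp add: pre_mono pre_compact)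
  show "K \<in> ?P" if K: "compactin Y K" and a: "\<And>\<epsilon>. \<epsilon> > 0 \<Longrightarrow> \<exists>C\<in>?P. C \<subseteq> K \<and> \<nu> K - \<nu> C < \<epsilon>" for K
  proof -
    have "pre K \<in> J"
    proof (rule X.mu_idealD(2)[OF J pre_compact[OF K]])
      fix \<epsilon> :: real assume "\<epsilon> > 0"
      from a[OF this] obtain C where "compactin Y C" "pre C \<in> J" "C \<subseteq> K" "\<nu> K - \<nu> C < \<epsilon>" by auto
      then show "\<exists>B\<in>J. B \<subseteq> pre K \<and> \<mu> (pre K) - \<mu> B < \<epsilon>"
        using K by (intro bexI[of _ "pre C"]) (simp_all add: pre_measure pre_mono)
    qed
    then show ?thesis using K by simp
  qed
qed simp

text \<open>Suprema are handled by the right adjoint. For the top element, a compact \<open>C\<close> lies in the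
  preimage of its compact image. For meets, \<open>mu_closure_Int\<close> reduces the claim to the generating
  ideals.\<close>

lemma frame_map_pull: "frame_map (mu_locale X \<mu>) (mu_locale Y \<nu>) pull"
proof -
  have "frame_hom (mu_locale Y \<nu>) (mu_locale X \<mu>) pull"
  proof (rule frame_homI[OF Y.complete_lattice_mu X.complete_lattice_mu])
    show "pull \<in> carrier (mu_locale Y \<nu>) \<rightarrow>\<^sub>E carrier (mu_locale X \<mu>)"
      using pull_ideal by (auto simp: X.mu_locale_simps Y.mu_locale_simps pull_def)
    show "pull (\<Squnion>\<^bsub>mu_locale Y \<nu>\<^esub>A) = \<Squnion>\<^bsub>mu_locale X \<mu>\<^esub>(pull ` A)"
      if A: "A \<subseteq> carrier (mu_locale Y \<nu>)" for A
    proof (rule X.mu.sup_eqI[symmetric])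
      have id: "is_mu_ideal Y \<nu> I" if "I \<in> A" for I using A that by (auto simp: Y.mu_locale_simps)
      let ?S = "\<Squnion>\<^bsub>mu_locale Y \<nu>\<^esub>A"
      have idS: "is_mu_ideal Y \<nu> ?S"
        using Y.mu.weak.sup_closed[OF A] by (simp add: Y.mu_locale_simps)
      show "pull ` A \<subseteq> carrier (mu_locale X \<mu>)" using id pull_ideal by (auto simp: X.mu_locale_simps)
      show "pull ?S \<in> carrier (mu_locale X \<mu>)" using idS pull_ideal by (simp add: X.mu_locale_simps)
      show "a \<sqsubseteq>\<^bsub>mu_locale X \<mu>\<^esub> pull ?S" if "a \<in> pull ` A" for a
      proof -
        obtain I where I: "I \<in> A" "a = pull I" using \<open>a \<in> pull ` A\<close> by auto
        have "I \<subseteq> ?S" using Y.mu.sup_upper[OF A I(1)] by (simp add: Y.mu_locale_simps)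
        moreover have "\<forall>K\<in>?S. pre K \<in> pull ?S" using pull_le_iff[OF idS pull_ideal[OF idS]] by simp
        ultimately show ?thesis
          using I pull_le_iff[OF id[OF I(1)] pull_ideal[OF idS]] by (auto simp: X.mu_locale_simps)
      qed
      show "pull ?S \<sqsubseteq>\<^bsub>mu_locale X \<mu>\<^esub> J"
        if "J \<in> carrier (mu_locale X \<mu>)" "\<And>a. a \<in> pull ` A \<Longrightarrow> a \<sqsubseteq>\<^bsub>mu_locale X \<mu>\<^esub> J" for J
      proof -
        have J: "is_mu_ideal X \<mu> J" using that(1) by (simp add: X.mu_locale_simps)
        let ?P = "{K. compactin Y K \<and> pre K \<in> J}"
        have P: "?P \<in> carrier (mu_locale Y \<nu>)" using push_ideal[OF J] by (simp add: Y.mu_locale_simps)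
        have "I \<sqsubseteq>\<^bsub>mu_locale Y \<nu>\<^esub> ?P" if I: "I \<in> A" for I
        proof -
          have "pull I \<subseteq> J" using \<open>\<And>a. a \<in> pull ` A \<Longrightarrow> a \<sqsubseteq>\<^bsub>mu_locale X \<mu>\<^esub> J\<close> I
            by (simp add: X.mu_locale_simps)
          then show ?thesis
            using pull_le_iff[OF id[OF I] J] compact_idealD(1)[OF Y.mu_idealD(1)[OF id[OF I]]]
            by (auto simp: Y.mu_locale_simps)
        qed
        then have "?S \<subseteq> ?P" using Y.mu.sup_least[OF A P] by (simp add: Y.mu_locale_simps)
        then have "pull ?S \<subseteq> J" using pull_le_iff[OF idS J] by auto
        then show ?thesis by (simp add: X.mu_locale_simps)
      qed
    qed
    have top: "compactin X C \<Longrightarrow> C \<in> pull_base {K. compactin Y K}" for C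
      using image_compactin[OF _ cont, of C] compactin_subset_topspace[of X C]
      by (auto simp: pull_base_def pre_def intro!: exI[of _ "f ` C"])
    then have "pull {K. compactin Y K} = {K. compactin X K}"
      using compact_idealD(1)[OF X.mu_idealD(1)[OF pull_ideal[OF Y.is_mu_ideal_compacts]]]
      by (auto simp: pull_eq Y.is_mu_ideal_compacts X.in_mu_closure)
    then show "pull \<top>\<^bsub>mu_locale Y \<nu>\<^esub> = \<top>\<^bsub>mu_locale X \<mu>\<^esub>"
      by (simp add: X.mu_top Y.mu_top)
    show "pull (I \<sqinter>\<^bsub>mu_locale Y \<nu>\<^esub> J) = pull I \<sqinter>\<^bsub>mu_locale X \<mu>\<^esub> pull J"
      if "I \<in> carrier (mu_locale Y \<nu>)" "J \<in> carrier (mu_locale Y \<nu>)" for I J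
    proof -
      have id: "is_mu_ideal Y \<nu> I" "is_mu_ideal Y \<nu> J" using that by (simp_all add: Y.mu_locale_simps)
      note cI = compact_idealD[OF Y.mu_idealD(1)[OF id(1)]] and cJ = compact_idealD[OF Y.mu_idealD(1)[OF id(2)]]
      have idI: "is_mu_ideal Y \<nu> (I \<inter> J)"
        using Y.mu.meet_closed[OF that] by (simp add: Y.mu_meet[OF id]) (simp add: Y.mu_locale_simps)
      have "pull_base I \<inter> pull_base J = pull_base (I \<inter> J)"
      proof (intro equalityI subsetI)
        fix C assume "C \<in> pull_base I \<inter> pull_base J"
        then obtain A B where AB: "compactin X C" "A \<in> I" "B \<in> J" "C \<subseteq> pre A" "C \<subseteq> pre B"
          by (auto simp: pull_base_def)
        have "compactin Y (A \<inter> B)" using cI(1)[OF AB(2)] cJ(1)[OF AB(3)] by (rule Y.compact_Int)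
        then have "A \<inter> B \<in> I \<inter> J" using cI(4)[OF AB(2)] cJ(4)[OF AB(3)] by simp
        moreover have "C \<subseteq> pre (A \<inter> B)" using AB(4,5) by (auto simp: pre_def)
        ultimately show "C \<in> pull_base (I \<inter> J)"
          unfolding pull_base_def using AB(1) by (intro CollectI conjI bexI[of _ "A \<inter> B"])
      qed (auto simp: pull_base_def)
      then have "pull I \<inter> pull J = pull (I \<inter> J)"
        using X.mu_closure_Int[of "pull_base I" "pull_base J"] id idI
        by (simp add: pull_eq compact_ideal_pull_base Y.mu_idealD(1))
      then show ?thesis using id pull_ideal by (simp add: X.mu_meet Y.mu_meet)
    qed
  qed
  then show ?thesis by unfold_locales
qed

lemma inner_measure_pull:
  assumes "I \<in> carrier (mu_locale Y \<nu>)"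
  shows "inner_measure X \<mu> (pull I) = inner_measure Y \<nu> I"
proof -
  have I: "is_mu_ideal Y \<nu> I" using assms by (simp add: Y.mu_locale_simps)
  note cI = Y.mu_idealD(1)[OF I]
  have "inner_measure X \<mu> (pull I) = (SUP C\<in>mu_closure X \<mu> (pull_base I). ennreal (\<mu> C))"
    using pull_ideal[OF I] by (simp add: inner_measure_def X.mu_locale_simps pull_eq[OF I])
  also have "\<dots> = (SUP C\<in>pull_base I. ennreal (\<mu> C))"
    by (rule X.SUP_mu_closure) (simp add: pull_base_def)
  also have "\<dots> = (SUP K\<in>I. ennreal (\<nu> K))"
  proof (rule antisym)
    show "(SUP C\<in>pull_base I. ennreal (\<mu> C)) \<le> (SUP K\<in>I. ennreal (\<nu> K))"
    proof (rule SUP_mono)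
      fix C assume "C \<in> pull_base I"
      then obtain K where K: "K \<in> I" "compactin X C" "C \<subseteq> pre K" by (auto simp: pull_base_def)
      have kY: "compactin Y K" using compact_idealD(1)[OF cI K(1)] .
      have "\<mu> C \<le> \<nu> K" using X.mono[OF K(2) pre_compact[OF kY] K(3)] pre_measure[OF kY] by simp
      then show "\<exists>K\<in>I. ennreal (\<mu> C) \<le> ennreal (\<nu> K)" using K(1) by (intro bexI ennreal_leI)
    qed
    show "(SUP K\<in>I. ennreal (\<nu> K)) \<le> (SUP C\<in>pull_base I. ennreal (\<mu> C))"
    proof (rule SUP_mono)
      fix K assume K: "K \<in> I"
      then show "\<exists>C\<in>pull_base I. ennreal (\<nu> K) \<le> ennreal (\<mu> C)"
        using pre_in_pull_base[OF cI K] pre_measure[OF compact_idealD(1)[OF cI K]]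
        by (intro bexI[of _ "pre K"]) simp_all
    qed
  qed
  also have "\<dots> = inner_measure Y \<nu> I" using assms by (simp add: inner_measure_def)
  finally show ?thesis .
qed

text \<open>A compact \<open>C\<close> inside \<open>pre V\<close> lies in \<open>pre (f ` C)\<close> with \<open>f ` C\<close> a compact subset of \<open>V\<close>.
  Conversely, an approximation of \<open>K\<close> by compact subsets of \<open>V\<close> pulls back to an approximation
  of \<open>pre K\<close> with the same errors, because \<open>f\<close> preserves measures.\<close>

lemma pull_mu_proj:
  assumes V: "openin Y V" shows "pull (mu_proj Y \<nu> V) = mu_proj X \<mu> (pre V)"
proof -
  have oV: "openin X (pre V)" using cont V by (simp add: pre_def continuous_map_def)
  have idV: "is_mu_ideal Y \<nu> (mu_proj Y \<nu> V)"
    using frame_map.f_closed[OF Y.frame_map_mu_proj, of V] V by (simp add: Y.mu_locale_simps opens_simps)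
  have idP: "is_mu_ideal X \<mu> (mu_proj X \<mu> (pre V))"
    using frame_map.f_closed[OF X.frame_map_mu_proj, of "pre V"] oV by (simp add: X.mu_locale_simps opens_simps)
  show ?thesis
  proof
    have "pre K \<in> mu_proj X \<mu> (pre V)" if K: "K \<in> mu_proj Y \<nu> V" for K
    proof -
      have Kc: "compactin Y K" using K V by (simp add: Y.mu_proj_eq mu_closure_def)
      show ?thesis
      proof (rule X.mu_idealD(2)[OF idP pre_compact[OF Kc]])
        fix \<epsilon> :: real assume e: "\<epsilon> > 0"
        obtain C where C: "C \<in> {K. compactin Y K \<and> K \<subseteq> V}" "C \<subseteq> K" "\<nu> K - \<nu> C < \<epsilon>"
          using K[unfolded Y.mu_proj_eq[OF V]] e by (rule Y.mu_closureE)
        have "pre C \<in> mu_proj X \<mu> (pre V)"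
          using C(1) pre_mono[of C V] by (simp add: X.mu_proj_eq[OF oV] pre_compact X.in_mu_closure)
        then show "\<exists>B\<in>mu_proj X \<mu> (pre V). B \<subseteq> pre K \<and> \<mu> (pre K) - \<mu> B < \<epsilon>"
          using C Kc by (intro bexI[of _ "pre C"]) (simp_all add: pre_measure pre_mono)
      qed
    qed
    then show "pull (mu_proj Y \<nu> V) \<subseteq> mu_proj X \<mu> (pre V)"
      using pull_le_iff[OF idV idP] by simp
    have "{C. compactin X C \<and> C \<subseteq> pre V} \<subseteq> pull (mu_proj Y \<nu> V)"
    proof
      fix C assume "C \<in> {C. compactin X C \<and> C \<subseteq> pre V}"
      then have C: "compactin X C" "C \<subseteq> pre V" by auto
      have fC: "compactin Y (f ` C)" using C(1) cont by (rule image_compactin)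
      have "f ` C \<in> mu_proj Y \<nu> V"
        using fC C(2) by (auto simp: Y.mu_proj_eq[OF V] pre_def intro!: Y.in_mu_closure)
      moreover have "C \<subseteq> pre (f ` C)" using compactin_subset_topspace[OF C(1)] by (auto simp: pre_def)
      ultimately have "C \<in> pull_base (mu_proj Y \<nu> V)" using C(1) by (auto simp: pull_base_def)
      then show "C \<in> pull (mu_proj Y \<nu> V)" using C(1) by (simp add: pull_eq[OF idV] X.in_mu_closure)
    qed
    then show "mu_proj X \<mu> (pre V) \<subseteq> pull (mu_proj Y \<nu> V)"
      using X.mu_closure_least[OF pull_ideal[OF idV]] by (simp add: X.mu_proj_eq[OF oV])
  qed
qed

text \<open>The commuting square of the introduction: both composites are frame homomorphisms out of the frame
  of sublocales of \<open>Y\<close> and agree on closed sublocales.\<close>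

lemma pushforward_Sl_measure:
  "pushforward (Sl (opens Y)) (\<lambda>T\<in>carrier (Sl (opens Y)). preim (opens X) (opens Y) (opens_map X Y f) T)
     (Sl_measure X \<mu>) = Sl_measure Y \<nu>"
proof -
  interpret f: frame_map "opens X" "opens Y" "opens_map X Y f" using cont by (rule frame_map_opens)
  interpret lX: frame_map "mu_locale X \<mu>" "Sl (opens X)" "Sl_lift (opens X) (mu_locale X \<mu>) (mu_proj X \<mu>)"
    by (rule X.Sl_lift_mu(1))
  interpret lY: frame_map "mu_locale Y \<nu>" "Sl (opens Y)" "Sl_lift (opens Y) (mu_locale Y \<nu>) (mu_proj Y \<nu>)"
    by (rule Y.Sl_lift_mu(1))
  interpret p: frame_map "mu_locale X \<mu>" "mu_locale Y \<nu>" pull by (rule frame_map_pull)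
  let ?S = "Sl (opens Y)"
  let ?f = "\<lambda>T\<in>carrier ?S. preim (opens X) (opens Y) (opens_map X Y f) T"
  let ?lX = "Sl_lift (opens X) (mu_locale X \<mu>) (mu_proj X \<mu>)"
  let ?lY = "Sl_lift (opens Y) (mu_locale Y \<nu>) (mu_proj Y \<nu>)"
  have eq: "(\<lambda>T\<in>carrier ?S. ?lX (?f T)) = (\<lambda>T\<in>carrier ?S. pull (?lY T))"
  proof (rule f.M.frame_hom_Sl_unique[OF X.frame_mu])
    show "frame_hom ?S (mu_locale X \<mu>) (\<lambda>T\<in>carrier ?S. ?lX (?f T))"
      by (rule frame_hom_compose[OF f.M.complete_lattice_Sl f.L.complete_lattice_Sl
            X.complete_lattice_mu f.frame_hom_preim lX.hom])
    show "frame_hom ?S (mu_locale X \<mu>) (\<lambda>T\<in>carrier ?S. pull (?lY T))"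
      by (rule frame_hom_compose[OF f.M.complete_lattice_Sl Y.complete_lattice_mu
            X.complete_lattice_mu lY.hom p.hom])
    fix U assume U: "U \<in> carrier (opens Y)"
    then have oU: "openin Y U" by (simp add: opens_simps)
    have c: "can (opens Y) U \<in> carrier ?S" using U by (simp add: f.M.carrier_Sl f.M.sublocale_of_can)
    have om: "opens_map X Y f U = pre U" using U by (simp add: opens_map_def pre_def)
    have oP: "openin X (pre U)" using cont oU by (simp add: pre_def continuous_map_def)
    show "(\<lambda>T\<in>carrier ?S. ?lX (?f T)) (can (opens Y) U) = (\<lambda>T\<in>carrier ?S. pull (?lY T)) (can (opens Y) U)"
      using c U oU oP by (simp add: f.preim_can om X.Sl_lift_mu(2) Y.Sl_lift_mu(2) pull_mu_proj)
  qed
  show ?thesis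
  proof (rule extensionalityI[of _ "carrier ?S"])
    fix T assume T: "T \<in> carrier ?S"
    have fT: "?f T \<in> carrier (Sl (opens X))"
      using frame_hom_closed[OF f.frame_hom_preim T] .
    have "pushforward ?S ?f (Sl_measure X \<mu>) T = inner_measure X \<mu> (?lX (?f T))"
      using T fT by (simp add: Sl_measure_def pushforward_def)
    also have "?lX (?f T) = pull (?lY T)" using fun_cong[OF eq, of T] T by simp
    also have "inner_measure X \<mu> (pull (?lY T)) = inner_measure Y \<nu> (?lY T)"
      using T by (intro inner_measure_pull) simp
    also have "\<dots> = Sl_measure Y \<nu> T" using T by (simp add: Sl_measure_def pushforward_def)
    finally show "pushforward ?S ?f (Sl_measure X \<mu>) T = Sl_measure Y \<nu> T" .
  qed (simp_all add: pushforward_def Sl_measure_def)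
qed

end

section \<open>The functors\<close>

lemma Hom_Loc: "h \<in> Hom Loc L M \<longleftrightarrow> frame_hom M L h"
  by (simp add: Loc_def)

lemma frame_homD:
  assumes "frame_hom L M h" shows "h \<in> extensional (carrier L)" "x \<in> carrier L \<Longrightarrow> h x \<in> carrier M"
  using assms by (auto simp: frame_hom_def PiE_def)

lemma is_category_Loc: "is_category (Loc :: ('a gorder, 'a \<Rightarrow> 'a) cat)"
  unfolding is_category_def
proof (intro conjI ballI)
  have cl: "complete_lattice L" if "L \<in> Obj Loc" for L :: "'a gorder"
    using that by (simp add: Loc_def frame_def)
  fix K L M N :: "'a gorder" and f g h
  assume K: "K \<in> Obj Loc"
  show "Ident Loc K \<in> Hom Loc K K"
    using frame_hom_ident[OF cl[OF K]] by (simp add: Loc_def)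
  assume L: "L \<in> Obj Loc" and f: "f \<in> Hom Loc K L"
  note f' = frame_homD[OF f[unfolded Hom_Loc]]
  show "Comp Loc K K L f (Ident Loc K) = f" "Comp Loc K L L (Ident Loc L) f = f"
    using f' by (auto simp: Loc_def intro!: extensionalityI[of _ "carrier L"])
  assume M: "M \<in> Obj Loc" and g: "g \<in> Hom Loc L M"
  note g' = frame_homD[OF g[unfolded Hom_Loc]]
  show "Comp Loc K L M g f \<in> Hom Loc K M"
    using frame_hom_compose[OF cl[OF M] cl[OF L] cl[OF K] g[unfolded Hom_Loc] f[unfolded Hom_Loc]]
    by (simp add: Loc_def)
  assume N: "N \<in> Obj Loc" and h: "h \<in> Hom Loc M N"
  note h' = frame_homD[OF h[unfolded Hom_Loc]]
  show "Comp Loc K L N (Comp Loc L M N h g) f = Comp Loc K M N h (Comp Loc K L M g f)"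
    using h' by (auto simp: Loc_def)
qed

lemma MeasLoc_simps:
  "(L, \<nu>) \<in> Obj MeasLoc_glob \<longleftrightarrow> L \<in> Obj Loc \<and> is_loc_measure L \<nu>"
  "f \<in> Hom MeasLoc_glob (L, \<nu>) (M, \<nu>') \<longleftrightarrow> f \<in> Hom Loc L M \<and> pushforward M f \<nu> = \<nu>'"
  "Ident MeasLoc_glob (L, \<nu>) = Ident Loc L"
  "Comp MeasLoc_glob (L, \<nu>) (M, \<nu>') (N, \<nu>'') = Comp Loc L M N"
  by (simp_all add: MeasLoc_glob_def Loc_def)

lemma is_category_MeasLoc: "is_category (MeasLoc_glob :: ('a gorder \<times> ('a \<Rightarrow> ennreal), 'a \<Rightarrow> 'a) cat)"
proof -
  have "is_category (Loc :: ('a gorder, 'a \<Rightarrow> 'a) cat)" by (rule is_category_Loc)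
  note Loc = this[unfolded is_category_def]
  have ident: "pushforward L (Ident Loc L) \<nu> = \<nu>" if "is_loc_measure L \<nu>" for L :: "'a gorder" and \<nu>
    using that by (intro extensionalityI[of _ "carrier L"])
      (auto simp: pushforward_def Loc_def is_loc_measure_def)
  have comp: "pushforward N (Comp Loc L M N g f) \<nu> = pushforward N g (pushforward M f \<nu>)"
    if "g \<in> Hom Loc M N" for L M N :: "'a gorder" and f g \<nu>
    using frame_homD(2)[OF that[unfolded Hom_Loc]] by (auto simp: pushforward_def Loc_def)
  show ?thesis
    unfolding is_category_def
  proof (intro conjI ballI)
    fix K L M N :: "'a gorder \<times> ('a \<Rightarrow> ennreal)" and f g h
    obtain K' \<kappa> L' l M' \<mu> N' \<nu> where [simp]: "K = (K', \<kappa>)" "L = (L', l)" "M = (M', \<mu>)" "N = (N', \<nu>)"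
      by (metis surj_pair)
    assume K: "K \<in> Obj MeasLoc_glob"
    show "Ident MeasLoc_glob K \<in> Hom MeasLoc_glob K K"
      using K Loc ident by (simp add: MeasLoc_simps)
    assume L: "L \<in> Obj MeasLoc_glob" and f: "f \<in> Hom MeasLoc_glob K L"
    show "Comp MeasLoc_glob K K L f (Ident MeasLoc_glob K) = f"
      "Comp MeasLoc_glob K L L (Ident MeasLoc_glob L) f = f"
      using K L f Loc by (simp_all add: MeasLoc_simps)
    assume M: "M \<in> Obj MeasLoc_glob" and g: "g \<in> Hom MeasLoc_glob L M"
    show "Comp MeasLoc_glob K L M g f \<in> Hom MeasLoc_glob K M"
      using K L M f g Loc by (simp add: MeasLoc_simps comp)
    assume N: "N \<in> Obj MeasLoc_glob" and h: "h \<in> Hom MeasLoc_glob M N"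
    show "Comp MeasLoc_glob K L N (Comp MeasLoc_glob L M N h g) f
        = Comp MeasLoc_glob K M N h (Comp MeasLoc_glob K L M g f)"
      using K L M N f g h Loc by (simp add: MeasLoc_simps)
  qed
qed

lemma is_functor_forget_measure: "is_functor MeasLoc_glob Loc forget_measure"
  unfolding is_functor_def
  by (auto simp: is_category_Loc is_category_MeasLoc forget_measure_def MeasLoc_simps)

lemma Rad_Obj: "(X, \<mu>) \<in> Obj RadHausSpc_glob \<longleftrightarrow> radon X \<mu>"
  by (simp add: RadHausSpc_glob_def radon_def)

lemma Rad_Hom:
  assumes "radon X \<mu>" "radon Y \<nu>"
  shows "f \<in> Hom RadHausSpc_glob (X, \<mu>) (Y, \<nu>) \<longleftrightarrow> f \<in> extensional (topspace X) \<and> radon_map X \<mu> Y \<nu> f"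
  using assms by (auto simp: RadHausSpc_glob_def radon_map_def radon_map_axioms_def)

lemma Rad_simps:
  "Ident RadHausSpc_glob (X, \<mu>) = (\<lambda>x\<in>topspace X. x)"
  "Comp RadHausSpc_glob (X, \<mu>) b c g f = compose (topspace X) g f"
  by (simp_all add: RadHausSpc_glob_def)

lemma radon_map_compose:
  assumes "radon_map X \<mu> Y \<nu> f" "radon_map Y \<nu> Z \<rho> g"
  shows "radon_map X \<mu> Z \<rho> (compose (topspace X) g f)"
proof -
  interpret f: radon_map X \<mu> Y \<nu> f by fact
  interpret g: radon_map Y \<nu> Z \<rho> g by fact
  have fY: "f x \<in> topspace Y" if "x \<in> topspace X" for x
    using f.cont that by (auto simp: continuous_map_def)
  have pre: "{x \<in> topspace X. compose (topspace X) g f x \<in> K}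
      = {x \<in> topspace X. f x \<in> {y \<in> topspace Y. g y \<in> K}}" for K
    using fY by (auto simp: compose_def)
  show ?thesis
  proof
    show "continuous_map X Z (compose (topspace X) g f)"
      using continuous_map_compose[OF f.cont g.cont]
      by (rule continuous_map_eq) (simp add: compose_def)
    show "compactin X {x \<in> topspace X. compose (topspace X) g f x \<in> K}" if "compactin Z K" for K
      unfolding pre using that by (intro f.proper g.proper)
    show "\<mu> {x \<in> topspace X. compose (topspace X) g f x \<in> K} = \<rho> K" if "compactin Z K" for K
      unfolding pre using that by (simp only: f.preserving[OF g.proper] g.preserving)
  qed
qed

lemma radon_map_ident:
  assumes "radon X \<mu>" shows "radon_map X \<mu> X \<mu> (\<lambda>x\<in>topspace X. x)"
proof -
  interpret radon X \<mu> by fact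
  have pre: "{x \<in> topspace X. (\<lambda>x\<in>topspace X. x) x \<in> K} = K" if "compactin X K" for K
    using compactin_subset_topspace[OF that] by auto
  show ?thesis
  proof
    show "continuous_map X X (\<lambda>x\<in>topspace X. x)"
      by (rule continuous_map_eq[OF continuous_map_id]) simp
    show "compactin X {x \<in> topspace X. (\<lambda>x\<in>topspace X. x) x \<in> K}" if "compactin X K" for K
      unfolding pre[OF that] by (rule that)
    show "\<mu> {x \<in> topspace X. (\<lambda>x\<in>topspace X. x) x \<in> K} = \<mu> K" if "compactin X K" for K
      unfolding pre[OF that] by (rule HOL.refl)
  qed
qed

lemma is_category_Rad:
  "is_category (RadHausSpc_glob :: ('a topology \<times> ('a set \<Rightarrow> real), 'a \<Rightarrow> 'a) cat)"
  unfolding is_category_def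
proof (intro conjI ballI)
  fix K L M N :: "'a topology \<times> ('a set \<Rightarrow> real)" and f g h
  obtain K' \<kappa> L' l M' \<mu> N' \<nu> where [simp]: "K = (K', \<kappa>)" "L = (L', l)" "M = (M', \<mu>)" "N = (N', \<nu>)"
    by (metis surj_pair)
  assume "K \<in> Obj RadHausSpc_glob"
  then have K: "radon K' \<kappa>" by (simp add: Rad_Obj)
  show "Ident RadHausSpc_glob K \<in> Hom RadHausSpc_glob K K"
    using K by (simp add: Rad_Hom Rad_simps radon_map_ident)
  assume "L \<in> Obj RadHausSpc_glob" and "f \<in> Hom RadHausSpc_glob K L"
  then have L: "radon L' l" and f: "f \<in> extensional (topspace K')" "radon_map K' \<kappa> L' l f"
    using K by (simp_all add: Rad_Obj Rad_Hom)
  have fL: "f x \<in> topspace L'" if "x \<in> topspace K'" for x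
    using radon_map.cont[OF f(2)] that by (auto simp: continuous_map_def)
  show "Comp RadHausSpc_glob K K L f (Ident RadHausSpc_glob K) = f"
    "Comp RadHausSpc_glob K L L (Ident RadHausSpc_glob L) f = f"
    using f(1) fL by (auto simp: Rad_simps compose_def intro!: extensionalityI[of _ "topspace K'"])
  assume "M \<in> Obj RadHausSpc_glob" and "g \<in> Hom RadHausSpc_glob L M"
  then have M: "radon M' \<mu>" and g: "radon_map L' l M' \<mu> g"
    using L by (simp_all add: Rad_Obj Rad_Hom)
  show "Comp RadHausSpc_glob K L M g f \<in> Hom RadHausSpc_glob K M"
    using K M radon_map_compose[OF f(2) g] by (simp add: Rad_Hom Rad_simps)
  show "Comp RadHausSpc_glob K L N (Comp RadHausSpc_glob L M N h g) f
      = Comp RadHausSpc_glob K M N h (Comp RadHausSpc_glob K L M g f)"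
    using fL by (auto simp: Rad_simps compose_def)
qed

lemma Sl_functor_simps:
  "on_obj Sl_functor (X, \<mu>) = Sl (opens X)"
  "on_arr Sl_functor (X, \<mu>) (Y, \<nu>) f = Sl_map (opens X) (opens Y) (opens_map X Y f)"
  by (simp_all add: Sl_functor_def)

lemma Sl_map_opens:
  assumes "continuous_map X Y f"
  shows "Sl_map (opens X) (opens Y) (opens_map X Y f)
    = (\<lambda>T\<in>carrier (Sl (opens Y)). preim (opens X) (opens Y) (opens_map X Y f) T)"
  by (rule Sl_map_eq[OF frame_map_opens[OF assms]])

lemma Sl_map_ident:
  "Sl_map (opens X) (opens X) (opens_map X X (\<lambda>x\<in>topspace X. x)) = Ident Loc (Sl (opens X))"
proof -
  interpret O: plain_frame "opens X" by (rule plain_frame.intro[OF frame_opens])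
  have "opens_map X X (\<lambda>x\<in>topspace X. x) = (\<lambda>U\<in>carrier (opens X). U)"
    unfolding opens_map_def by (rule restrict_ext) (auto simp: opens_simps dest: openin_subset)
  then have "Sl_map (opens X) (opens X) (opens_map X X (\<lambda>x\<in>topspace X. x))
    = (\<lambda>T\<in>carrier (Sl (opens X)). preim (opens X) (opens X) (\<lambda>U\<in>carrier (opens X). U) T)"
    using Sl_map_eq[OF O.frame_map_ident] by simp
  also have "\<dots> = (\<lambda>T\<in>carrier (Sl (opens X)). T)"
    by (rule restrict_ext) (simp add: O.carrier_Sl sublocale_of.preim_ident)
  finally show ?thesis by (simp add: Loc_def)
qed

lemma Sl_map_compose:
  assumes f: "continuous_map X Y f" and g: "continuous_map Y Z g"
  shows "Sl_map (opens X) (opens Z) (opens_map X Z (compose (topspace X) g f))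
    = Comp Loc (Sl (opens X)) (Sl (opens Y)) (Sl (opens Z))
        (Sl_map (opens Y) (opens Z) (opens_map Y Z g)) (Sl_map (opens X) (opens Y) (opens_map X Y f))"
proof -
  note fm = frame_map_opens[OF f] and gm = frame_map_opens[OF g]
  interpret f: frame_map "opens X" "opens Y" "opens_map X Y f" by (rule fm)
  interpret g: frame_map "opens Y" "opens Z" "opens_map Y Z g" by (rule gm)
  have eq: "opens_map X Z (compose (topspace X) g f)
    = (\<lambda>W\<in>carrier (opens Z). opens_map X Y f (opens_map Y Z g W))"
    unfolding opens_map_def[of X Z]
  proof (rule restrict_ext)
    fix W assume W: "W \<in> carrier (opens Z)"
    have "opens_map Y Z g W \<in> carrier (opens Y)" using W by simp
    then show "{x \<in> topspace X. compose (topspace X) g f x \<in> W} = opens_map X Y f (opens_map Y Z g W)"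
      using W f by (auto simp: opens_map_def compose_def continuous_map_def)
  qed
  show ?thesis
    unfolding eq Sl_map_eq[OF frame_map_compose[OF fm gm]] Sl_map_eq[OF fm] Sl_map_eq[OF gm]
      preim_compose[OF fm gm]
    unfolding Loc_def cat.simps
    by (rule restrict_ext) (simp add: g.M.carrier_Sl f.M.carrier_Sl g.sublocale_of_preim)
qed

lemma is_functor_Sl_functor: "is_functor RadHausSpc_glob Loc Sl_functor"
  unfolding is_functor_def
proof (intro conjI ballI)
  fix K L M :: "'a topology \<times> ('a set \<Rightarrow> real)" and f g
  obtain X \<mu> Y \<nu> Z \<rho> where [simp]: "K = (X, \<mu>)" "L = (Y, \<nu>)" "M = (Z, \<rho>)"
    by (metis surj_pair)
  assume "K \<in> Obj RadHausSpc_glob"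
  then have X: "radon X \<mu>" by (simp add: Rad_Obj)
  interpret O: plain_frame "opens X" by (rule plain_frame.intro[OF frame_opens])
  show "on_obj Sl_functor K \<in> Obj Loc"
    using O.frame_Sl by (simp add: Sl_functor_simps Loc_def)
  show "on_arr Sl_functor K K (Ident RadHausSpc_glob K) = Ident Loc (on_obj Sl_functor K)"
    by (simp add: Sl_functor_simps Rad_simps Sl_map_ident)
  assume "L \<in> Obj RadHausSpc_glob" and "f \<in> Hom RadHausSpc_glob K L"
  then have Y: "radon Y \<nu>" and f: "radon_map X \<mu> Y \<nu> f"
    using X by (simp_all add: Rad_Obj Rad_Hom)
  note fc = radon_map.cont[OF f]
  show "on_arr Sl_functor K L f \<in> Hom Loc (on_obj Sl_functor K) (on_obj Sl_functor L)"
    using frame_map.frame_hom_preim[OF frame_map_opens[OF fc]]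
    by (simp add: Sl_functor_simps Hom_Loc Sl_map_opens[OF fc])
  assume "M \<in> Obj RadHausSpc_glob" and "g \<in> Hom RadHausSpc_glob L M"
  then have g: "radon_map Y \<nu> Z \<rho> g"
    using Y by (simp add: Rad_Obj Rad_Hom)
  show "on_arr Sl_functor K M (Comp RadHausSpc_glob K L M g f)
      = Comp Loc (on_obj Sl_functor K) (on_obj Sl_functor L) (on_obj Sl_functor M)
          (on_arr Sl_functor L M g) (on_arr Sl_functor K L f)"
    by (simp add: Sl_functor_simps Rad_simps Sl_map_compose[OF fc radon_map.cont[OF g]])
qed (rule is_category_Rad is_category_Loc)+

definition measured_Sl_functor ::
    "('a topology \<times> ('a set \<Rightarrow> real), 'a \<Rightarrow> 'a,
      'a set set gorder \<times> ('a set set \<Rightarrow> ennreal), 'a set set \<Rightarrow> 'a set set) fctor" where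
  "measured_Sl_functor =
     \<lparr>on_obj = (\<lambda>(X, \<mu>). (Sl (opens X), Sl_measure X \<mu>)), on_arr = on_arr Sl_functor\<rparr>"

lemma measured_Sl_functor_simps:
  "on_obj measured_Sl_functor (X, \<mu>) = (Sl (opens X), Sl_measure X \<mu>)"
  "on_arr measured_Sl_functor = on_arr Sl_functor"
  by (simp_all add: measured_Sl_functor_def)

lemma is_functor_measured_Sl_functor: "is_functor RadHausSpc_glob MeasLoc_glob measured_Sl_functor"
  unfolding is_functor_def
proof (intro conjI ballI)
  fix K L M :: "'a topology \<times> ('a set \<Rightarrow> real)" and f g
  obtain X \<mu> Y \<nu> Z \<rho> where [simp]: "K = (X, \<mu>)" "L = (Y, \<nu>)" "M = (Z, \<rho>)"
    by (metis surj_pair)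
  assume K: "K \<in> Obj RadHausSpc_glob"
  then have X: "radon X \<mu>" by (simp add: Rad_Obj)
  interpret O: plain_frame "opens X" by (rule plain_frame.intro[OF frame_opens])
  show "on_obj measured_Sl_functor K \<in> Obj MeasLoc_glob"
    using O.frame_Sl radon.is_loc_measure_Sl[OF X] by (simp add: measured_Sl_functor_simps MeasLoc_simps Loc_def)
  show "on_arr measured_Sl_functor K K (Ident RadHausSpc_glob K) = Ident MeasLoc_glob (on_obj measured_Sl_functor K)"
    by (simp add: measured_Sl_functor_simps Sl_functor_simps Rad_simps Sl_map_ident MeasLoc_simps)
  assume L: "L \<in> Obj RadHausSpc_glob" and fH: "f \<in> Hom RadHausSpc_glob K L"
  then have Y: "radon Y \<nu>" and f: "radon_map X \<mu> Y \<nu> f"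
    using X by (simp_all add: Rad_Obj Rad_Hom)
  note fc = radon_map.cont[OF f]
  show "on_arr measured_Sl_functor K L f \<in> Hom MeasLoc_glob (on_obj measured_Sl_functor K) (on_obj measured_Sl_functor L)"
    using frame_map.frame_hom_preim[OF frame_map_opens[OF fc]] radon_map.pushforward_Sl_measure[OF f]
    by (simp add: measured_Sl_functor_simps Sl_functor_simps MeasLoc_simps Hom_Loc Sl_map_opens[OF fc])
  assume "M \<in> Obj RadHausSpc_glob" and "g \<in> Hom RadHausSpc_glob L M"
  then have g: "radon_map Y \<nu> Z \<rho> g"
    using Y by (simp add: Rad_Obj Rad_Hom)
  show "on_arr measured_Sl_functor K M (Comp RadHausSpc_glob K L M g f)
      = Comp MeasLoc_glob (on_obj measured_Sl_functor K) (on_obj measured_Sl_functor L) (on_obj measured_Sl_functor M)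
          (on_arr measured_Sl_functor L M g) (on_arr measured_Sl_functor K L f)"
    by (simp add: measured_Sl_functor_simps Sl_functor_simps Rad_simps MeasLoc_simps
        Sl_map_compose[OF fc radon_map.cont[OF g]])
qed (rule is_category_Rad is_category_MeasLoc)+

theorem theorem1p7:
  shows "\<exists>F :: ('a topology \<times> ('a set \<Rightarrow> real), 'a \<Rightarrow> 'a,
               'a set set gorder \<times> ('a set set \<Rightarrow> ennreal), 'a set set \<Rightarrow> 'a set set) fctor.
           lifts_along RadHausSpc_glob MeasLoc_glob Loc forget_measure Sl_functor F \<and>
           (\<forall>X \<mu>. (X, \<mu>) \<in> Obj RadHausSpc_glob \<longrightarrow>
              on_obj F (X, \<mu>) = (Sl (opens X), Sl_measure X \<mu>))"
proof (intro exI conjI allI impI)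
  show "lifts_along RadHausSpc_glob MeasLoc_glob Loc forget_measure Sl_functor measured_Sl_functor"
    unfolding lifts_along_def
    using is_functor_measured_Sl_functor is_functor_forget_measure is_functor_Sl_functor
    by (auto simp: forget_measure_def measured_Sl_functor_simps Sl_functor_simps)
qed (rule measured_Sl_functor_simps)

end
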